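(* Let $G$ be a finite simple graph that contains no triangle and no ISK4. Then $G$ is series-parallel, or $G$ is a complete bipartite graph, or $G$ has a clique cutset of size at most two, or $G$ has a wheel decomposition.
   Context: $G$ contains $H$ if $H$ is isomorphic to an induced subgraph of $G$. A subdivision of a graph is obtained by repeatedly replacing an edge $vw$ by a path $vuw$ through a new vertex $u$. An ISK4 is an induced subgraph that is a subdivision of $K_4$. A graph is series-parallel if no subgraph of it is a subdivision of $K_4$. A cutset is a set $C$ of vertices with $G\setminus C$ disconnected. A hole is a chordless cycle of length at least 4. A wheel $(H,x)$ of $G$ is an induced subgraph consisting of a hole $H$ and a vertex $x\notin V(H)$ having at least three neighbors on $H$; let $x_1,\dots,x_n$ be the neighbors of $x$ on $H$ in the order along $H$, and for $i=1,\dots,n$ (indices mod $n$) let the sector $S_i$ be the subpath of $H$ with ends $x_i,x_{i+1}$ whose interior vertices are not adjacent to $x$. With $N[x]=N(x)\cup\{x\}$, $G$ has a wheel decomposition if for some wheel $(H,x)$ of $G$, for every $i\in\{1,\dots,n\}$, the set $(N[x]\setminus V(H))\cup\{x_i,x_{i+1}\}$ is a cutset separating $S_i$ from $H\setminus S_i$. *)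

theory Defs
  imports "Graph_Theory.Graph_Theory"
begin

text \<open>
  A finite simple graph is a \<open>pair_graph\<close>: a finite, symmetric, loop-free digraph whose arcs are
  pairs of vertices, so that an edge is a pair of opposite arcs. Every pair is available as an
  arc name, so the graphs obtained while subdividing are again of this type.
\<close>

definition triangle_free :: "'a pair_pre_digraph \<Rightarrow> bool" where
  "triangle_free G \<longleftrightarrow>
    \<not> (\<exists>H. induced_subgraph (with_proj H) (with_proj G) \<and> complete_digraph 3 (with_proj H))"

text \<open>
  Subdividing only adds vertices, so a copy of \<open>K\<^sub>4\<close> of which \<open>H\<close> is a subdivision can be taken on
  vertices of \<open>H\<close>; no isomorphism is needed.
\<close>

definition K4_subdivision :: "'a pair_pre_digraph \<Rightarrow> bool" where
  "K4_subdivision H \<longleftrightarrow> (\<exists>K. complete_digraph 4 (with_proj K) \<and> subdivision_pair K H)"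

definition ISK4_free :: "'a pair_pre_digraph \<Rightarrow> bool" where
  "ISK4_free G \<longleftrightarrow>
    \<not> (\<exists>H. induced_subgraph (with_proj H) (with_proj G) \<and> K4_subdivision H)"

definition series_parallel :: "'a pair_pre_digraph \<Rightarrow> bool" where
  "series_parallel G \<longleftrightarrow>
    \<not> (\<exists>H. subgraph (with_proj H) (with_proj G) \<and> K4_subdivision H)"

definition complete_bipartite :: "'a pair_pre_digraph \<Rightarrow> bool" where
  "complete_bipartite G \<longleftrightarrow>
    (\<exists>m n. 0 < m \<and> 0 < n \<and> complete_bipartite_digraph m n (with_proj G))"

definition delete_verts :: "'a pair_pre_digraph \<Rightarrow> 'a set \<Rightarrow> ('a, 'a \<times> 'a) pre_digraph" where
  "delete_verts G C = with_proj G \<restriction> (pverts G - C)"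

text \<open>
  The library's \<open>connected\<close> is false for the graph without vertices; deleting all vertices does not
  count as disconnecting the graph.
\<close>

definition cutset :: "'a pair_pre_digraph \<Rightarrow> 'a set \<Rightarrow> bool" where
  "cutset G C \<longleftrightarrow> C \<subset> pverts G \<and> \<not> connected (delete_verts G C)"

text \<open>The empty set is a clique: a disconnected graph has a clique cutset of size zero.\<close>

definition clique :: "'a pair_pre_digraph \<Rightarrow> 'a set \<Rightarrow> bool" where
  "clique G C \<longleftrightarrow> C \<subseteq> pverts G \<and> (\<forall>u\<in>C. \<forall>v\<in>C. u \<noteq> v \<longrightarrow> (u, v) \<in> parcs G)"

text \<open>
  \<open>A\<close> and \<open>B\<close> may meet \<open>C\<close> (the ends of a sector lie in the cutset), but each of them must have a
  vertex outside \<open>C\<close>.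
\<close>

definition separates :: "'a pair_pre_digraph \<Rightarrow> 'a set \<Rightarrow> 'a set \<Rightarrow> 'a set \<Rightarrow> bool" where
  "separates G C A B \<longleftrightarrow> A - C \<noteq> {} \<and> B - C \<noteq> {} \<and>
    (\<forall>a\<in>A - C. \<forall>b\<in>B - C. \<not> a \<rightarrow>\<^sup>*\<^bsub>delete_verts G C\<^esub> b)"

definition nbhd :: "'a pair_pre_digraph \<Rightarrow> 'a \<Rightarrow> 'a set" where
  "nbhd G x = {v. (x, v) \<in> parcs G}"

definition closed_nbhd :: "'a pair_pre_digraph \<Rightarrow> 'a \<Rightarrow> 'a set" where
  "closed_nbhd G x = nbhd G x \<union> {x}"

text \<open>
  A hole is given by its list of arcs, in one of the two directions and from an arbitrary starting
  point; \<open>map fst p\<close> lists its vertices in cyclic order, without repetition.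
\<close>

definition hole :: "'a pair_pre_digraph \<Rightarrow> ('a \<times> 'a) awalk \<Rightarrow> bool" where
  "hole G p \<longleftrightarrow> pre_digraph.cycle (with_proj G) p \<and> 4 \<le> length p \<and>
    (\<forall>u\<in>set (map fst p). \<forall>v\<in>set (map fst p).
      (u, v) \<in> parcs G \<longrightarrow> (u, v) \<in> set p \<or> (v, u) \<in> set p)"

definition hole_nbrs :: "'a pair_pre_digraph \<Rightarrow> ('a \<times> 'a) awalk \<Rightarrow> 'a \<Rightarrow> 'a list" where
  "hole_nbrs G p x = filter (\<lambda>v. v \<in> nbhd G x) (map fst p)"

definition wheel :: "'a pair_pre_digraph \<Rightarrow> ('a \<times> 'a) awalk \<Rightarrow> 'a \<Rightarrow> bool" where
  "wheel G p x \<longleftrightarrow> hole G p \<and> x \<in> pverts G \<and> x \<notin> set (map fst p) \<and>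
    3 \<le> length (hole_nbrs G p x)"

text \<open>
  \<open>q\<close> is the arc list of a subpath of the hole \<open>p\<close>, running from \<open>u\<close> to \<open>v\<close> in the direction of \<open>p\<close>;
  the rotation allows it to pass through the starting point of \<open>p\<close>.
\<close>

definition sector ::
    "'a pair_pre_digraph \<Rightarrow> ('a \<times> 'a) awalk \<Rightarrow> 'a \<Rightarrow> 'a \<Rightarrow> ('a \<times> 'a) awalk \<Rightarrow> 'a \<Rightarrow> bool" where
  "sector G p x u q v \<longleftrightarrow> pre_digraph.apath (with_proj G) u q v \<and>
    (\<exists>k r. rotate k p = q @ r) \<and>
    set (pre_digraph.inner_verts (with_proj G) q) \<inter> nbhd G x = {}"

text \<open>
  For consecutive neighbours of \<open>x\<close> on the hole exactly one \<open>q\<close> satisfies \<open>sector\<close>, so the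
  existential quantifier over \<open>q\<close> only names the sector. Indices start at \<open>0\<close>.
\<close>

definition wheel_decomposition :: "'a pair_pre_digraph \<Rightarrow> bool" where
  "wheel_decomposition G \<longleftrightarrow> (\<exists>p x. wheel G p x \<and>
    (let xs = hole_nbrs G p x; n = length xs; VH = set (map fst p) in
      \<forall>i<n. let u = xs ! i; v = xs ! (Suc i mod n); C = (closed_nbhd G x - VH) \<union> {u, v} in
        \<exists>q. sector G p x u q v \<and>
          (let S = set (pre_digraph.awalk_verts (with_proj G) u q) in
            cutset G C \<and> separates G C S (VH - S))))"

end

theory Submission
  imports Defs
begin

text \<open>
  In a triangle-free graph, a hole together with a vertex joined to it by three disjoint, mutually
  nonadjacent induced paths ending in distinct vertices of the hole is an \<open>ISK4\<close>. So a centre of a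
  wheel has at least four neighbours on the rim, and many other configurations are excluded.

  If the graph is not series-parallel, a smallest subgraph that is a subdivision of \<open>K\<^sub>4\<close> yields a
  \<open>K\<^sub>3\<^sub>,\<^sub>3\<close> or a wheel. In the first case a maximal complete bipartite subgraph is the whole graph, or
  every component of its complement attaches to a clique of size at most two. In the second case
  call a wheel with rim \<open>C\<close> and centre \<open>x\<close> proper if no other nonneighbour of \<open>x\<close> has more than two
  neighbours on \<open>C\<close> or has neighbours in \<open>C\<close> outside a common sector; a shortest rim gives a
  proper wheel. Among the proper wheels with centre \<open>x\<close> one with fewest spokes admits no path,
  avoiding \<open>C\<close>, \<open>x\<close> and the neighbours of \<open>x\<close>, between vertices of \<open>C\<close> outside a common sector:
  rerouting \<open>C\<close> along a shortest such path would give a proper wheel with fewer spokes. This is the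
  wheel decomposition.
\<close>

section \<open>Induced paths and holes\<close>

text \<open>The obstacle is that a rerouted rim must again bound a proper wheel. The vertices of the
  discarded arc now lie outside the rim, and an outside vertex may see both the kept arc and the new
  path, so each of them has to be tested for bad pairs. Two facts make this feasible.

  The path is shortest not for one rim only, but among all proper wheels with the given centre and
  the same, fewest, number of spokes. If an end of the path sees two vertices of the rim, the rim
  can be moved onto that end without changing the number of spokes, and a shorter path remains.
  Hence each end may be assumed to see a single vertex.

  Every rim carries at least four spokes. A vertex inside an arc that forms a bad pair with neither
  end of the arc leaves room for at most three spokes on the arc and its ends, provided the other
  arc has a spoke.

  For a shortest rim the test concerns a second centre not adjacent to the first: the neighbours of
  the two would have to alternate along two consecutive sectors, and this already contains an
  ISK4.\<close>

fun pe :: "'a list \<Rightarrow> ('a \<times> 'a) set" where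
  "pe (x # y # zs) = {(x, y), (y, x)} \<union> pe (y # zs)"
| "pe _ = {}"

lemma pe_append: "pe (xs @ y # ys) = pe (xs @ [y]) \<union> pe (y # ys)"
proof (induction xs)
  case (Cons x xs)
  then show ?case by (cases xs) auto
qed auto

lemma pe_rev: "pe (rev xs) = pe xs"
proof (induction xs)
  case (Cons x xs)
  show ?case
  proof (cases xs)
    case (Cons y ys)
    have "pe (rev ys @ [y, x]) = pe (rev ys @ [y]) \<union> pe [y, x]"
      using pe_append[of "rev ys" y "[x]"] by simp
    then show ?thesis using Cons.IH Cons by auto
  qed auto
qed auto

lemma pe_sym: "(u, v) \<in> pe xs \<Longrightarrow> (v, u) \<in> pe xs"
  by (induction xs rule: pe.induct) auto

lemma pe_subset: "(u, v) \<in> pe xs \<Longrightarrow> u \<in> set xs \<and> v \<in> set xs"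
  by (induction xs rule: pe.induct) auto

text \<open>Once the interior \<open>l\<close> is nonempty, every edge of the path has an end in it.
  With \<open>T\<close> the set of branch vertices, this tells the edges of different branch paths
  apart.\<close>

lemma pe_branch:
  assumes "set l \<inter> T = {}" "(u, v) \<in> pe (a # l @ [b])" "u \<in> T" "v \<in> T"
  shows "l = [] \<and> ((u, v) = (a, b) \<or> (u, v) = (b, a))"
proof (cases l)
  case Nil
  with assms show ?thesis by auto
next
  case (Cons x l')
  have "(u, v) \<in> pe (x # l' @ [b])"
    using assms Cons by auto
  then have "u \<in> set l \<or> v \<in> set l"
    using Cons
  proof (induction l' arbitrary: x l)
    case (Cons y l')
    then show ?case by (cases "(u, v) \<in> pe (y # l' @ [b])") (auto dest!: Cons.IH)
  qed auto
  then show ?thesis using assms by auto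
qed

text \<open>The combinatorial argument runs over a symmetric relation; digraphs enter only where
  subdivisions are read off and where the decomposition is stated.\<close>

locale sgraph =
  fixes V :: "'a set" and E :: "'a \<Rightarrow> 'a \<Rightarrow> bool"
  assumes finV: "finite V"
    and EV: "E u v \<Longrightarrow> u \<in> V"
    and Esym: "E u v \<Longrightarrow> E v u"
    and Eirr: "\<not> E u u"
begin

lemma wk_pe: "successively E xs \<longleftrightarrow> (\<forall>(u, v) \<in> pe xs. E u v)"
  by (induction xs rule: pe.induct) (auto dest: Esym)

lemma wk_rev: "successively E (rev xs) \<longleftrightarrow> successively E xs"
  unfolding wk_pe pe_rev ..

lemma wk_append: "successively E (xs @ y # ys) \<longleftrightarrow> successively E (xs @ [y]) \<and> successively E (y # ys)"
  by (subst (1 2 3) wk_pe, subst pe_append) auto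

text \<open>In graph-theoretic language: \<open>A\<close> and \<open>B\<close> are disjoint and
  anticomplete.\<close>

definition apart :: "'a set \<Rightarrow> 'a set \<Rightarrow> bool" where
  "apart A B \<longleftrightarrow> A \<inter> B = {} \<and> (\<forall>u\<in>A. \<forall>v\<in>B. \<not> E u v)"

lemma apart_sym: "apart A B \<longleftrightarrow> apart B A"
  unfolding apart_def using Esym by blast

lemma apart_Un: "apart (A \<union> B) C \<longleftrightarrow> apart A C \<and> apart B C"
  "apart C (A \<union> B) \<longleftrightarrow> apart C A \<and> apart C B"
  by (auto simp: apart_def)

lemma apart_empty [simp]: "apart {} A" "apart A {}"
  by (auto simp: apart_def)

lemma apart_mono: "apart A B \<Longrightarrow> A' \<subseteq> A \<Longrightarrow> B' \<subseteq> B \<Longrightarrow> apart A' B'"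
  unfolding apart_def by blast

lemma apart_iff: "apart A B \<longleftrightarrow> (\<forall>u\<in>A. \<forall>v\<in>B. u \<noteq> v \<and> \<not> E u v)"
  by (auto simp: apart_def)

fun ipath :: "'a list \<Rightarrow> bool" where
  "ipath (x # y # ys) \<longleftrightarrow> E x y \<and> x \<noteq> y \<and> apart {x} (set ys) \<and> ipath (y # ys)"
| "ipath _ \<longleftrightarrow> True"

text \<open>A chord of the concatenation lies in one of the two parts that share \<open>y\<close>,
  or runs between \<open>xs\<close> and \<open>ys\<close>. Subpaths and joined paths are obtained
  from this equivalence.\<close>

lemma ipath_append:
  "ipath (xs @ y # ys) \<longleftrightarrow> ipath (xs @ [y]) \<and> ipath (y # ys) \<and> apart (set xs) (set ys)"
proof (induction xs)
  case (Cons x xs)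
  show ?case
  proof (cases xs)
    case Nil
    then show ?thesis by (cases ys) auto
  next
    case (Cons z zs)
    have "apart (set (x # xs)) (set ys) \<longleftrightarrow> apart (set xs) (set ys) \<and> apart {x} (set ys)"
      "apart {x} (set (zs @ y # ys)) \<longleftrightarrow> apart {x} (set zs) \<and> apart {x} {y} \<and> apart {x} (set ys)"
      "apart {x} (set (zs @ [y])) \<longleftrightarrow> apart {x} (set zs) \<and> apart {x} {y}"
      unfolding apart_def by auto
    then show ?thesis using Cons.IH Cons by auto
  qed
qed auto

lemma ipath_rev: "ipath (rev xs) \<longleftrightarrow> ipath xs"
proof (induction xs)
  case (Cons x xs)
  show ?case
  proof (cases xs)
    case (Cons y ys)
    have "ipath (rev ys @ y # [x]) \<longleftrightarrow> ipath (rev ys @ [y]) \<and> ipath [y, x] \<and> apart (set ys) {x}"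
      by (subst ipath_append) simp
    moreover have "apart (set ys) {x} \<longleftrightarrow> apart {x} (set ys)" by (rule apart_sym)
    ultimately show ?thesis using Cons.IH Cons by (auto dest: Esym)
  qed auto
qed auto

lemma ipath_distinct: "ipath xs \<Longrightarrow> distinct xs"
  by (induction xs rule: ipath.induct) (auto simp: apart_def)

lemma ipath_wk: "ipath xs \<Longrightarrow> successively E xs"
  by (induction xs rule: ipath.induct) auto

lemma ipath_adj: "ipath xs \<Longrightarrow> u \<in> set xs \<Longrightarrow> v \<in> set xs \<Longrightarrow> E u v \<Longrightarrow> (u, v) \<in> pe xs"
proof (induction xs rule: ipath.induct)
  case (1 x y ys)
  then show ?case by (auto simp: apart_def Eirr dest: Esym)
qed (auto simp: Eirr)

lemma ipathI:
  assumes "successively E xs" "distinct xs"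
    and "\<And>p u q v r. xs = p @ u # q @ v # r \<Longrightarrow> q \<noteq> [] \<Longrightarrow> \<not> E u v"
  shows "ipath xs"
  using assms
proof (induction xs rule: ipath.induct)
  case (1 x y ys)
  have "ipath (y # ys)"
  proof (rule 1)
    fix p u q v r
    assume "y # ys = p @ u # q @ v # r" "q \<noteq> []"
    then show "\<not> E u v" using 1(4)[of "x # p" u q v r] by simp
  qed (use 1 in auto)
  moreover have "\<not> E x v" if v: "v \<in> set ys" for v
  proof -
    obtain q r where "ys = q @ v # r" using split_list[OF v] by blast
    then show ?thesis using 1(4)[of "[]" x "y # q" v r] by simp
  qed
  ultimately show ?case using 1 by (auto simp: apart_def)
qed auto

lemma ipath_appendD1: "ipath (xs @ ys) \<Longrightarrow> ipath xs"
proof (cases ys)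
  case (Cons y ys')
  assume "ipath (xs @ ys)"
  then have "ipath (xs @ [y])" using Cons ipath_append[of xs y ys'] by blast
  then have "ipath (y # rev xs)" using ipath_rev[of "xs @ [y]"] by simp
  then have "ipath (rev xs)" by (cases "rev xs") auto
  then show ?thesis by (simp add: ipath_rev)
qed auto

lemma ipath_appendD2: "ipath (xs @ ys) \<Longrightarrow> ipath ys"
  using ipath_appendD1[of "rev ys" "rev xs"] ipath_rev[of "xs @ ys"] ipath_rev[of ys] by simp

text \<open>A chordless cycle listed from an arbitrary starting vertex \<open>x\<close>. The bound 3
  on the remaining vertices excludes triangles, and \<open>butlast (tl xs)\<close> is the list
  \<open>xs\<close> without the two neighbours of \<open>x\<close>.\<close>

fun hole :: "'a list \<Rightarrow> bool" where
  "hole (x # xs) \<longleftrightarrow> 3 \<le> length xs \<and> ipath xs \<and> x \<notin> set xs \<and> E x (hd xs) \<and> E x (last xs)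
     \<and> apart {x} (set (butlast (tl xs)))"
| "hole [] \<longleftrightarrow> False"

text \<open>This view is symmetric in the two arcs between \<open>u\<close> and \<open>w\<close>, so
  that one arc can be exchanged for another path; the defining recursion singles out one vertex
  instead.\<close>

lemma hole_split:
  assumes "A \<noteq> []" "B \<noteq> []"
  shows "hole (u # A @ w # B) \<longleftrightarrow>
    ipath (u # A @ [w]) \<and> ipath (w # B @ [u]) \<and> apart (set A) (set B)"
proof -
  obtain a A' where A: "A = a # A'" using assms by (cases A) auto
  obtain b B' where B: "B = B' @ [b]" using assms by (cases B rule: rev_cases) auto
  have 1: "ipath (u # A @ [w]) \<longleftrightarrow> E u a \<and> u \<noteq> a \<and> apart {u} (set A') \<and> apart {u} {w} \<and> ipath (A @ [w])"
    unfolding A by (auto simp: apart_def)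
  have "ipath (w # B @ [u]) \<longleftrightarrow> ipath ((w # B') @ b # [u])" by (simp add: B)
  also have "\<dots> \<longleftrightarrow> ipath (w # B) \<and> E b u \<and> b \<noteq> u \<and> apart (set (w # B')) {u}"
    by (subst ipath_append) (simp add: B)
  also have "\<dots> \<longleftrightarrow> ipath (w # B) \<and> E u b \<and> u \<noteq> b \<and> apart {u} {w} \<and> apart {u} (set B')"
    unfolding apart_def using Esym by auto
  finally have 2: "ipath (w # B @ [u]) \<longleftrightarrow>
      ipath (w # B) \<and> E u b \<and> u \<noteq> b \<and> apart {u} {w} \<and> apart {u} (set B')" .
  have 3: "ipath (A @ w # B) \<longleftrightarrow> ipath (A @ [w]) \<and> ipath (w # B) \<and> apart (set A) (set B)"
    by (rule ipath_append)
  have 4: "hd (A @ w # B) = a" "last (A @ w # B) = b" "butlast (tl (A @ w # B)) = A' @ w # B'"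
    by (auto simp: A B butlast_append)
  have 5: "3 \<le> length (A @ w # B)" by (simp add: A B)
  have 6: "u \<notin> set (A @ w # B) \<and> E u a \<and> E u b \<and> apart {u} (set (A' @ w # B')) \<longleftrightarrow>
    E u a \<and> u \<noteq> a \<and> apart {u} (set A') \<and> apart {u} {w} \<and> E u b \<and> u \<noteq> b \<and> apart {u} (set B')"
    unfolding apart_def A B by auto
  have "hole (u # A @ w # B) \<longleftrightarrow> ipath (A @ w # B) \<and>
    (u \<notin> set (A @ w # B) \<and> E u a \<and> E u b \<and> apart {u} (set (A' @ w # B')))"
    unfolding hole.simps 4 using 5 by blast
  then show ?thesis unfolding 1 2 3 6 by blast
qed

lemma hole_length: "hole xs \<Longrightarrow> 4 \<le> length xs"
  by (cases xs) auto

lemma hole_distinct: "hole xs \<Longrightarrow> distinct xs"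
  by (cases xs) (auto dest: ipath_distinct)

lemma hole_rotate1: "hole (x # xs) \<Longrightarrow> hole (xs @ [x])"
proof -
  assume h: "hole (x # xs)"
  then obtain a b ys where xs: "xs = a # b # ys" and ys: "ys \<noteq> []"
    by (cases xs rule: ipath.cases) (auto simp: Suc_le_length_iff numeral_eq_Suc)
  have "hole (x # [a] @ b # ys)" using h xs by simp
  then have *: "ipath [x, a, b]" "ipath (b # ys @ [x])" "apart {a} (set ys)"
    using hole_split[of "[a]" ys x b] ys by auto
  obtain c zs where c: "ys = zs @ [c]" using ys by (cases ys rule: rev_cases) auto
  have "hole (a # (b # zs) @ c # [x])"
  proof (subst hole_split)
    have i: "ipath (b # zs @ c # [x])" using * c by simp
    have "ipath ((b # zs) @ [c]) \<and> ipath [c, x] \<and> apart (set (b # zs)) {x}"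
      using i ipath_append[of "b # zs" c "[x]"] by simp
    then show "ipath (a # (b # zs) @ [c]) \<and> ipath (c # [x] @ [a]) \<and> apart (set (b # zs)) (set [x])"
      using * c by (auto simp: apart_def dest: Esym)
  qed auto
  then show ?thesis by (simp add: xs c)
qed

lemma hole_swap: "hole (xs @ ys) \<Longrightarrow> hole (ys @ xs)"
proof (induction xs arbitrary: ys)
  case (Cons x xs)
  have "hole (xs @ (ys @ [x]))" using hole_rotate1[of x "xs @ ys"] Cons by simp
  then show ?case using Cons.IH[of "ys @ [x]"] by simp
qed auto

lemma hole_rotate: "hole (rotate n xs) \<longleftrightarrow> hole xs"
proof
  show "hole xs \<Longrightarrow> hole (rotate n xs)"
    using hole_swap[of "take (n mod length xs) xs" "drop (n mod length xs) xs"]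
    by (simp add: rotate_drop_take)
  show "hole (rotate n xs) \<Longrightarrow> hole xs"
    using hole_swap[of "drop (n mod length xs) xs" "take (n mod length xs) xs"]
    by (simp add: rotate_drop_take)
qed

lemma hole_rev: "hole (rev xs) \<longleftrightarrow> hole xs"
proof -
  have *: "hole (rev xs)" if h0: "hole xs" for xs
  proof -
    obtain a b c d ys where xs: "xs = a # b # c # d # ys"
      using hole_length[OF h0] by (auto simp: Suc_le_length_iff numeral_eq_Suc)
    have h: "hole (a # [b] @ c # (d # ys))" using h0 xs by simp
    then have "ipath [a, b, c]" "ipath (c # (d # ys) @ [a])" "apart {b} (set (d # ys))"
      using hole_split[of "[b]" "d # ys" a c] by auto
    moreover from this(2) have "ipath (rev (c # (d # ys) @ [a]))" by (subst ipath_rev)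
    moreover have "a # rev (d # ys) @ [c] = rev (c # (d # ys) @ [a])" by simp
    ultimately have "hole (a # rev (d # ys) @ c # [b])"
      by (subst hole_split) (auto simp: apart_def dest: Esym)
    then have "hole ([a] @ (rev (d # ys) @ c # [b]))" by simp
    then have "hole ((rev (d # ys) @ c # [b]) @ [a])" by (rule hole_swap)
    then show ?thesis by (simp add: xs)
  qed
  show ?thesis using *[of xs] *[of "rev xs"] by auto
qed

text \<open>On the rim of a wheel with centre \<open>z\<close> this is the number of spokes.\<close>

definition cn :: "'a \<Rightarrow> 'a list \<Rightarrow> nat" where
  "cn z xs = length (filter (E z) xs)"

lemma cn_simps [simp]:
  "cn z [] = 0" "cn z (x # xs) = (if E z x then Suc (cn z xs) else cn z xs)"
  "cn z (xs @ ys) = cn z xs + cn z ys" "cn z (rev xs) = cn z xs"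
  by (auto simp: cn_def rev_filter[symmetric])

lemma cn_rotate [simp]: "cn z (rotate n xs) = cn z xs"
proof -
  let ?m = "n mod length xs"
  have "cn z (rotate n xs) = cn z (drop ?m xs) + cn z (take ?m xs)"
    by (simp add: rotate_drop_take)
  also have "\<dots> = cn z (take ?m xs @ drop ?m xs)"
    by (simp only: cn_simps)
  finally show ?thesis by (simp only: append_take_drop_id)
qed

lemma cn_0: "cn z xs = 0 \<longleftrightarrow> (\<forall>v\<in>set xs. \<not> E z v)"
  by (induction xs) auto

lemma cn_pos: "cn z xs > 0 \<longleftrightarrow> (\<exists>v\<in>set xs. E z v)"
  by (induction xs) auto

lemma cn_first: "cn z xs > 0 \<Longrightarrow> \<exists>p v q. xs = p @ v # q \<and> cn z p = 0 \<and> E z v"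
  using split_list_first_prop[of xs "E z"] unfolding cn_0 cn_pos by auto

lemma cn_last: "cn z xs > 0 \<Longrightarrow> \<exists>p v q. xs = p @ v # q \<and> cn z q = 0 \<and> E z v"
  using split_list_last_prop[of xs "E z"] unfolding cn_0 cn_pos by auto

end

section \<open>Subdivisions of \<open>K\<^sub>4\<close>\<close>

text \<open>Used to locate, on a branch path, the edge that disappears when the graph is
  subdivided.\<close>

lemma successively_diff:
  assumes "successively R xs" "\<not> successively R' xs"
  shows "\<exists>p s t q. xs = p @ s # t # q \<and> R s t \<and> \<not> R' s t"
  using assms
proof (induction xs rule: pe.induct)
  case (1 x y zs)
  show ?case
  proof (cases "R' x y")
    case True
    then obtain p s t q where "y # zs = p @ s # t # q" "R s t" "\<not> R' s t" using 1 by auto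
    then show ?thesis by (intro exI[of _ "x # p"]) auto
  next
    case False
    then show ?thesis using 1 by (intro exI[of _ "[]"]) auto
  qed
qed auto

text \<open>
  The branch vertices of a subdivision of \<open>K\<^sub>4\<close> serve as indices:
  \<open>L p q\<close> lists the interior vertices of the path from \<open>p\<close> to \<open>q\<close>.
\<close>

definition K4f :: "('a \<Rightarrow> 'a \<Rightarrow> bool) \<Rightarrow> 'a set \<Rightarrow> ('a \<Rightarrow> 'a \<Rightarrow> 'a list) \<Rightarrow> bool" where
  "K4f R T L \<longleftrightarrow> card T = 4 \<and>
    (\<forall>p\<in>T. \<forall>q\<in>T. p \<noteq> q \<longrightarrow> successively R (p # L p q @ [q]) \<and> L q p = rev (L p q)
       \<and> distinct (L p q) \<and> set (L p q) \<inter> T = {}) \<and>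
    (\<forall>p\<in>T. \<forall>q\<in>T. \<forall>r\<in>T. \<forall>s\<in>T. p \<noteq> q \<longrightarrow> r \<noteq> s \<longrightarrow> {p, q} \<noteq> {r, s} \<longrightarrow> set (L p q) \<inter> set (L r s) = {})"

definition K4V :: "'a set \<Rightarrow> ('a \<Rightarrow> 'a \<Rightarrow> 'a list) \<Rightarrow> 'a set" where
  "K4V T L = T \<union> (\<Union>p\<in>T. \<Union>q\<in>T - {p}. set (L p q))"

text \<open>The concrete counterpart of \<open>K4f\<close>: constructions produce six named paths,
  while statements symmetric in the branch vertices are easier with the indexed family.\<close>

definition K4m :: "('a \<Rightarrow> 'a \<Rightarrow> bool) \<Rightarrow> 'a \<Rightarrow> 'a \<Rightarrow> 'a \<Rightarrow> 'a \<Rightarrow>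
    'a list \<Rightarrow> 'a list \<Rightarrow> 'a list \<Rightarrow> 'a list \<Rightarrow> 'a list \<Rightarrow> 'a list \<Rightarrow> bool" where
  "K4m R a b c d ab ac ad bc bd cd \<longleftrightarrow>
    distinct (a # b # c # d # ab @ ac @ ad @ bc @ bd @ cd) \<and>
    successively R (a # ab @ [b]) \<and> successively R (a # ac @ [c]) \<and> successively R (a # ad @ [d]) \<and>
    successively R (b # bc @ [c]) \<and> successively R (b # bd @ [d]) \<and> successively R (c # cd @ [d])"

text \<open>The value at \<open>p = q\<close> is arbitrary: \<open>K4f\<close> and
  \<open>K4V\<close> look at distinct indices only.\<close>

definition K4t :: "'a \<Rightarrow> 'a \<Rightarrow> 'a \<Rightarrow> 'a \<Rightarrow> 'a list \<Rightarrow> 'a list \<Rightarrow> 'a list \<Rightarrow> 'a list \<Rightarrow> 'a list \<Rightarrow> 'a list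
    \<Rightarrow> 'a \<Rightarrow> 'a \<Rightarrow> 'a list" where
  "K4t a b c d ab ac ad bc bd cd p q =
    (if p = a then (if q = b then ab else if q = c then ac else ad)
     else if p = b then (if q = a then rev ab else if q = c then bc else bd)
     else if p = c then (if q = a then rev ac else if q = b then rev bc else cd)
     else (if q = a then rev ad else if q = b then rev bd else rev cd))"

lemma successively_symp_rev:
  assumes "\<And>x y. R x y \<Longrightarrow> R y x" "successively R xs"
  shows "successively R (rev xs)"
proof -
  have "(\<lambda>x y. R y x) = R" using assms(1) by blast
  then show ?thesis using assms(2) by (metis successively_rev)
qed

lemma K4m_K4f:
  assumes R: "\<And>x y. R x y \<Longrightarrow> R y x" and m: "K4m R a b c d ab ac ad bc bd cd"
  shows "K4f R {a, b, c, d} (K4t a b c d ab ac ad bc bd cd)"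
    and "K4V {a, b, c, d} (K4t a b c d ab ac ad bc bd cd) =
      set (a # b # c # d # ab @ ac @ ad @ bc @ bd @ cd)"
proof -
  note di0 = m[unfolded K4m_def, THEN conjunct1]
  have d: "a \<noteq> b" "a \<noteq> c" "a \<noteq> d" "b \<noteq> c" "b \<noteq> d" "c \<noteq> d"
    "b \<noteq> a" "c \<noteq> a" "d \<noteq> a" "c \<noteq> b" "d \<noteq> b" "d \<noteq> c"
    using di0 by auto
  let ?L = "K4t a b c d ab ac ad bc bd cd"
  have L: "?L a b = ab" "?L a c = ac" "?L a d = ad" "?L b a = rev ab" "?L b c = bc" "?L b d = bd"
    "?L c a = rev ac" "?L c b = rev bc" "?L c d = cd" "?L d a = rev ad" "?L d b = rev bd" "?L d c = rev cd"
    using d by (simp_all add: K4t_def)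
  have s: "successively R (a # ab @ [b])" "successively R (a # ac @ [c])" "successively R (a # ad @ [d])"
    "successively R (b # bc @ [c])" "successively R (b # bd @ [d])" "successively R (c # cd @ [d])"
    using m by (simp_all add: K4m_def)
  have rv: "successively R (rev xs)" if "successively R xs" for xs
    using R that by (rule successively_symp_rev)
  have r: "successively R (b # rev ab @ [a])" "successively R (c # rev ac @ [a])"
    "successively R (d # rev ad @ [a])" "successively R (c # rev bc @ [b])"
    "successively R (d # rev bd @ [b])" "successively R (d # rev cd @ [c])"
    using s[THEN rv] by simp_all
  have di: "distinct ab" "distinct ac" "distinct ad" "distinct bc" "distinct bd" "distinct cd"
    "set ab \<inter> {a, b, c, d} = {}" "set ac \<inter> {a, b, c, d} = {}" "set ad \<inter> {a, b, c, d} = {}"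
    "set bc \<inter> {a, b, c, d} = {}" "set bd \<inter> {a, b, c, d} = {}" "set cd \<inter> {a, b, c, d} = {}"
    using di0 by (simp_all add: Int_Un_distrib)
  have x: "set ab \<inter> set ac = {}" "set ab \<inter> set ad = {}" "set ab \<inter> set bc = {}" "set ab \<inter> set bd = {}"
    "set ab \<inter> set cd = {}" "set ac \<inter> set ad = {}" "set ac \<inter> set bc = {}" "set ac \<inter> set bd = {}"
    "set ac \<inter> set cd = {}" "set ad \<inter> set bc = {}" "set ad \<inter> set bd = {}" "set ad \<inter> set cd = {}"
    "set bc \<inter> set bd = {}" "set bc \<inter> set cd = {}" "set bd \<inter> set cd = {}"
 
    using di0 by (simp_all add: Int_Un_distrib)
  note x' = x[THEN trans[OF Int_commute]]
  show "K4f R {a, b, c, d} ?L"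
    unfolding K4f_def
  proof (intro conjI)
    show "card {a, b, c, d} = 4" using d by simp
    show "\<forall>p\<in>{a, b, c, d}. \<forall>q\<in>{a, b, c, d}. p \<noteq> q \<longrightarrow> successively R (p # ?L p q @ [q])
      \<and> ?L q p = rev (?L p q) \<and> distinct (?L p q) \<and> set (?L p q) \<inter> {a, b, c, d} = {}"
      using s r di by (simp add: L d)
    show "\<forall>p\<in>{a, b, c, d}. \<forall>q\<in>{a, b, c, d}. \<forall>r\<in>{a, b, c, d}. \<forall>s\<in>{a, b, c, d}. p \<noteq> q \<longrightarrow> r \<noteq> s \<longrightarrow>
        {p, q} \<noteq> {r, s} \<longrightarrow> set (?L p q) \<inter> set (?L r s) = {}"
      by (simp add: L d x x' doubleton_eq_iff)
  qed
  show "K4V {a, b, c, d} ?L = set (a # b # c # d # ab @ ac @ ad @ bc @ bd @ cd)"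
  proof -
    have "{a, b, c, d} - {a} = {b, c, d}" "{a, b, c, d} - {b} = {a, c, d}"
      "{a, b, c, d} - {c} = {a, b, d}" "{a, b, c, d} - {d} = {a, b, c}"
      using d by auto
    then show ?thesis by (simp add: K4V_def L Un_ac insert_commute)
  qed
qed

lemma K4fD:
  assumes "K4f R T L"
  shows "card T = 4"
    and "\<And>p q. \<lbrakk>p \<in> T; q \<in> T; p \<noteq> q\<rbrakk> \<Longrightarrow> successively R (p # L p q @ [q])"
    and "\<And>p q. \<lbrakk>p \<in> T; q \<in> T; p \<noteq> q\<rbrakk> \<Longrightarrow> L q p = rev (L p q)"
    and "\<And>p q. \<lbrakk>p \<in> T; q \<in> T; p \<noteq> q\<rbrakk> \<Longrightarrow> distinct (L p q)"
    and "\<And>p q. \<lbrakk>p \<in> T; q \<in> T; p \<noteq> q\<rbrakk> \<Longrightarrow> set (L p q) \<inter> T = {}"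
    and "\<And>p q r s. \<lbrakk>p \<in> T; q \<in> T; r \<in> T; s \<in> T; p \<noteq> q; r \<noteq> s; {p, q} \<noteq> {r, s}\<rbrakk>
           \<Longrightarrow> set (L p q) \<inter> set (L r s) = {}"
proof -
  note 1 = assms[unfolded K4f_def, THEN conjunct1]
    and 2 = assms[unfolded K4f_def, THEN conjunct2, THEN conjunct1, rule_format]
    and 3 = assms[unfolded K4f_def, THEN conjunct2, THEN conjunct2, rule_format]
  show "card T = 4" by (rule 1)
  show "successively R (p # L p q @ [q])" if "p \<in> T" "q \<in> T" "p \<noteq> q" for p q
    using 2[OF that] by (rule conjunct1)
  show "L q p = rev (L p q)" if "p \<in> T" "q \<in> T" "p \<noteq> q" for p q
    using 2[OF that] by (elim conjE)
  show "distinct (L p q)" if "p \<in> T" "q \<in> T" "p \<noteq> q" for p q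
    using 2[OF that] by (elim conjE)
  show "set (L p q) \<inter> T = {}" if "p \<in> T" "q \<in> T" "p \<noteq> q" for p q
    using 2[OF that] by (elim conjE)
  show "set (L p q) \<inter> set (L r s) = {}"
    if "p \<in> T" "q \<in> T" "r \<in> T" "s \<in> T" "p \<noteq> q" "r \<noteq> s" "{p, q} \<noteq> {r, s}" for p q r s
    by (rule 3[OF that])
qed

lemma K4f_K4m:
  assumes f: "K4f R T L" and T: "p \<in> T" "q \<in> T" "r \<in> T" "s \<in> T" and d: "distinct [p, q, r, s]"
  shows "K4m R p q r s (L p q) (L p r) (L p s) (L q r) (L q s) (L r s)"
    and "K4V T L = set (p # q # r # s # L p q @ L p r @ L p s @ L q r @ L q s @ L r s)"
    and "T = {p, q, r, s}"
proof -
  have n: "p \<noteq> q" "p \<noteq> r" "p \<noteq> s" "q \<noteq> r" "q \<noteq> s" "r \<noteq> s" using d by auto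
  have 1: "successively R (x # L x y @ [y])" "L y x = rev (L x y)" "distinct (L x y)"
      "set (L x y) \<inter> T = {}" if "x \<in> T" "y \<in> T" "x \<noteq> y" for x y
    using K4fD(2-5)[OF f that] by blast+
  have 2: "set (L x y) \<inter> set (L z w) = {}"
    if "x \<in> T" "y \<in> T" "z \<in> T" "w \<in> T" "x \<noteq> y" "z \<noteq> w" "{x, y} \<noteq> {z, w}" for x y z w
    by (rule K4fD(6)[OF f that])
  have x: "set (L p q) \<inter> set (L p r) = {}" "set (L p q) \<inter> set (L p s) = {}"
    "set (L p q) \<inter> set (L q r) = {}" "set (L p q) \<inter> set (L q s) = {}" "set (L p q) \<inter> set (L r s) = {}"
    "set (L p r) \<inter> set (L p s) = {}" "set (L p r) \<inter> set (L q r) = {}" "set (L p r) \<inter> set (L q s) = {}"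
    "set (L p r) \<inter> set (L r s) = {}" "set (L p s) \<inter> set (L q r) = {}" "set (L p s) \<inter> set (L q s) = {}"
    "set (L p s) \<inter> set (L r s) = {}" "set (L q r) \<inter> set (L q s) = {}" "set (L q r) \<inter> set (L r s) = {}"
    "set (L q s) \<inter> set (L r s) = {}"
    by (rule 2; use T n in \<open>simp add: doubleton_eq_iff\<close>)+
  have nt: "v \<notin> set (L x y)" if "v \<in> T" "x \<in> T" "y \<in> T" "x \<noteq> y" for v x y
    using 1(4)[OF that(2-4)] that(1) by blast
  show "K4m R p q r s (L p q) (L p r) (L p s) (L q r) (L q s) (L r s)"
    unfolding K4m_def by (simp add: Int_Un_distrib x nt T n 1(1,3))
  have "{p, q, r, s} \<subseteq> T" "card {p, q, r, s} = card T" using T d K4fD(1)[OF f] by auto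
  moreover have "finite T" using K4fD(1)[OF f] by (metis card.infinite zero_neq_numeral)
  ultimately show T5: "T = {p, q, r, s}" by (metis card_subset_eq)
  show "K4V T L = set (p # q # r # s # L p q @ L p r @ L p s @ L q r @ L q s @ L r s)"
  proof -
    have "{p, q, r, s} - {p} = {q, r, s}" "{p, q, r, s} - {q} = {p, r, s}"
      "{p, q, r, s} - {r} = {p, q, s}" "{p, q, r, s} - {s} = {p, q, r}"
      using n by auto
    moreover have "set (L q p) = set (L p q)" "set (L r p) = set (L p r)" "set (L s p) = set (L p s)"
      "set (L r q) = set (L q r)" "set (L s q) = set (L q s)" "set (L s r) = set (L r s)"
      using T(1-4) n 1(2)[of p q] 1(2)[of p r] 1(2)[of p s] 1(2)[of q r] 1(2)[of q s] 1(2)[of r s]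
      by simp_all
    ultimately show ?thesis unfolding K4V_def T5 by (simp add: Un_ac insert_commute)
  qed
qed

text \<open>At most one branch path runs through the edge between \<open>u\<close> and
  \<open>v\<close>, because two different branch paths share at most one vertex, a common end. That
  path is led through the new vertex \<open>w\<close>; all others survive.\<close>

lemma K4f_subdivide:
  assumes f: "K4f R T L" and R: "\<And>x y. R x y \<Longrightarrow> R y x" and R': "\<And>x y. R' x y \<Longrightarrow> R' y x"
    and w: "w \<notin> K4V T L" and RR: "\<And>x y. R x y \<Longrightarrow> {x, y} \<noteq> {u, v} \<Longrightarrow> R' x y"
    and uw: "R' u w" "R' w v" and uv: "u \<noteq> v"
  shows "\<exists>L'. K4f R' T L' \<and> K4V T L' \<subseteq> insert w (K4V T L)"
proof (cases "\<forall>p\<in>T. \<forall>q\<in>T. p \<noteq> q \<longrightarrow> successively R' (p # L p q @ [q])")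
  case True
  have "K4f R' T L"
    unfolding K4f_def
    by (intro conjI ballI impI; (rule K4fD[OF f] | rule True[rule_format]); assumption)
  then show ?thesis by blast
next
  case False
  then obtain p q where pq: "p \<in> T" "q \<in> T" "p \<noteq> q" and ns: "\<not> successively R' (p # L p q @ [q])"
    by blast
  have s: "successively R (p # L p q @ [q])" by (rule K4fD(2)[OF f pq])
  from successively_diff[OF s ns] obtain xs s t ys where
    st: "p # L p q @ [q] = xs @ s # t # ys" and "R s t" "\<not> R' s t" by blast
  then have st2: "{s, t} = {u, v}" using RR by blast
  have dpq: "distinct (p # L p q @ [q])" using K4fD(4,5)[OF f pq] pq by auto
  obtain l where l: "p # l @ [q] = xs @ s # w # t # ys"
  proof -
    have "hd (xs @ s # w # t # ys) = p" using st by (cases xs) auto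
    moreover have "last (xs @ s # w # t # ys) = q"
      using st by (metis append_is_Nil_conv last.simps last_append list.distinct(1) append_Cons last_snoc)
    ultimately have "xs @ s # w # t # ys = p # butlast (tl (xs @ s # w # t # ys)) @ [q]"
      by (cases xs; cases ys rule: rev_cases) (auto simp: butlast_append)
    then show ?thesis using that by metis
  qed
  have sl: "insert p (insert q (set l)) = insert w (insert p (insert q (set (L p q))))"
    using arg_cong[OF l, of set] arg_cong[OF st, of set] by auto
  have wn: "w \<notin> set (p # L p q @ [q])" using w pq by (auto simp: K4V_def)
  have dl: "distinct (p # l @ [q])"
    unfolding l using dpq wn unfolding st by auto
  have sl': "set l = insert w (set (L p q))"
    using sl dl dpq wn pq by auto
  define L' where "L' x y = (if x = p \<and> y = q then l else if x = q \<and> y = p then rev l else L x y)" for x y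
  have other: "successively R' (x # L x y @ [y])" if xy: "x \<in> T" "y \<in> T" "x \<noteq> y" "{x, y} \<noteq> {p, q}" for x y
  proof (rule ccontr)
    assume ns: "\<not> ?thesis"
    have "successively R (x # L x y @ [y])" by (rule K4fD(2)[OF f xy(1-3)])
    from successively_diff[OF this ns] obtain xs' s' t' ys' where
      st': "x # L x y @ [y] = xs' @ s' # t' # ys'" and "R s' t'" "\<not> R' s' t'" by blast
    then have "{s', t'} = {u, v}" using RR by blast
    then have 1: "{u, v} \<subseteq> {x, y} \<union> set (L x y)" using arg_cong[OF st', of set] by auto
    have 2: "{u, v} \<subseteq> {p, q} \<union> set (L p q)" using arg_cong[OF st, of set] st2 by auto
    have 3: "set (L x y) \<inter> set (L p q) = {}" "set (L x y) \<inter> T = {}" "set (L p q) \<inter> T = {}"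
      by (rule K4fD(6)[OF f xy(1,2) pq(1,2) xy(3) pq(3) xy(4)] K4fD(5)[OF f xy(1-3)] K4fD(5)[OF f pq])+
    have 4: "{x, y} \<subseteq> T" "{p, q} \<subseteq> T" using xy pq by blast+
    have 5: "z \<in> {x, y} \<and> z \<in> {p, q}" if z: "z \<in> {u, v}" for z
    proof -
      have "z \<in> {x, y} \<or> z \<in> set (L x y)" "z \<in> {p, q} \<or> z \<in> set (L p q)" using 1 2 z by blast+
      moreover have "z \<notin> set (L x y) \<or> z \<notin> set (L p q)" "z \<notin> set (L x y) \<or> z \<notin> T" "z \<notin> set (L p q) \<or> z \<notin> T"
        using 3(1) 3(2) 3(3) by (meson disjoint_iff)+
      moreover have "z \<in> {x, y} \<Longrightarrow> z \<in> T" "z \<in> {p, q} \<Longrightarrow> z \<in> T" using 4 by (meson subsetD)+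
      ultimately show ?thesis by argo
    qed
    have "{u, v} \<subseteq> {x, y} \<inter> {p, q}" using 5 by (meson Int_iff subsetI)
    then show False using uv xy pq by auto
  qed
  have new: "successively R' (p # l @ [q])"
  proof -
    have "successively R' (xs @ [s])" "successively R' (t # ys)"
    proof -
      have *: "successively R (xs @ [s])" "successively R (t # ys)"
        using s unfolding st by (auto simp: successively_append_iff)
      have d: "distinct (xs @ s # t # ys)" using dpq unfolding st .
      show "successively R' (xs @ [s])"
      proof (rule ccontr)
        assume "\<not> ?thesis"
        from successively_diff[OF *(1) this] obtain a b c e where
          q: "xs @ [s] = a @ b # c # e" "R b c" "\<not> R' b c" by blast
        then have "{b, c} = {s, t}" using RR st2 by blast
        then have "t \<in> set (xs @ [s])" using q(1) by (auto simp: doubleton_eq_iff)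
        then show False using d by auto
      qed
      show "successively R' (t # ys)"
      proof (rule ccontr)
        assume "\<not> ?thesis"
        from successively_diff[OF *(2) this] obtain a b c e where
          q: "t # ys = a @ b # c # e" "R b c" "\<not> R' b c" by blast
        then have "{b, c} = {s, t}" using RR st2 by blast
        then have "s \<in> set (t # ys)" unfolding q(1) by (auto simp: doubleton_eq_iff)
        then show False using d by auto
      qed
    qed
    moreover have "R' s w" "R' w t" using uw st2 R' by (auto simp: doubleton_eq_iff)
    ultimately show ?thesis unfolding l by (auto simp: successively_append_iff)
  qed
  have new': "successively R' (q # rev l @ [p])"
    using successively_symp_rev[of R' "p # l @ [q]"] R' new by simp
  have wT: "w \<notin> T" using w by (auto simp: K4V_def)
  have sL': "set (L' x y) \<subseteq> insert w (set (L x y))" if "x \<in> T" "y \<in> T" "x \<noteq> y" for x y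
    using that sl' K4fD(3)[OF f pq] by (auto simp: L'_def)
  have sL'': "L' x y = L x y" if "{x, y} \<noteq> {p, q}" for x y
  proof -
    have "\<not> (x = p \<and> y = q)" "\<not> (x = q \<and> y = p)" using that by (metis insert_commute)+
    then show ?thesis unfolding L'_def by (simp only: if_False)
  qed
  have "K4f R' T L'"
    unfolding K4f_def
  proof (intro conjI ballI impI)
    show "card T = 4" by (rule K4fD(1)[OF f])
    fix x y assume xy: "x \<in> T" "y \<in> T" "x \<noteq> y"
    show "successively R' (x # L' x y @ [y])"
    proof (cases "{x, y} = {p, q}")
      case True
      then have "x = p \<and> y = q \<or> x = q \<and> y = p" by (simp add: doubleton_eq_iff)
      then show ?thesis using new new' pq(3) unfolding L'_def by (elim disjE conjE) simp_all
    next
      case False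
      then show ?thesis using other[OF xy] sL''[of x y] by simp
    qed
    show "L' y x = rev (L' x y)" using K4fD(3)[OF f xy] xy(3) pq(3) unfolding L'_def by simp
    show "distinct (L' x y)" using K4fD(4)[OF f xy] dl unfolding L'_def by simp
    have "set (L x y) \<inter> T = {}" by (rule K4fD(5)[OF f xy])
    then show "set (L' x y) \<inter> T = {}" using sL'[OF xy] wT by auto
    fix r s assume rs: "r \<in> T" "s \<in> T" "r \<noteq> s" "{x, y} \<noteq> {r, s}"
    have 1: "set (L x y) \<inter> set (L r s) = {}" using K4fD(6)[OF f xy(1,2) rs(1,2) xy(3) rs(3,4)] .
    have wL: "w \<notin> set (L x y)" if "x \<in> T" "y \<in> T" "x \<noteq> y" for x y
      using w that unfolding K4V_def by blast
    have 2: "w \<notin> set (L x y)" "w \<notin> set (L r s)" using wL xy rs by blast+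
    show "set (L' x y) \<inter> set (L' r s) = {}"
    proof (cases "{x, y} = {p, q}")
      case True
      then have "L' r s = L r s" using sL''[of r s] rs by simp
      then show ?thesis using sL'[OF xy] 1 2 by auto
    next
      case False
      then have "L' x y = L x y" using sL''[of x y] by simp
      then show ?thesis using sL'[of r s] rs 1 2 by auto
    qed
  qed
  moreover have "K4V T L' \<subseteq> insert w (K4V T L)"
    using sL' unfolding K4V_def by blast
  ultimately show ?thesis by blast
qed

section \<open>Translating between subdivided digraphs and six explicit paths\<close>

lemma K4_subdivision_K4f:
  assumes "complete_digraph 4 (with_proj K)" "subdivision_pair K H"
  shows "\<exists>T L. K4f (\<lambda>u v. (u, v) \<in> parcs H) T L \<and> K4V T L \<subseteq> pverts H"
  using assms(2)
proof (induction rule: subdivision_pair_induct)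
  case base
  have K: "finite (pverts K)" "card (pverts K) = 4"
    "parcs K = {(u, v). (u, v) \<in> pverts K \<times> pverts K \<and> u \<noteq> v}"
    using assms(1) unfolding complete_digraph_pair_def by blast+
  have "K4f (\<lambda>u v. (u, v) \<in> parcs K) (pverts K) (\<lambda>_ _. [])"
    unfolding K4f_def K(3) by (simp add: K)
  moreover have "K4V (pverts K) (\<lambda>_ _. []) \<subseteq> pverts K"
    by (simp add: K4V_def)
  ultimately show ?case by blast
next
  case (divide e w H)
  obtain u v where e: "e = (u, v)" by (cases e)
  interpret H: pair_bidirected_digraph H
    using divide by (auto intro: bidirected_digraphI_subdivision)
  have H': "parcs (subdivide H e w) = (parcs H - {(u, v), (v, u)}) \<union> {(u, w), (w, u), (w, v), (v, w)}"
    "pverts (subdivide H e w) = pverts H \<union> {w}"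
    by (auto simp: e subdivide.simps)
  from divide obtain T L where TL: "K4f (\<lambda>u v. (u, v) \<in> parcs H) T L" "K4V T L \<subseteq> pverts H" by blast
  have "u \<noteq> v" using divide e H.no_loops by fastforce
  have sy: "(x, y) \<in> parcs H \<Longrightarrow> (y, x) \<in> parcs H" for x y
    by (rule H.arcs_symmetric)
  have "\<exists>L'. K4f (\<lambda>u v. (u, v) \<in> parcs (subdivide H e w)) T L' \<and> K4V T L' \<subseteq> insert w (K4V T L)"
    by (rule K4f_subdivide[OF TL(1), where u = u and v = v])
      (use sy divide TL \<open>u \<noteq> v\<close> in \<open>auto simp: H' doubleton_eq_iff\<close>)
  then show ?case using TL unfolding H' by blast
qed

lemma not_series_parallel_K4f:
  assumes "\<not> series_parallel G"
  shows "\<exists>T L. K4f (\<lambda>u v. (u, v) \<in> parcs G) T L \<and> K4V T L \<subseteq> pverts G"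
proof -
  obtain H K where H: "subgraph (with_proj H) (with_proj G)"
    and K: "complete_digraph 4 (with_proj K)" "subdivision_pair K H"
    using assms by (auto simp: series_parallel_def K4_subdivision_def)
  from K4_subdivision_K4f[OF K] obtain T L where
    TL: "K4f (\<lambda>u v. (u, v) \<in> parcs H) T L" "K4V T L \<subseteq> pverts H" by blast
  have sub: "parcs H \<subseteq> parcs G" "pverts H \<subseteq> pverts G" using H by (auto simp: subgraph_def)
  have mono: "successively (\<lambda>u v. (u, v) \<in> parcs H) xs \<Longrightarrow> successively (\<lambda>u v. (u, v) \<in> parcs G) xs" for xs
    by (erule successively_mono) (use sub in auto)
  have "K4f (\<lambda>u v. (u, v) \<in> parcs G) T L"
    unfolding K4f_def
    by (intro conjI ballI impI; (rule K4fD(1,3-)[OF TL(1)] | rule mono[OF K4fD(2)[OF TL(1)]]); assumption)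
  then show ?thesis using TL(2) sub(2) by blast
qed

text \<open>Subdivide the edge at the first vertex of \<open>l\<close>; the rest of \<open>l\<close>
  then replaces the second of the two new edges.\<close>

lemma subdivision_pair_path:
  assumes "subdivision_pair K H" "(a, b) \<in> parcs H" "distinct l" "set l \<inter> pverts H = {}"
  shows "subdivision_pair K
    \<lparr>pverts = pverts H \<union> set l, parcs = parcs H - {(a, b), (b, a)} \<union> pe (a # l @ [b])\<rparr>"
  using assms
proof (induction l arbitrary: a H)
  case Nil
  interpret H: pair_bidirected_digraph H
    using Nil by (auto intro: bidirected_digraphI_subdivision)
  have "(b, a) \<in> parcs H" using Nil H.arcs_symmetric by blast
  then have "\<lparr>pverts = pverts H \<union> set [], parcs = parcs H - {(a, b), (b, a)} \<union> pe (a # [] @ [b])\<rparr> = H"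
    using Nil by (cases H) auto
  then show ?case using Nil by simp
next
  case (Cons x l)
  interpret H: pair_bidirected_digraph H
    using Cons by (auto intro: bidirected_digraphI_subdivision)
  have ab: "a \<noteq> x" "b \<noteq> x" "a \<noteq> b" and xH: "\<And>y. (x, y) \<notin> parcs H \<and> (y, x) \<notin> parcs H"
    using Cons.prems H.in_arcsD1 H.in_arcsD2 H.no_loops by fastforce+
  define H1 where "H1 = subdivide H (a, b) x"
  have H1: "pverts H1 = insert x (pverts H)"
    "parcs H1 = (parcs H - {(a, b), (b, a)}) \<union> {(a, x), (x, a), (x, b), (b, x)}"
    by (auto simp: H1_def subdivide.simps)
  have "subdivision_pair K H1"
    unfolding H1_def using Cons.prems by (intro subdivision_pair_intros) auto
  then have "subdivision_pair K
    \<lparr>pverts = pverts H1 \<union> set l, parcs = parcs H1 - {(x, b), (b, x)} \<union> pe (x # l @ [b])\<rparr>"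
    by (rule Cons.IH) (use Cons.prems H1 in auto)
  moreover have "pverts H1 \<union> set l = pverts H \<union> set (x # l)" by (simp add: H1)
  moreover have "parcs H1 - {(x, b), (b, x)} \<union> pe (x # l @ [b]) =
      parcs H - {(a, b), (b, a)} \<union> pe (a # (x # l) @ [b])"
    using ab xH by (auto simp: H1)
  ultimately show ?case by simp
qed

text \<open>Replace the six edges of a complete graph one after the other by paths.\<close>

lemma K4m_subdivision:
  assumes m: "K4m R a b c d ab ac ad bc bd cd"
    and V: "pverts H = set (a # b # c # d # ab @ ac @ ad @ bc @ bd @ cd)"
    and A: "parcs H = pe (a # ab @ [b]) \<union> pe (a # ac @ [c]) \<union> pe (a # ad @ [d])
      \<union> pe (b # bc @ [c]) \<union> pe (b # bd @ [d]) \<union> pe (c # cd @ [d])"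
  shows "K4_subdivision H"
proof -
  define T where "T = {a, b, c, d}"
  have n: "a \<noteq> b" "a \<noteq> c" "a \<noteq> d" "b \<noteq> c" "b \<noteq> d" "c \<noteq> d"
    "b \<noteq> a" "c \<noteq> a" "d \<noteq> a" "c \<noteq> b" "d \<noteq> b" "d \<noteq> c"
    using m by (auto simp: K4m_def)
  have di: "distinct ab" "distinct ac" "distinct ad" "distinct bc" "distinct bd" "distinct cd"
    "set ab \<inter> T = {}" "set ac \<inter> T = {}" "set ad \<inter> T = {}"
    "set bc \<inter> T = {}" "set bd \<inter> T = {}" "set cd \<inter> T = {}"
    using m by (auto simp: K4m_def T_def)
  have x: "set ac \<inter> set ab = {}" "set ad \<inter> (set ab \<union> set ac) = {}"
    "set bc \<inter> (set ab \<union> set ac \<union> set ad) = {}" "set bd \<inter> (set ab \<union> set ac \<union> set ad \<union> set bc) = {}"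
    "set cd \<inter> (set ab \<union> set ac \<union> set ad \<union> set bc \<union> set bd) = {}"
    using m unfolding K4m_def by (simp_all add: Int_Un_distrib Int_commute)
  have pT: "pe (p # l @ [q]) \<inter> T \<times> T \<subseteq> {(p, q), (q, p)}" if "set l \<inter> T = {}" for p l q
    using pe_branch[OF that] by blast
  define K where "K = \<lparr>pverts = T, parcs = {(u, v). (u, v) \<in> T \<times> T \<and> u \<noteq> v}\<rparr>"
  have K: "complete_digraph 4 (with_proj K)"
    using n by (simp add: complete_digraph_pair_def K_def T_def)
  interpret K: pair_graph K using K by (rule pair_graphI_complete)
  have s0: "subdivision_pair K K"
    by (rule subdivision_pair_base) unfold_locales
  define P where "P p l q = pe (p # l @ [q])" for p q :: 'a and l
  define D where "D p q = {(p, q), (q, p)}" for p q :: 'a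
  \<comment> \<open>An edge still waiting for its turn survives the replacement of a different
    edge.\<close>
  have keep: "(p, q) \<in> X - D p' q' \<union> P p' l q'" if "(p, q) \<in> X" "{p, q} \<noteq> {p', q'}" for p q X p' q' l
    using that by (auto simp: D_def doubleton_eq_iff)
  have step: "subdivision_pair K \<lparr>pverts = pverts H \<union> set l, parcs = parcs H - D p q \<union> P p l q\<rparr>"
    if "subdivision_pair K H" "(p, q) \<in> parcs H" "distinct l" "set l \<inter> pverts H = {}" for H p q l
    using subdivision_pair_path[OF that] by (simp only: P_def D_def)
  have KE: "(p, q) \<in> parcs K" if "p \<in> T" "q \<in> T" "p \<noteq> q" for p q
    using that by (simp add: K_def)
  have T: "a \<in> T" "b \<in> T" "c \<in> T" "d \<in> T" by (auto simp: T_def)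
  have ne: "{a, c} \<noteq> {a, b}" "{a, d} \<noteq> {a, b}" "{b, c} \<noteq> {a, b}" "{b, d} \<noteq> {a, b}" "{c, d} \<noteq> {a, b}"
    "{a, d} \<noteq> {a, c}" "{b, c} \<noteq> {a, c}" "{b, d} \<noteq> {a, c}" "{c, d} \<noteq> {a, c}"
    "{b, c} \<noteq> {a, d}" "{b, d} \<noteq> {a, d}" "{c, d} \<noteq> {a, d}" "{b, d} \<noteq> {b, c}" "{c, d} \<noteq> {b, c}"
    "{c, d} \<noteq> {b, d}"
    using n by (simp_all add: doubleton_eq_iff)
  have vK: "pverts K = T" by (simp add: K_def)
  have s1: "subdivision_pair K \<lparr>pverts = T \<union> set ab, parcs = parcs K - D a b \<union> P a ab b\<rparr>"
    using step[OF s0, of a b ab] KE T n di by (simp add: vK)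
  have s2: "subdivision_pair K \<lparr>pverts = T \<union> set ab \<union> set ac,
      parcs = parcs K - D a b \<union> P a ab b - D a c \<union> P a ac c\<rparr>"
    using step[OF s1, of a c ac] keep KE T n di x ne by (simp add: Int_Un_distrib)
  have s3: "subdivision_pair K \<lparr>pverts = T \<union> set ab \<union> set ac \<union> set ad,
      parcs = parcs K - D a b \<union> P a ab b - D a c \<union> P a ac c - D a d \<union> P a ad d\<rparr>"
    using step[OF s2, of a d ad] keep KE T n di x ne by (simp add: Int_Un_distrib)
  have s4: "subdivision_pair K \<lparr>pverts = T \<union> set ab \<union> set ac \<union> set ad \<union> set bc,
      parcs = parcs K - D a b \<union> P a ab b - D a c \<union> P a ac c - D a d \<union> P a ad d - D b c \<union> P b bc c\<rparr>"
    using step[OF s3, of b c bc] keep KE T n di x ne by (simp add: Int_Un_distrib)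
  have s5: "subdivision_pair K \<lparr>pverts = T \<union> set ab \<union> set ac \<union> set ad \<union> set bc \<union> set bd,
      parcs = parcs K - D a b \<union> P a ab b - D a c \<union> P a ac c - D a d \<union> P a ad d - D b c \<union> P b bc c
        - D b d \<union> P b bd d\<rparr>"
    using step[OF s4, of b d bd] keep KE T n di x ne by (simp add: Int_Un_distrib)
  have s6: "subdivision_pair K \<lparr>pverts = T \<union> set ab \<union> set ac \<union> set ad \<union> set bc \<union> set bd \<union> set cd,
      parcs = parcs K - D a b \<union> P a ab b - D a c \<union> P a ac c - D a d \<union> P a ad d - D b c \<union> P b bc c
        - D b d \<union> P b bd d - D c d \<union> P c cd d\<rparr>"
    using step[OF s5, of c d cd] keep KE T n di x ne by (simp add: Int_Un_distrib)
  have D: "D p q \<subseteq> T \<times> T" if "p \<in> T" "q \<in> T" for p q using that by (auto simp: D_def)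
  have PD: "P p l q \<inter> D r s = {}" if "set l \<inter> T = {}" "r \<in> T" "s \<in> T" "{r, s} \<noteq> {p, q}" for p l q r s
    using pT[OF that(1), of p q] D[OF that(2,3)] that(4) unfolding P_def D_def by (auto simp: doubleton_eq_iff)
  have KD: "parcs K \<subseteq> D a b \<union> D a c \<union> D a d \<union> D b c \<union> D b d \<union> D c d"
    by (auto simp: K_def T_def D_def)
  have PD': "P a ab b \<inter> D a c = {}" "P a ab b \<inter> D a d = {}" "P a ab b \<inter> D b c = {}" "P a ab b \<inter> D b d = {}"
    "P a ab b \<inter> D c d = {}" "P a ac c \<inter> D a d = {}" "P a ac c \<inter> D b c = {}" "P a ac c \<inter> D b d = {}"
    "P a ac c \<inter> D c d = {}" "P a ad d \<inter> D b c = {}" "P a ad d \<inter> D b d = {}" "P a ad d \<inter> D c d = {}"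
    "P b bc c \<inter> D b d = {}" "P b bc c \<inter> D c d = {}" "P b bd d \<inter> D c d = {}"
    by (rule PD; use di T ne in simp)+
  \<comment> \<open>The six removals exhaust the edges of \<open>K\<close>, and by
    \<open>PD'\<close> none of them hits a path inserted earlier.\<close>
  have "parcs K - D a b \<union> P a ab b - D a c \<union> P a ac c - D a d \<union> P a ad d - D b c \<union> P b bc c
        - D b d \<union> P b bd d - D c d \<union> P c cd d =
      P a ab b \<union> P a ac c \<union> P a ad d \<union> P b bc c \<union> P b bd d \<union> P c cd d"
    using KD by (simp add: Un_Diff Diff_triv PD') blast
  then have "H = \<lparr>pverts = T \<union> set ab \<union> set ac \<union> set ad \<union> set bc \<union> set bd \<union> set cd,
      parcs = parcs K - D a b \<union> P a ab b - D a c \<union> P a ac c - D a d \<union> P a ad d - D b c \<union> P b bc c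
        - D b d \<union> P b bd d - D c d \<union> P c cd d\<rparr>"
    using A V by (cases H) (auto simp: P_def T_def)
  then show ?thesis using s6 K unfolding K4_subdivision_def by auto
qed

text \<open>Since the edges among \<open>W\<close> are exactly those of the six paths, the induced
  subgraph on \<open>W\<close> is itself the subdivision.\<close>

lemma not_ISK4_free:
  assumes "pair_graph G" and m: "K4m R a b c d ab ac ad bc bd cd"
    and W: "W = set (a # b # c # d # ab @ ac @ ad @ bc @ bd @ cd)" "W \<subseteq> pverts G"
    and A: "{(u, v) \<in> parcs G. u \<in> W \<and> v \<in> W} = pe (a # ab @ [b]) \<union> pe (a # ac @ [c]) \<union> pe (a # ad @ [d])
      \<union> pe (b # bc @ [c]) \<union> pe (b # bd @ [d]) \<union> pe (c # cd @ [d])"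
  shows "\<not> ISK4_free G"
proof -
  interpret pair_graph G by fact
  define H where "H = \<lparr>pverts = W, parcs = {(u, v) \<in> parcs G. u \<in> W \<and> v \<in> W}\<rparr>"
  have "K4_subdivision H"
    using m by (rule K4m_subdivision) (simp_all only: H_def A[symmetric] W(1)[symmetric] pair_pre_digraph.simps)
  moreover have "wf_digraph (with_proj H)"
    by unfold_locales (auto simp: H_def)
  then have "induced_subgraph (with_proj H) (with_proj G)"
    using W(2) wf_digraph by (auto simp: induced_subgraph_def subgraph_def H_def compatible_def)
  ultimately show ?thesis by (auto simp: ISK4_free_def)
qed

section \<open>Triangle-free graphs that are not series-parallel\<close>

lemma K4mD:
  assumes "K4m R a b c d ab ac ad bc bd cd"
  shows "distinct (a # b # c # d # ab @ ac @ ad @ bc @ bd @ cd)"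
    "successively R (a # ab @ [b])" "successively R (a # ac @ [c])" "successively R (a # ad @ [d])"
    "successively R (b # bc @ [c])" "successively R (b # bd @ [d])" "successively R (c # cd @ [d])"
  using assms unfolding K4m_def by blast+

text \<open>For rebuilding a subdivision from the vertices of another one: \<open>rs\<close>
  collects the vertices that are dropped, and comparing multisets gives distinctness of all lists at
  once. In a smallest subdivision \<open>rs\<close> must turn out empty.\<close>

lemma K4mI:
  assumes "distinct xs" "mset (rs @ a # b # c # d # ab @ ac @ ad @ bc @ bd @ cd) = mset xs"
    "successively R (a # ab @ [b])" "successively R (a # ac @ [c])" "successively R (a # ad @ [d])"
    "successively R (b # bc @ [c])" "successively R (b # bd @ [d])" "successively R (c # cd @ [d])"
  shows "K4m R a b c d ab ac ad bc bd cd"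
proof -
  have "distinct (rs @ a # b # c # d # ab @ ac @ ad @ bc @ bd @ cd)"
    using assms(1) mset_eq_imp_distinct_iff[OF assms(2)] by blast
  then have "distinct (a # b # c # d # ab @ ac @ ad @ bc @ bd @ cd)"
    unfolding distinct_append by blast
  then show ?thesis using assms(3-) unfolding K4m_def by blast
qed

text \<open>The three transpositions of neighbouring branch vertices generate all permutations, so
  symmetric cases reduce to one naming.\<close>

lemma K4m_swap:
  assumes "\<And>x y. R x y \<Longrightarrow> R y x" and m: "K4m R a b c d ab ac ad bc bd cd"
  shows "K4m R b a c d (rev ab) bc bd ac ad cd"
    and "K4m R a c b d ac ab ad (rev bc) cd bd"
    and "K4m R a b d c ab ad ac bd bc (rev cd)"
proof -
  have rv: "successively R (rev xs)" if "successively R xs" for xs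
    using assms(1) that by (rule successively_symp_rev)
  note 2 = K4mD(2-)[OF m]
  have 3: "successively R (b # rev ab @ [a])" "successively R (c # rev bc @ [b])"
    "successively R (d # rev cd @ [c])"
    using 2 rv[of "a # ab @ [b]"] rv[of "b # bc @ [c]"] rv[of "c # cd @ [d]"] by simp_all
  show "K4m R b a c d (rev ab) bc bd ac ad cd"
    by (rule K4mI[OF K4mD(1)[OF m], of "[]"]) (fact 2 3 | simp)+
  show "K4m R a c b d ac ab ad (rev bc) cd bd"
    by (rule K4mI[OF K4mD(1)[OF m], of "[]"]) (fact 2 3 | simp)+
  show "K4m R a b d c ab ad ac bd bc (rev cd)"
    by (rule K4mI[OF K4mD(1)[OF m], of "[]"]) (fact 2 3 | simp)+
qed

lemma pe_gap:
  assumes d: "distinct (p @ u # q @ v # r)" and "q \<noteq> []"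
  shows "(u, v) \<notin> pe (p @ u # q @ v # r)"
proof -
  have "pe (p @ u # q @ v # r) = pe (p @ [u]) \<union> (pe (u # q @ [v]) \<union> pe (v # r))"
    by (subst pe_append) (use pe_append[of "u # q" v r] in simp)
  moreover have "(u, v) \<notin> pe (p @ [u])" "(u, v) \<notin> pe (v # r)"
    using d by (auto dest: pe_subset)
  moreover have "(u, v) \<notin> pe (u # q @ [v])"
    using pe_branch[of q "{u, v}" u v u v] d assms(2) by auto
  ultimately show ?thesis by blast
qed

section \<open>Chords of a smallest subdivision of K4\<close>

locale triangle_free_graph = sgraph +
  assumes tri: "E a b \<Longrightarrow> E b c \<Longrightarrow> \<not> E a c"
begin

text \<open>Counting interior vertices is enough: there are always four branch vertices in
  addition.\<close>

definition minK :: "nat \<Rightarrow> bool" where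
  "minK M \<longleftrightarrow> (\<forall>a b c d ab ac ad bc bd cd. K4m E a b c d ab ac ad bc bd cd \<longrightarrow>
     M \<le> length ab + length ac + length ad + length bc + length bd + length cd)"

lemma minKD: "minK M \<Longrightarrow> K4m E a b c d ab ac ad bc bd cd \<Longrightarrow>
     M \<le> length ab + length ac + length ad + length bc + length bd + length cd"
  unfolding minK_def by blast

lemma swaps:
  assumes "K4m E a b c d ab ac ad bc bd cd"
  shows "K4m E b a c d (rev ab) bc bd ac ad cd"
    and "K4m E a c b d ac ab ad (rev bc) cd bd"
    and "K4m E a b d c ab ad ac bd bc (rev cd)"
  by (rule K4m_swap[OF _ assms]; erule Esym)+

lemma wk_revD: "successively E (a # xs @ [b]) \<Longrightarrow> successively E (b # rev xs @ [a])"
  using wk_rev[of "a # xs @ [b]"] by simp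

lemma wk_split:
  assumes "successively E (a # (xs @ y # ys) @ [b])"
  shows "successively E (a # xs @ [y])" "successively E (y # ys @ [b])"
  using wk_append[of "a # xs" y "ys @ [b]"] assms by simp_all

lemma wk_join:
  assumes "successively E (a # xs @ [y])" "successively E (y # ys @ [b])"
  shows "successively E (a # (xs @ y # ys) @ [b])"
  using wk_append[of "a # xs" y "ys @ [b]"] assms by simp

text \<open>The chord bypasses the nonempty stretch \<open>q\<close>, and the same branch vertices
  carry a smaller subdivision.\<close>

lemma chord_same_path:
  assumes m: "K4m E a b c d ab ac ad bc bd cd"
    and M: "minK (length ab + length ac + length ad + length bc + length bd + length cd)"
    and e: "a # ab @ [b] = p @ u # q @ v # r" "q \<noteq> []" "E u v"
  shows False
proof -
  \<comment> \<open>The shortened path keeps its ends; the cases only record whether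
    \<open>u\<close> or \<open>v\<close> is one of them.\<close>
  obtain l where l: "a # l @ [b] = p @ u # v # r"
  proof (cases p)
    case Nil
    show thesis
    proof (cases r rule: rev_cases)
      case Nil then show thesis using that[of "[]"] e \<open>p = []\<close> by auto
    next
      case (snoc r' z) then show thesis using that[of "v # r'"] e \<open>p = []\<close> by auto
    qed
  next
    case (Cons y p')
    show thesis
    proof (cases r rule: rev_cases)
      case Nil
      then have "b = v" "ab = p' @ u # q" using e Cons
        by (metis append_Cons append_assoc append1_eq_conv list.inject)+
      then show thesis using that[of "p' @ [u]"] e Cons Nil by auto
    next
      case (snoc r' z)
      then have "(a # ab) @ [b] = (p @ u # q @ v # r') @ [z]" using e(1) by simp
      then have "b = z" by blast
      then show thesis using that[of "p' @ u # v # r'"] e Cons snoc by auto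
    qed
  qed
  have len: "length ab = length l + length q"
    using arg_cong[OF e(1), of length] arg_cong[OF l, of length] by simp
  have ms: "mset (q @ l) = mset ab"
  proof -
    have "add_mset a (add_mset b (mset (q @ l))) = mset q + mset (a # l @ [b])" by simp
    also have "\<dots> = mset (a # ab @ [b])" unfolding l e(1) by simp
    finally show ?thesis by simp
  qed
  have w: "successively E (a # l @ [b])"
  proof -
    have "successively E (p @ u # q @ v # r)" using K4mD(2)[OF m] unfolding e(1) .
    then show ?thesis unfolding l using e(3)
      wk_append[of p u "q @ v # r"] wk_append[of "u # q" v r] wk_append[of p u "v # r"] by simp
  qed
  have "K4m E a b c d l ac ad bc bd cd"
  proof (rule K4mI[OF K4mD(1)[OF m] _ w K4mD(3-)[OF m]])
    show "mset (q @ a # b # c # d # l @ ac @ ad @ bc @ bd @ cd) =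
        mset (a # b # c # d # ab @ ac @ ad @ bc @ bd @ cd)"
      using ms by (simp add: add.assoc[symmetric])
  qed
  from minKD[OF M this] show False using len e(2) by simp
qed

text \<open>Move the branch vertex from \<open>a\<close> to \<open>v\<close>: the path to
  \<open>b\<close> starts with the chord, and the path to \<open>d\<close> passes through
  \<open>a\<close>. Only \<open>a1\<close> is lost. Applied from both sides, this makes
  \<open>a\<close>, \<open>u\<close>, \<open>v\<close> a triangle.\<close>

lemma chord_adjacent_half:
  assumes m: "K4m E a b c d (a1 @ u # a2) (c1 @ v # c2) ad bc bd cd"
    and M: "minK (length (a1 @ u # a2) + length (c1 @ v # c2) + length ad + length bc + length bd + length cd)"
    and e: "E u v"
  shows "a1 = []"
proof -
  note w = K4mD(2-)[OF m] wk_split[OF K4mD(2)[OF m]] wk_split[OF K4mD(3)[OF m]]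
  have j: "successively E (v # (u # a2) @ [b])" using w Esym[OF e] by simp
  have "K4m E v b c d (u # a2) c2 (rev c1 @ a # ad) bc bd cd"
    by (rule K4mI[OF K4mD(1)[OF m], of a1]) (simp, (fact w j wk_join[OF wk_revD[OF w(9)] w(3)])+)
  from minKD[OF M this] show ?thesis by simp
qed

text \<open>With branch vertices \<open>b\<close>, \<open>d\<close>, \<open>u\<close>,
  \<open>v\<close> the chord is a branch path and \<open>ac\<close> is dropped; with
  \<open>b\<close>, \<open>c\<close>, \<open>d\<close>, \<open>v\<close> the part \<open>a1\<close>
  is dropped. Under all symmetries the four cross paths and the four half paths become empty, and
  the six remaining vertices form a K33.\<close>

lemma chord_opposite:
  assumes m: "K4m E a b c d (a1 @ u # a2) ac ad bc bd (c1 @ v # c2)"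
    and M: "minK (length (a1 @ u # a2) + length ac + length ad + length bc + length bd + length (c1 @ v # c2))"
    and e: "E u v"
  shows "ac = []" "a1 = []"
proof -
  note w = K4mD(2-)[OF m] wk_split[OF K4mD(2)[OF m]] wk_split[OF K4mD(7)[OF m]]
  note r = w[THEN wk_revD]
  have 1: "successively E (u # [] @ [v])" using e by simp
  have "K4m E b d u v bd (rev a2) (bc @ c # c1) (rev ad @ a # a1) (rev c2) []"
    by (rule K4mI[OF K4mD(1)[OF m], of ac])
      (simp, (fact w r 1 wk_join[OF w(4) w(9)] wk_join[OF r(3) w(7)])+)
  from minKD[OF M this] show "ac = []" by simp
  have 2: "successively E (b # (rev a2 @ [u]) @ [v])"
    using wk_join[OF r(8) 1] by simp
  have "K4m E b c d v bc bd (rev a2 @ [u]) (rev ac @ a # ad) c1 (rev c2)"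
    by (rule K4mI[OF K4mD(1)[OF m], of a1])
      (simp, (fact w r 2 wk_join[OF r(2) w(3)])+)
  from minKD[OF M this] show "a1 = []" by simp
qed

text \<open>Making \<open>u\<close> a branch vertex in place of \<open>a\<close> drops
  \<open>ad\<close>, in place of \<open>c\<close> it drops \<open>cd\<close>. By symmetry
  \<open>bd\<close> is empty too, so \<open>d\<close> is adjacent to the other three branch
  vertices.\<close>

lemma chord_hub:
  assumes m: "K4m E a b c d (a1 @ u # a2) ac ad bc bd cd"
    and M: "minK (length (a1 @ u # a2) + length ac + length ad + length bc + length bd + length cd)"
    and e: "E d u"
  shows "ad = []" "cd = []"
proof -
  note w = K4mD(2-)[OF m] wk_split[OF K4mD(2)[OF m]]
  note r = w[THEN wk_revD]
  have 1: "successively E (d # [] @ [u])" using e by simp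
  have "K4m E d u b c [] (rev bd) (rev cd) a2 (rev a1 @ a # ac) bc"
    by (rule K4mI[OF K4mD(1)[OF m], of ad])
      (simp, (fact w r 1 wk_join[OF r(7) w(2)])+)
  from minKD[OF M this] show "ad = []" by simp
  have "K4m E d a b u (rev ad) (rev bd) [] (ac @ c # rev bc) a1 (rev a2)"
    by (rule K4mI[OF K4mD(1)[OF m], of cd])
      (simp, (fact w r 1 wk_join[OF w(2) r(4)])+)
  from minKD[OF M this] show "cd = []" by simp
qed

definition PE :: "'a set \<Rightarrow> ('a \<Rightarrow> 'a \<Rightarrow> 'a list) \<Rightarrow> ('a \<times> 'a) set" where
  "PE T L = (\<Union>p\<in>T. \<Union>q\<in>T - {p}. pe (p # L p q @ [q]))"

lemma PE_iff:
  assumes f: "K4f E T L" and T: "p \<in> T" "q \<in> T" "r \<in> T" "s \<in> T" and d: "distinct [p, q, r, s]"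
  shows "PE T L = pe (p # L p q @ [q]) \<union> pe (p # L p r @ [r]) \<union> pe (p # L p s @ [s])
      \<union> pe (q # L q r @ [r]) \<union> pe (q # L q s @ [s]) \<union> pe (r # L r s @ [s])"
proof -
  note T' = K4f_K4m(3)[OF f T d]
  have n: "{p, q, r, s} - {p} = {q, r, s}" "{p, q, r, s} - {q} = {p, r, s}"
    "{p, q, r, s} - {r} = {p, q, s}" "{p, q, r, s} - {s} = {p, q, r}"
    using d by auto
  have "pe (y # L y x @ [x]) = pe (x # L x y @ [y])" if "x \<in> T" "y \<in> T" "x \<noteq> y" for x y
    using K4fD(3)[OF f that] pe_rev[of "x # L x y @ [y]"] by simp
  then have "pe (q # L q p @ [p]) = pe (p # L p q @ [q])" "pe (r # L r p @ [p]) = pe (p # L p r @ [r])"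
    "pe (s # L s p @ [p]) = pe (p # L p s @ [s])" "pe (r # L r q @ [q]) = pe (q # L q r @ [r])"
    "pe (s # L s q @ [q]) = pe (q # L q s @ [s])" "pe (s # L s r @ [r]) = pe (r # L r s @ [s])"
    using T d by auto
  then show ?thesis unfolding PE_def T' by (simp add: n Un_ac)
qed

lemma K4f_rest:
  assumes "K4f E T L" "p \<in> T" "q \<in> T" "p \<noteq> q"
  obtains r s where "r \<in> T" "s \<in> T" "distinct [p, q, r, s]"
proof -
  have "finite T" using K4fD(1)[OF assms(1)] by (metis card.infinite zero_neq_numeral)
  then have "card (T - {p, q}) = 2" using assms K4fD(1)[OF assms(1)] by (simp add: card_Diff_subset)
  then obtain r s where "T - {p, q} = {r, s}" "r \<noteq> s" by (auto simp: card_2_iff)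
  then show thesis using that[of r s] assms by auto
qed

text \<open>A chord within one path, or between two paths with a common end, contradicts minimality
  or triangle-freeness. Opposite paths give a K33. What is left is a branch vertex \<open>s\<close>
  joined to the interior of a path that does not end in \<open>s\<close>. The second alternative
  records where the chord lies, since the lemma is applied again to chords of the resulting
  rim.\<close>

lemma chord_cases:
  assumes f: "K4f E T L" and M: "\<forall>T' L'. K4f E T' L' \<longrightarrow> card (K4V T L) \<le> card (K4V T' L')"
    and xy: "x \<in> K4V T L" "y \<in> K4V T L" "E x y" "(x, y) \<notin> PE T L"
  shows "(\<exists>a b c d u v. distinct [a, b, c, d, u, v] \<and>
        (\<forall>p\<in>{a, b, v}. \<forall>q\<in>{c, d, u}. E p q)) \<or>
      (\<exists>p q s. p \<in> T \<and> q \<in> T \<and> s \<in> T \<and> distinct [p, q, s] \<and> {x, y} \<inter> set (L p q) \<noteq> {} \<and> s \<in> {x, y} \<and>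
        (\<forall>t\<in>T - {s}. L s t = []))"
proof -
  have K: "K4m E p q r s (L p q) (L p r) (L p s) (L q r) (L q s) (L r s)"
    and mK: "minK (length (L p q) + length (L p r) + length (L p s) + length (L q r) + length (L q s)
      + length (L r s))"
    and T: "T = {p, q, r, s}"
    if "p \<in> T" "q \<in> T" "r \<in> T" "s \<in> T" "distinct [p, q, r, s]" for p q r s
  proof -
    note 1 = K4f_K4m[OF f that]
    show "K4m E p q r s (L p q) (L p r) (L p s) (L q r) (L q s) (L r s)" by (rule 1)
    show "T = {p, q, r, s}" by (rule 1)
    have c: "card (K4V T L) = 4 + (length (L p q) + length (L p r) + length (L p s) + length (L q r)
      + length (L q s) + length (L r s))"
      using distinct_card[OF K4mD(1)[OF 1(1)]] unfolding 1(2) by simp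
    show "minK (length (L p q) + length (L p r) + length (L p s) + length (L q r) + length (L q s)
      + length (L r s))"
      unfolding minK_def
    proof (intro allI impI)
      fix a b c d ab ac ad bc bd cd
      assume m: "K4m E a b c d ab ac ad bc bd cd"
      let ?L = "K4t a b c d ab ac ad bc bd cd"
      have "card (K4V {a, b, c, d} ?L) =
          4 + (length ab + length ac + length ad + length bc + length bd + length cd)"
      proof -
        have "K4V {a, b, c, d} ?L = set (a # b # c # d # ab @ ac @ ad @ bc @ bd @ cd)"
          using Esym m by (rule K4m_K4f)
        then show ?thesis using distinct_card[OF K4mD(1)[OF m]] by simp
      qed
      moreover have "K4f E {a, b, c, d} ?L" using Esym m by (rule K4m_K4f)
      ultimately have "card (K4V T L) \<le>
          4 + (length ab + length ac + length ad + length bc + length bd + length cd)"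
        using M by metis
      then show "length (L p q) + length (L p r) + length (L p s) + length (L q r) + length (L q s)
        + length (L r s) \<le> length ab + length ac + length ad + length bc + length bd + length cd"
        using c by simp
    qed
  qed
  have PEI: "pe (p # L p q @ [q]) \<subseteq> PE T L" if "p \<in> T" "q \<in> T" "p \<noteq> q" for p q
    unfolding PE_def using that by blast
  have yx: "E y x" "(y, x) \<notin> PE T L" using xy(3,4) Esym PE_def by (auto dest: pe_sym)
  have same: False if u: "u \<in> set (p # L p q @ [q])" "v \<in> set (p # L p q @ [q])"
    and pq: "p \<in> T" "q \<in> T" "p \<noteq> q" and uv: "E u v" "(u, v) \<notin> PE T L" for p q u v
  proof -
    obtain r s where rs: "r \<in> T" "s \<in> T" "distinct [p, q, r, s]" using K4f_rest[OF f pq] .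
    have *: False if "p # L p q @ [q] = a @ u' # b @ v' # c" "E u' v'" "{u', v'} = {u, v}" for a b c u' v'
    proof (cases "b = []")
      case True
      then have "(u', v') \<in> pe (p # L p q @ [q])"
        using that(1) pe_append[of a u' "v' # c"] by simp
      then show False using PEI[OF pq] uv that(3) pe_sym by (fastforce simp: doubleton_eq_iff)
    next
      case False
      show ?thesis
        by (rule chord_same_path[OF K[OF pq(1,2) rs] mK[OF pq(1,2) rs] that(1) False that(2)])
    qed
    have "u \<noteq> v" using uv Eirr by blast
    obtain a b where ab: "p # L p q @ [q] = a @ u # b" using split_list[OF u(1)] by blast
    show False
    proof (cases "v \<in> set b")
      case True
      then obtain b1 b2 where "b = b1 @ v # b2" using split_list by fastforce
      then show False using *[of a u b1 v b2] ab uv by simp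
    next
      case False
      then have "v \<in> set a" using u(2) ab \<open>u \<noteq> v\<close> by auto
      then obtain b1 b2 where "a = b1 @ v # b2" using split_list by fastforce
      then show False using *[of b1 v b2 u b] ab uv Esym by (simp add: insert_commute)
    qed
  qed
  have adj: False if pq: "p \<in> T" "q \<in> T" "r \<in> T" "distinct [p, q, r]"
    and u: "u \<in> set (L p q)" "v \<in> set (L p r)" and uv: "E u v" for p q r u v
  proof -
    obtain s where s: "s \<in> T" "distinct [p, q, r, s]"
    proof -
      obtain r' s' where "r' \<in> T" "s' \<in> T" "distinct [p, q, r', s']"
        using K4f_rest[OF f pq(1,2)] pq(4) by auto
      then show thesis using that[of r'] that[of s'] pq(4) by (cases "r = r'") auto
    qed
    obtain a1 a2 where a: "L p q = a1 @ u # a2" using split_list[OF u(1)] by blast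
    obtain c1 c2 where c: "L p r = c1 @ v # c2" using split_list[OF u(2)] by blast
    note k = K[OF pq(1-3) s] and mk = mK[OF pq(1-3) s]
    have "a1 = []"
      by (rule chord_adjacent_half[OF k[unfolded a c] mk[unfolded a c] uv])
    moreover have "c1 = []"
      by (rule chord_adjacent_half[OF swaps(2)[OF k, unfolded a c] _ Esym[OF uv]])
        (use mk[unfolded a c] in \<open>simp add: ac_simps\<close>)
    ultimately have "E p u" "E p v" using K4mD(2,3)[OF k] a c by simp_all
    then show False using tri uv by blast
  qed
  have opp: "\<exists>a b c d u v. distinct [a, b, c, d, u, v] \<and> (\<forall>p\<in>{a, b, v}. \<forall>q\<in>{c, d, u}. E p q)"
    if pq: "p \<in> T" "q \<in> T" "r \<in> T" "s \<in> T" "distinct [p, q, r, s]"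
      and u: "u \<in> set (L p q)" "v \<in> set (L r s)" and uv: "E u v" for p q r s u v
  proof -
    obtain a1 a2 where a: "L p q = a1 @ u # a2" using split_list[OF u(1)] by blast
    obtain c1 c2 where c: "L r s = c1 @ v # c2" using split_list[OF u(2)] by blast
    note k0 = K[OF pq] and mk0 = mK[OF pq]
    note k1 = k0[unfolded a c] and mk1 = mk0[unfolded a c]
    note 1 = chord_opposite[OF k1 mk1 uv]
    note k2 = swaps(1)[OF k1, simplified, unfolded append_assoc append_Cons append_Nil]
    have 2: "L q r = []" "a2 = []"
      using chord_opposite[of q p r s "rev a2" u "rev a1" "L q r" "L q s" "L p r" "L p s" c1 v c2] k2 mk1 uv
      by (simp_all add: ac_simps)
    note k3 = swaps(3)[OF k1, simplified, unfolded append_assoc append_Cons append_Nil]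
    have 3: "L p s = []" "L q s = []" "c2 = []" "c1 = []"
    proof -
      show "L p s = []"
        using chord_opposite(1)[of p q s r a1 u a2 "L p s" "L p r" "L q s" "L q r" "rev c2" v "rev c1"] k3 mk1 uv
        by (simp add: ac_simps)
      note k4 = swaps(1)[OF k3, simplified, unfolded append_assoc append_Cons append_Nil]
      show "L q s = []"
        using chord_opposite(1)[of q p s r "rev a2" u "rev a1" "L q s" "L q r" "L p s" "L p r" "rev c2" v "rev c1"]
          k4 mk1 uv by (simp add: ac_simps)
      \<comment> \<open>Exchange the two opposite paths, so that the halves of \<open>L r s\<close>
        take the place of those of \<open>L p q\<close>.\<close>
      obtain k5: "K4m E r s p q (c1 @ v # c2) (rev (L p r)) (rev (L q r)) (rev (L p s)) (rev (L q s)) (a1 @ u # a2)"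
        and mk5: "minK (length (c1 @ v # c2) + length (rev (L p r)) + length (rev (L q r)) +
          length (rev (L p s)) + length (rev (L q s)) + length (a1 @ u # a2))"
      proof
        have d: "distinct [r, s, p, q]" using pq(5) by auto
        have "L r p = rev (L p r)" "L r q = rev (L q r)" "L s p = rev (L p s)" "L s q = rev (L q s)"
          using K4fD(3)[OF f] pq by auto
        then show "K4m E r s p q (c1 @ v # c2) (rev (L p r)) (rev (L q r)) (rev (L p s)) (rev (L q s)) (a1 @ u # a2)"
          using K[OF pq(3,4,1,2) d] a c by simp
        show "minK (length (c1 @ v # c2) + length (rev (L p r)) + length (rev (L q r)) +
          length (rev (L p s)) + length (rev (L q s)) + length (a1 @ u # a2))"
          using mk1 by (simp add: ac_simps)
      qed
      show "c1 = []" by (rule chord_opposite(2)[OF k5 mk5 Esym[OF uv]])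
      note k6 = swaps(1)[OF k5, simplified, unfolded append_assoc append_Cons append_Nil]
      show "c2 = []"
        using chord_opposite(2)[of s r p q "rev c2" v "rev c1" "rev (L p s)" "rev (L q s)" "rev (L p r)"
          "rev (L q r)" a1 u a2] k6 mk5 Esym[OF uv] by (simp add: ac_simps)
    qed
    have "E p r" "E p s" "E q r" "E q s" "E p u" "E u q" "E r v" "E v s"
      using K4mD(2-)[OF k0] a c 1 2 3 by simp_all
    moreover have "distinct [p, q, r, s, u, v]"
      using K4mD(1)[OF k0] a c by auto
    moreover from calculation have "E q u" "E v r" "E v u" using uv Esym by blast+
    ultimately have "distinct [p, q, r, s, u, v] \<and> (\<forall>x\<in>{p, q, v}. \<forall>y\<in>{r, s, u}. E x y)" by simp
    then show ?thesis by blast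
  qed
  have hub: "\<forall>t\<in>T - {s}. L s t = []"
    if pq: "p \<in> T" "q \<in> T" "s \<in> T" "distinct [p, q, s]" and u: "u \<in> set (L p q)" and us: "E s u" for p q s u
  proof -
    obtain r where r: "r \<in> T" "distinct [p, q, r, s]"
    proof -
      obtain r' s' where "r' \<in> T" "s' \<in> T" "distinct [p, q, r', s']"
        using K4f_rest[OF f pq(1,2)] pq(4) by auto
      then show thesis using that[of r'] that[of s'] pq(4) by (cases "s = r'") auto
    qed
    obtain a1 a2 where a: "L p q = a1 @ u # a2" using split_list[OF u(1)] by blast
    note k1 = K[OF pq(1,2) r(1) pq(3) r(2), unfolded a] and mk1 = mK[OF pq(1,2) r(1) pq(3) r(2), unfolded a]
    note 1 = chord_hub[OF k1 mk1 us]
    note k2 = swaps(1)[OF k1, simplified, unfolded append_assoc append_Cons append_Nil]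
    have 2: "L q s = []"
      using chord_hub(1)[of q p r s "rev a2" u "rev a1" "L q r" "L q s" "L p r" "L p s" "L r s"] k2 mk1 us
      by (simp add: ac_simps)
    have "L s p = []" "L s q = []" "L s r = []"
      using 1 2 K4fD(3)[OF f] pq r by auto
    then show ?thesis using T[OF pq(1,2) r(1) pq(3) r(2)] by auto
  qed
  have loc: "z \<in> T \<or> (\<exists>p q. p \<in> T \<and> q \<in> T \<and> p \<noteq> q \<and> z \<in> set (L p q))" if "z \<in> K4V T L" for z
    using that unfolding K4V_def by blast
  have mixed: "\<exists>p q s. p \<in> T \<and> q \<in> T \<and> s \<in> T \<and> distinct [p, q, s] \<and> {x, y} \<inter> set (L p q) \<noteq> {} \<and> s \<in> {x, y} \<and>
        (\<forall>t\<in>T - {s}. L s t = [])"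
    if "u \<in> T" "p \<in> T" "q \<in> T" "p \<noteq> q" "v \<in> set (L p q)" "E u v" "(u, v) \<notin> PE T L" "{u, v} = {x, y}" for u v p q
  proof -
    have "u \<noteq> p" "u \<noteq> q" using same[of u p q v] that by auto
    then have "distinct [p, q, u]" using that by auto
    moreover from this have "\<forall>t\<in>T - {u}. L u t = []" using hub[of p q u v] that by blast
    moreover have "{x, y} \<inter> set (L p q) \<noteq> {}" "u \<in> {x, y}" using that(5,8) by blast+
    ultimately show ?thesis using that(1-3) by blast
  qed
  have rL: "set (L p q) = set (L q p)" if "p \<in> T" "q \<in> T" "p \<noteq> q" for p q
    using K4fD(3)[OF f that] by simp
  consider "x \<in> T" "y \<in> T" | p q where "x \<in> T" "p \<in> T" "q \<in> T" "p \<noteq> q" "y \<in> set (L p q)"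
    | p q where "y \<in> T" "p \<in> T" "q \<in> T" "p \<noteq> q" "x \<in> set (L p q)"
    | p q r s where "p \<in> T" "q \<in> T" "p \<noteq> q" "x \<in> set (L p q)" "r \<in> T" "s \<in> T" "r \<noteq> s" "y \<in> set (L r s)"
    using loc[OF xy(1)] loc[OF xy(2)] by blast
  then show ?thesis
  proof cases
    case 1
    have "x \<noteq> y" using xy(3) Eirr by blast
    then show ?thesis using same[of x x y y] 1 xy by auto
  next
    case 2
    then show ?thesis using mixed[of x p q y] xy by blast
  next
    case 3
    then show ?thesis using mixed[of y p q x] yx by blast
  next
    case (4 p q r s)
    show ?thesis
    proof (cases "{p, q} = {r, s}")
      case True
      then have "y \<in> set (L p q)" using 4 rL[of p q] by (auto simp: doubleton_eq_iff)
      then show ?thesis using same[of x p q y] 4 xy by auto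
    next
      case False
      consider "p = r" "q \<noteq> s" | "p = s" "q \<noteq> r" | "q = r" "p \<noteq> s" | "q = s" "p \<noteq> r" | "distinct [p, q, r, s]"
        using 4(3,7) False by auto
      then show ?thesis
      proof cases
        case 1 then show ?thesis using adj[of p q s x y] 4 xy(3) by auto
      next
        case 2 then show ?thesis using adj[of p q r x y] 4 xy(3) rL[of r s] by auto
      next
        case 3 then show ?thesis using adj[of q p s x y] 4 xy(3) rL[of p q] by auto
      next
        case q: 4 then show ?thesis using adj[of q p r x y] 4 xy(3) rL[of p q] rL[of r s] by auto
      next
        case 5 then show ?thesis using opp[of p q r s x y] 4 xy(3) by blast
      qed
    qed
  qed
qed

end

section \<open>Holes with three legs to a common vertex\<close>

context sgraph
begin

lemma hole_wk: "hole (x # xs) \<Longrightarrow> successively E (x # xs @ [x])"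
proof -
  assume h: "hole (x # xs)"
  then have ne: "xs \<noteq> []" by auto
  have "successively E xs" "E x (hd xs)" "E (last xs) x"
    using h ipath_wk Esym by auto
  with ne show ?thesis by (simp add: successively_Cons successively_append_iff)
qed

lemma hole_adj:
  assumes "hole (x # xs)" "u \<in> set (x # xs)" "v \<in> set (x # xs)" "E u v"
  shows "(u, v) \<in> pe (x # xs @ [x])"
proof -
  obtain y ys where xs: "xs = y # ys" "ys \<noteq> []"
    using assms(1) by (cases xs; cases "tl xs") auto
  obtain zs l where ys: "ys = zs @ [l]" using xs(2) by (cases ys rule: rev_cases) auto
  have p: "pe (x # xs @ [x]) = {(x, y), (y, x), (l, x), (x, l)} \<union> pe xs"
    using pe_append[of "y # zs" l "[x]"] by (simp add: xs ys) blast
  have h: "ipath xs" "apart {x} (set zs)" "x \<notin> set xs"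
    using assms(1) by (simp_all add: xs ys)
  have x: "w = y \<or> w = l" if "w \<in> set xs" "E x w" for w
    using that h(2) by (auto simp: xs ys apart_def)
  show ?thesis
    using assms(2-4) ipath_adj[OF h(1)] x Esym[OF assms(4)] Eirr unfolding p by auto
qed

text \<open>Edges from \<open>z\<close> to vertices of the hole other than \<open>c\<close> are left
  open here; \<open>spider\<close> restricts them by a separate hypothesis.\<close>

definition leg :: "'a list \<Rightarrow> 'a \<Rightarrow> 'a list \<Rightarrow> 'a \<Rightarrow> bool" where
  "leg C z l c \<longleftrightarrow> ipath (z # l @ [c]) \<and> c \<in> set C \<and> set l \<inter> set C = {} \<and>
    (\<forall>v\<in>set l. \<forall>w\<in>set C. E v w \<longrightarrow> w = c)"

end

text \<open>Freeness from ISK4 in the form in which it is applied: every subdivision of K4 that is a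
  subgraph has a chord.\<close>

locale triangle_ISK4_free_graph = triangle_free_graph +
  assumes isk4: "K4m E a b c d ab ac ad bc bd cd \<Longrightarrow>
    \<exists>u v. E u v \<and> u \<in> set (a # b # c # d # ab @ ac @ ad @ bc @ bd @ cd) \<and>
      v \<in> set (a # b # c # d # ab @ ac @ ad @ bc @ bd @ cd) \<and>
      (u, v) \<notin> pe (a # ab @ [b]) \<union> pe (a # ac @ [c]) \<union> pe (a # ad @ [d])
        \<union> pe (b # bc @ [c]) \<union> pe (b # bd @ [d]) \<union> pe (c # cd @ [d])"
begin

text \<open>The three legs and the three arcs of the hole are the branch paths. By
  \<open>isk4\<close> there would be an edge off these paths; but an edge meeting \<open>z\<close>
  or a leg stays within one leg and its ends, and an edge of the hole lies on an arc.\<close>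

lemma spider_ordered:
  assumes h: "hole (c1 # A @ c2 # B @ c3 # D)" and z: "z \<notin> set (c1 # A @ c2 # B @ c3 # D)"
    and l: "leg (c1 # A @ c2 # B @ c3 # D) z l1 c1" "leg (c1 # A @ c2 # B @ c3 # D) z l2 c2"
      "leg (c1 # A @ c2 # B @ c3 # D) z l3 c3"
    and a: "apart (set l1) (set l2)" "apart (set l1) (set l3)" "apart (set l2) (set l3)"
    and zc: "\<forall>w\<in>set (c1 # A @ c2 # B @ c3 # D). E z w \<longrightarrow> w \<in> {c1, c2, c3}"
  shows False
proof -
  let ?C = "c1 # A @ c2 # B @ c3 # D"
  have w: "successively E (c1 # A @ c2 # B @ c3 # D @ [c1])" using hole_wk[OF h] by simp
  have pC: "pe (c1 # A @ c2 # B @ c3 # D @ [c1]) =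
      pe (c1 # A @ [c2]) \<union> pe (c2 # B @ [c3]) \<union> pe (c3 # D @ [c1])"
    using pe_append[of "c1 # A" c2 "B @ c3 # D @ [c1]"] pe_append[of "c2 # B" c3 "D @ [c1]"] by auto
  have pD: "pe (c1 # rev D @ [c3]) = pe (c3 # D @ [c1])"
    using pe_rev[of "c3 # D @ [c1]"] by simp
  have i: "ipath (z # l1 @ [c1])" "ipath (z # l2 @ [c2])" "ipath (z # l3 @ [c3])"
    using l by (auto simp: leg_def)
  have lC: "set l1 \<inter> set ?C = {}" "set l2 \<inter> set ?C = {}" "set l3 \<inter> set ?C = {}"
    using l unfolding leg_def by blast+
  have lw: "w = c1" if "v \<in> set l1" "w \<in> set ?C" "E v w" for v w
    using l(1) that unfolding leg_def by blast
  have lw2: "w = c2" if "v \<in> set l2" "w \<in> set ?C" "E v w" for v w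
    using l(2) that unfolding leg_def by blast
  have lw3: "w = c3" if "v \<in> set l3" "w \<in> set ?C" "E v w" for v w
    using l(3) that unfolding leg_def by blast
  have wD: "successively E (c1 # rev D @ [c3])"
    using wk_append[of "c1 # A @ c2 # B" c3 "D @ [c1]"] w wk_revD[of c3 D c1] by simp
  have wA: "successively E (c1 # A @ [c2])" "successively E (c2 # B @ [c3])"
    using wk_append[of "c1 # A" c2 "B @ c3 # D @ [c1]"] wk_append[of "c2 # B" c3 "D @ [c1]"] w by simp_all
  have dC: "distinct ?C" by (rule hole_distinct[OF h])
  have dl: "distinct (z # l1)" "distinct (z # l2)" "distinct (z # l3)"
    using i[THEN ipath_distinct] by auto
  have al: "set l1 \<inter> set l2 = {}" "set l1 \<inter> set l3 = {}" "set l2 \<inter> set l3 = {}"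
    using a by (simp_all add: apart_def)
  have dis: "distinct (z # (l1 @ l2 @ l3) @ ?C)"
    using z dC dl al lC by (simp add: Int_Un_distrib Int_Un_distrib2 disjoint_iff)
  have "K4m E z c1 c2 c3 l1 l2 l3 A (rev D) B"
    by (rule K4mI[OF dis, of "[]"]) (simp, use i[THEN ipath_wk] wA wD in simp_all)
  from isk4[OF this] obtain u v where uv: "E u v"
    "u \<in> insert z (set l1 \<union> set l2 \<union> set l3 \<union> set ?C)" "v \<in> insert z (set l1 \<union> set l2 \<union> set l3 \<union> set ?C)"
    "(u, v) \<notin> pe (z # l1 @ [c1]) \<union> pe (z # l2 @ [c2]) \<union> pe (z # l3 @ [c3]) \<union> pe (c1 # A @ [c2])
        \<union> pe (c3 # D @ [c1]) \<union> pe (c2 # B @ [c3])"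
    unfolding pD by (auto 0 3)
  have main: "(u, v) \<in> pe (z # l1 @ [c1]) \<union> pe (z # l2 @ [c2]) \<union> pe (z # l3 @ [c3]) \<union> pe (c1 # A @ [c2])
        \<union> pe (c3 # D @ [c1]) \<union> pe (c2 # B @ [c3])"
    if uv: "E u v" "u \<in> insert z (set l1 \<union> set l2 \<union> set l3)" "v \<in> insert z (set l1 \<union> set l2 \<union> set l3 \<union> set ?C)"
    for u v
  proof -
    have "u \<in> set (z # l1 @ [c1]) \<and> v \<in> set (z # l1 @ [c1]) \<or> u \<in> set (z # l2 @ [c2]) \<and> v \<in> set (z # l2 @ [c2])
      \<or> u \<in> set (z # l3 @ [c3]) \<and> v \<in> set (z # l3 @ [c3])"
    proof (cases "v \<in> set ?C")
      case True
      consider "u = z" | "u \<in> set l1" | "u \<in> set l2" | "u \<in> set l3" using uv(2) by blast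
      then show ?thesis
      proof cases
        case 1 then show ?thesis using zc True uv(1) by auto
      next
        case 2 then show ?thesis using lw[OF 2 True uv(1)] by simp
      next
        case 3 then show ?thesis using lw2[OF 3 True uv(1)] by simp
      next
        case 4 then show ?thesis using lw3[OF 4 True uv(1)] by simp
      qed
    next
      case False
      then have v: "v \<in> insert z (set l1 \<union> set l2 \<union> set l3)" using uv(3) by blast
      have "\<not> (x \<in> set l1 \<and> y \<in> set l2)" "\<not> (x \<in> set l1 \<and> y \<in> set l3)" "\<not> (x \<in> set l2 \<and> y \<in> set l3)"
        if "E x y" for x y
        using a that unfolding apart_def by blast+
      then show ?thesis using uv(2) v uv(1) Esym[OF uv(1)] by auto
    qed
    then show ?thesis using ipath_adj[OF i(1) _ _ uv(1)] ipath_adj[OF i(2) _ _ uv(1)]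
      ipath_adj[OF i(3) _ _ uv(1)] by blast
  qed
  consider "u \<in> insert z (set l1 \<union> set l2 \<union> set l3)" | "v \<in> insert z (set l1 \<union> set l2 \<union> set l3)"
    | "u \<in> set ?C" "v \<in> set ?C"
    using uv(2,3) by blast
  then show False
  proof cases
    case 1 show False using main[OF uv(1) 1 uv(3)] uv(4) by contradiction
  next
    case 2
    have sy: "(u, v) \<in> pe xs \<longleftrightarrow> (v, u) \<in> pe xs" for xs by (rule iffI; erule pe_sym)
    show False using main[OF Esym[OF uv(1)] 2 uv(2)] uv(4) unfolding Un_iff sy by contradiction
  next
    case 3
    have "(u, v) \<in> pe (c1 # A @ c2 # B @ c3 # D @ [c1])" using hole_adj[OF h 3 uv(1)] by simp
    then show False unfolding pC using uv(4) unfolding Un_iff by argo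
  qed
qed

lemma leg_cong: "leg C z l c \<Longrightarrow> set C = set C' \<Longrightarrow> leg C' z l c"
  by (simp add: leg_def)

text \<open>
  A hole with a centre and three induced legs to it is an \<open>ISK4\<close> with branch vertices
  \<open>z\<close>, \<open>c1\<close>, \<open>c2\<close>, \<open>c3\<close>.
\<close>

lemma spider:
  assumes h: "hole C" and z: "z \<notin> set C"
    and l: "leg C z l1 c1" "leg C z l2 c2" "leg C z l3 c3" and d: "distinct [c1, c2, c3]"
    and a: "apart (set l1) (set l2)" "apart (set l1) (set l3)" "apart (set l2) (set l3)"
    and zc: "\<forall>w\<in>set C. E z w \<longrightarrow> w \<in> {c1, c2, c3}"
  shows False
proof -
  have c: "c1 \<in> set C" "c2 \<in> set C" "c3 \<in> set C" using l by (auto simp: leg_def)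
  obtain p q where C: "C = p @ c1 # q" using split_list[OF c(1)] by blast
  have h': "hole (c1 # (q @ p))" using hole_swap[of p "c1 # q"] h C by simp
  have s: "set C = set (c1 # (q @ p))" using C by auto
  have c': "c2 \<in> set (q @ p)" "c3 \<in> set (q @ p)" using c s d by auto
  obtain A B where AB: "q @ p = A @ c2 # B" using split_list[OF c'(1)] by blast
  show False
  \<comment> \<open>The cyclic order of the three ends is not given; if \<open>c3\<close> comes
    before \<open>c2\<close>, the last two legs change places.\<close>
  proof (cases "c3 \<in> set B")
    case True
    then obtain B' D where B: "B = B' @ c3 # D" using split_list by fastforce
    have e: "c1 # (q @ p) = c1 # A @ c2 # B' @ c3 # D" using AB B by simp
    note s' = s[unfolded e]
    show False
      by (rule spider_ordered[OF h'[unfolded e] _ leg_cong[OF l(1) s'] leg_cong[OF l(2) s']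
            leg_cong[OF l(3) s'] a]) (use z zc s' in auto)
  next
    case False
    then have "c3 \<in> set A" using c' AB d by auto
    then obtain A' D where A: "A = A' @ c3 # D" using split_list by fastforce
    have e: "c1 # (q @ p) = c1 # A' @ c3 # D @ c2 # B" using AB A by simp
    note s' = s[unfolded e]
    show False
      by (rule spider_ordered[OF h'[unfolded e] _ leg_cong[OF l(1) s'] leg_cong[OF l(3) s']
            leg_cong[OF l(2) s'] a(2,1)]) (use z zc s' a(3) in \<open>auto simp: apart_sym\<close>)
  qed
qed

lemma leg_direct: "E z c \<Longrightarrow> c \<in> set C \<Longrightarrow> z \<notin> set C \<Longrightarrow> leg C z [] c"
  by (auto simp: leg_def)

text \<open>
  In a subdivision with fewest vertices, a chord between two branch paths either shortens the
  subdivision, or closes a triangle, or joins two opposite paths all of whose edges are single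
  (giving \<open>K\<^sub>3\<^sub>,\<^sub>3\<close>), or ends in a branch vertex that is then the centre of a wheel.
\<close>

lemma K4f_wheel_or_K33:
  assumes "K4f E T L"
  shows "(\<exists>a b c d u v. distinct [a, b, c, d, u, v] \<and> (\<forall>p\<in>{a, b, v}. \<forall>q\<in>{c, d, u}. E p q)) \<or>
      (\<exists>C x. hole C \<and> x \<notin> set C \<and> 3 \<le> cn x C)"
proof -
  have "\<exists>TL. K4f E (fst TL) (snd TL) \<and>
      (\<forall>TL'. K4f E (fst TL') (snd TL') \<longrightarrow> card (K4V (fst TL) (snd TL)) \<le> card (K4V (fst TL') (snd TL')))"
    by (rule ex_has_least_nat[of _ "(T, L)"]) (use assms in simp)
  then obtain T L where f: "K4f E T L"
    and M: "\<forall>T' L'. K4f E T' L' \<longrightarrow> card (K4V T L) \<le> card (K4V T' L')" by auto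
  have four: "\<exists>a b c d. a \<in> T \<and> b \<in> T \<and> c \<in> T \<and> d \<in> T \<and> distinct [a, b, c, d]"
  proof -
    obtain a b where "a \<in> T" "b \<in> T" "a \<noteq> b"
    proof -
      have "\<not> T \<subseteq> {x}" for x using card_mono[of "{x}" T] K4fD(1)[OF f] by auto
      then show thesis using that by blast
    qed
    then show ?thesis using K4f_rest[OF f] by metis
  qed
  show ?thesis
  proof (cases "\<exists>x y. x \<in> K4V T L \<and> y \<in> K4V T L \<and> E x y \<and> (x, y) \<notin> PE T L")
    case False
    obtain a b c d where abcd: "a \<in> T" "b \<in> T" "c \<in> T" "d \<in> T" "distinct [a, b, c, d]" using four by blast
    note 1 = K4f_K4m[OF f abcd]
    from isk4[OF 1(1)] False show ?thesis unfolding 1(2) PE_iff[OF f abcd] by blast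
  next
    case True
    then obtain x y where xy: "x \<in> K4V T L" "y \<in> K4V T L" "E x y" "(x, y) \<notin> PE T L" by blast
    show ?thesis
    proof (rule ccontr)
      assume neg: "\<not> ?thesis"
      obtain a b d where abd: "a \<in> T" "b \<in> T" "d \<in> T" "distinct [a, b, d]" "{x, y} \<inter> set (L a b) \<noteq> {}"
        "d \<in> {x, y}" "\<forall>t\<in>T - {d}. L d t = []"
        using chord_cases[OF f M xy] neg by blast
      have ab0: "L a b \<noteq> []" using abd(5) by auto
      obtain c where c: "c \<in> T" "distinct [a, b, c, d]"
      proof -
        obtain r s where "r \<in> T" "s \<in> T" "distinct [a, b, r, s]"
          using K4f_rest[OF f abd(1,2)] abd(4) by auto
        then show thesis using that[of r] that[of s] abd(4) by (cases "d = r") auto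
      qed
      note T4 = abd(1,2) c(1) abd(3) c(2)
      note K = K4f_K4m(1)[OF f T4] and KV = K4f_K4m(2)[OF f T4] and T = K4f_K4m(3)[OF f T4]
      define ab ac bc where "ab = L a b" and "ac = L a c" and "bc = L b c"
      have Ld: "L a d = []" "L b d = []" "L c d = []"
        using abd(7) K4fD(3)[OF f abd(3), of a] K4fD(3)[OF f abd(3), of b] K4fD(3)[OF f abd(3), of c] T4
        by auto
      note di = K4mD(1)[OF K, folded ab_def ac_def bc_def, unfolded Ld]
      have da: "E d a" "E d b" "E d c" using K4mD[OF K] Ld Esym by auto
      define S where "S = {a, b, c} \<union> set ab \<union> set bc \<union> set ac"
      have S: "S \<subseteq> K4V T L" "d \<notin> S" unfolding KV S_def ab_def ac_def bc_def
        using di by (auto simp: ab_def ac_def bc_def)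
      \<comment> \<open>A chord of the cycle through \<open>a\<close>, \<open>b\<close>,
        \<open>c\<close> would have an end \<open>s\<close> among these three all of whose branch
        paths are single edges. For \<open>a\<close> and \<open>b\<close> this contradicts the
        nonempty interior of \<open>ab\<close>; for \<open>c\<close> the edge between
        \<open>a\<close> and \<open>c\<close> would close a triangle with \<open>d\<close>.\<close>
      have chordless: "(u, v) \<in> PE T L" if uv: "u \<in> S" "v \<in> S" "E u v" for u v
      proof (rule ccontr)
        assume n: "(u, v) \<notin> PE T L"
        obtain p q s where pqs: "p \<in> T" "q \<in> T" "s \<in> T" "distinct [p, q, s]" "{u, v} \<inter> set (L p q) \<noteq> {}"
          "s \<in> {u, v}" "\<forall>t\<in>T - {s}. L s t = []"
          using chord_cases[OF f M _ _ uv(3) n] neg uv S(1) by blast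
        have sd: "s \<noteq> d" using pqs(6) uv S(2) by auto
        have pd: "p \<noteq> d" using pqs(2,4,5) abd(7) by fastforce
        have qd: "q \<noteq> d" using pqs(1,2,4,5) abd(7) K4fD(3)[OF f, of d p] by fastforce
        have "s = a \<or> s = b \<or> s = c" using pqs(3) sd T by blast
        moreover have "s \<noteq> a" using pqs(7) ab0 T4 by auto
        moreover have "s \<noteq> b" using pqs(7) ab0 T4 K4fD(3)[OF f, of b a] by auto
        moreover have "s \<noteq> c"
        proof
          assume "s = c"
          then have "L a c = []" using pqs(7) T4 K4fD(3)[OF f, of c a] by auto
          then have "E a c" using K4mD(3)[OF K] by simp
          then show False using tri da by blast
        qed
        ultimately show False by blast
      qed
      have PE: "PE T L = pe (a # ab @ [b]) \<union> pe (a # ac @ [c]) \<union> pe (b # bc @ [c]) \<union>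
          {(a, d), (d, a), (b, d), (d, b), (c, d), (d, c)}"
        unfolding PE_iff[OF f T4] Ld ab_def ac_def bc_def by auto
      have chord3: "(u, v) \<in> pe (a # ab @ [b]) \<union> pe (a # ac @ [c]) \<union> pe (b # bc @ [c])"
        if "u \<in> S" "v \<in> S" "E u v" for u v
        using chordless[OF that] S(2) that(1,2) unfolding PE by auto
      let ?B = "bc @ c # rev ac"
      have pB: "pe (b # ?B @ [a]) = pe (b # bc @ [c]) \<union> pe (a # ac @ [c])"
        using pe_append[of "b # bc" c "rev ac @ [a]"] pe_rev[of "a # ac @ [c]"] by simp
      have "hole (a # ab @ b # ?B)"
      proof (subst hole_split; (intro conjI)?)
        show "ab \<noteq> []" using ab0 by (simp add: ab_def)
        show "?B \<noteq> []" by simp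
        show "ipath (a # ab @ [b])"
        proof (rule ipathI)
          show "successively E (a # ab @ [b])" using K4mD(2)[OF K] by (simp add: ab_def)
          show d1: "distinct (a # ab @ [b])" using di by auto
          fix p u q v r
          assume s: "a # ab @ [b] = p @ u # q @ v # r" and q: "q \<noteq> []"
          have uv: "u \<in> set (a # ab @ [b])" "v \<in> set (a # ab @ [b])" "u \<noteq> v"
            using d1 unfolding s by auto
          have "(u, v) \<notin> pe (a # ab @ [b])" using pe_gap[of p u q v r] d1 q unfolding s by blast
          moreover have "(u, v) \<notin> pe (a # ac @ [c])" "(u, v) \<notin> pe (b # bc @ [c])"
            using uv di by (auto dest!: pe_subset)
          ultimately show "\<not> E u v" using chord3[of u v] uv by (auto simp: S_def)
        qed
        show "ipath (b # ?B @ [a])"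
        proof (rule ipathI)
          have "successively E (b # bc @ [c])" "successively E (c # rev ac @ [a])"
            using K4mD(3,5)[OF K] wk_revD by (auto simp: bc_def ac_def)
          then show "successively E (b # ?B @ [a])" by (rule wk_join)
          show d1: "distinct (b # ?B @ [a])" using di by auto
          fix p u q v r
          assume s: "b # ?B @ [a] = p @ u # q @ v # r" and q: "q \<noteq> []"
          have uv: "u \<in> set (b # ?B @ [a])" "v \<in> set (b # ?B @ [a])" "u \<noteq> v"
            using d1 unfolding s by auto
          have "(u, v) \<notin> pe (b # ?B @ [a])" using pe_gap[of p u q v r] d1 q unfolding s by blast
          moreover have "(u, v) \<notin> pe (a # ab @ [b])"
          proof
            assume e: "(u, v) \<in> pe (a # ab @ [b])"
            then have "u \<in> {a, b}" "v \<in> {a, b}" using uv(1,2) di by (auto dest!: pe_subset)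
            moreover have "set ab \<inter> {a, b} = {}" using di by auto
            ultimately show False using pe_branch[OF _ e] ab0 by (auto simp: ab_def)
          qed
          ultimately show "\<not> E u v" using chord3[of u v] uv pB by (auto simp: S_def)
        qed
        have "\<not> E u v" if "u \<in> set ab" "v \<in> set ?B" for u v
        proof
          assume "E u v"
          then have "(u, v) \<in> pe (a # ab @ [b]) \<union> pe (a # ac @ [c]) \<union> pe (b # bc @ [c])"
            using chord3[of u v] that by (auto simp: S_def)
          moreover have "v \<notin> set (a # ab @ [b])" "u \<notin> set (a # ac @ [c])" "u \<notin> set (b # bc @ [c])"
            using that di by auto
          ultimately show False using pe_subset by (metis Un_iff)
        qed
        moreover have "set ab \<inter> set ?B = {}" using di by auto
        ultimately show "apart (set ab) (set ?B)" unfolding apart_def by blast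
      qed
      moreover have "d \<notin> set (a # ab @ b # ?B)" using S(2) by (auto simp: S_def)
      moreover have "3 \<le> cn d (a # ab @ b # ?B)" using da by simp
      ultimately show False using neg by blast
    qed
  qed
qed

end

section \<open>Complete bipartite subgraphs\<close>

context sgraph
begin

definition walk :: "'a set \<Rightarrow> 'a \<Rightarrow> 'a list \<Rightarrow> 'a \<Rightarrow> bool" where
  "walk S u xs v \<longleftrightarrow> xs \<noteq> [] \<and> hd xs = u \<and> last xs = v \<and> set xs \<subseteq> S \<and> successively E xs"

definition conn :: "'a set \<Rightarrow> 'a \<Rightarrow> 'a \<Rightarrow> bool" where
  "conn S u v \<longleftrightarrow> (\<exists>xs. walk S u xs v)"

lemma walk_rev: "walk S u xs v \<Longrightarrow> walk S v (rev xs) u"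
  unfolding walk_def wk_rev by (simp add: hd_rev last_rev)

lemma walk_append: "walk S u xs v \<Longrightarrow> walk S v' ys w \<Longrightarrow> E v v' \<Longrightarrow> walk S u (xs @ ys) w"
  unfolding walk_def by (simp add: successively_append_iff)

lemma walk_ends: "walk S u xs v \<Longrightarrow> u \<in> S \<and> v \<in> S"
  unfolding walk_def using hd_in_set[of xs] last_in_set[of xs] by blast

lemma walk_single: "u \<in> S \<Longrightarrow> walk S u [u] u"
  unfolding walk_def by simp

lemma walk_prefix: "walk S u (xs @ x # ys) v \<Longrightarrow> walk S u (xs @ [x]) x"
  unfolding walk_def using wk_append[of xs x ys] by (auto simp: hd_append)

lemma walk_suffix: "walk S u (xs @ x # ys) v \<Longrightarrow> walk S x (x # ys) v"
  unfolding walk_def using wk_append[of xs x ys] by auto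

lemma walk_shortcut: "walk S u (p @ x # q @ y # r) v \<Longrightarrow> E x y \<Longrightarrow> walk S u (p @ x # y # r) v"
  unfolding walk_def
  using wk_append[of p x "q @ y # r"] wk_append[of "x # q" y r] wk_append[of p x "y # r"]
  by (auto simp: hd_append)

lemma walk_loop: "walk S u (p @ x # q @ x # r) v \<Longrightarrow> walk S u (p @ x # r) v"
  unfolding walk_def
  using wk_append[of p x "q @ x # r"] wk_append[of "x # q" x r] wk_append[of p x r]
  by (auto simp: hd_append)

text \<open>A repeated vertex or a chord would give a shorter walk with the same ends.\<close>

lemma shortest_walk_ipath:
  assumes w: "walk S u xs v" and m: "\<And>ys. walk S u ys v \<Longrightarrow> length xs \<le> length ys"
  shows "ipath xs"
proof (rule ipathI)
  show "successively E xs" using w by (simp add: walk_def)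
  show "distinct xs"
  proof (rule ccontr)
    assume "\<not> distinct xs"
    then obtain p q r x where x: "xs = p @ [x] @ q @ [x] @ r" using not_distinct_decomp by blast
    have "walk S u (p @ x # r) v"
      using walk_loop[of S u p x q r v] w x by simp
    from m[OF this] show False by (simp add: x)
  qed
  then show "\<not> E x y" if "xs = p @ x # q @ y # r" "q \<noteq> []" for p x q y r
  proof -
    have "length xs \<le> length (p @ x # y # r)" if e: "E x y"
      by (rule m, rule walk_shortcut[OF _ e, of _ _ _ q]) (use w \<open>xs = _\<close> in simp)
    then show ?thesis using that by auto
  qed
qed

lemma walk_exit:
  assumes "walk S u xs v" "u \<in> A" "v \<notin> A"
  shows "\<exists>x y. x \<in> A \<and> y \<notin> A \<and> E x y \<and> x \<in> S \<and> y \<in> S"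
  using assms
proof (induction xs arbitrary: u)
  case Nil
  then show ?case by (simp add: walk_def)
next
  case (Cons a xs)
  have a: "a = u" "u \<in> S" using Cons.prems(1) by (auto simp: walk_def)
  show ?case
  proof (cases xs)
    case Nil
    then show ?thesis using Cons.prems a by (simp add: walk_def)
  next
    case (Cons b ys)
    have b: "E u b" "walk S b xs v" "b \<in> S" using Cons.prems(1) a Cons by (auto simp: walk_def)
    show ?thesis
    proof (cases "b \<in> A")
      case True
      then show ?thesis using Cons.IH[of b] b Cons.prems by blast
    next
      case False
      then show ?thesis using Cons.prems a b by blast
    qed
  qed
qed

end

section \<open>Paths attached to a maximal complete bipartite subgraph\<close>

context triangle_ISK4_free_graph
begin

text \<open>The hole is \<open>a1\<close>, \<open>b1\<close>, \<open>a3\<close>, \<open>b2\<close>,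
  the centre is \<open>a2\<close>, and the path \<open>ps\<close> is the third leg.\<close>

lemma K33_spider:
  assumes B: "\<forall>a\<in>{a1, a2, a3}. \<forall>b\<in>{b1, b2}. E a b" and d: "distinct [a1, a2, a3, b1, b2]"
    and p: "ipath (a2 # ps @ [a1])" and ps: "apart (set ps) {a3, b1, b2}"
  shows False
proof -
  have nA: "\<not> E x y" if "x \<in> {a1, a2, a3}" "y \<in> {a1, a2, a3}" for x y
    using tri[of x b1 y] B that Esym by blast
  have nB: "\<not> E b1 b2" using tri[of a1 b1 b2] B by blast
  have sym: "E b1 a1" "E b2 a1" "E b1 a3" "E b2 a3" using B Esym by blast+
  have h: "hole (a1 # [b1] @ a3 # [b2])"
    using d B nA nB sym by (subst hole_split) (auto simp: apart_def)
  have d2: "a1 \<notin> set ps" "a2 \<notin> set ps" using ipath_distinct[OF p] by auto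
  show False
  proof (rule spider[OF h, of a2 "[]" b1 "[]" b2 ps a1])
    show "leg (a1 # [b1] @ a3 # [b2]) a2 ps a1"
      using p ps d2 unfolding leg_def apart_def by auto
    show "leg (a1 # [b1] @ a3 # [b2]) a2 [] b1" "leg (a1 # [b1] @ a3 # [b2]) a2 [] b2"
      using B d by (auto intro!: leg_direct)
    show "\<forall>w\<in>set (a1 # [b1] @ a3 # [b2]). E a2 w \<longrightarrow> w \<in> {b1, b2, a1}" using nA by auto
  qed (use d in auto)
qed

text \<open>Three vertices on each side allow two given vertices to be avoided.\<close>

definition bip :: "'a set \<Rightarrow> 'a set \<Rightarrow> bool" where
  "bip A B \<longleftrightarrow> A \<subseteq> V \<and> B \<subseteq> V \<and> 3 \<le> card A \<and> 3 \<le> card B \<and> (\<forall>a\<in>A. \<forall>b\<in>B. E a b)"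

lemma bip_sym: "bip A B \<Longrightarrow> bip B A"
  unfolding bip_def using Esym by blast

lemma bip_fin: "bip A B \<Longrightarrow> finite A \<and> finite B"
  unfolding bip_def using finV finite_subset by blast

lemma pick_other:
  assumes "3 \<le> card A" "finite A"
  obtains z where "z \<in> A" "z \<noteq> x" "z \<noteq> y"
proof -
  have "\<not> A \<subseteq> {x, y}" using card_mono[of "{x, y}" A] assms card_2_iff'[of "{x, y}"]
    by (auto simp: card_insert_if split: if_splits)
  then show thesis using that by blast
qed

lemma pick_two:
  assumes "3 \<le> card A" "finite A"
  obtains z w where "z \<in> A" "w \<in> A" "z \<noteq> w" "z \<noteq> x" "w \<noteq> x"
proof -
  obtain z where "z \<in> A" "z \<noteq> x" using pick_other[OF assms, of x x] by blast
  moreover obtain w where "w \<in> A" "w \<noteq> x" "w \<noteq> z" using pick_other[OF assms, of x z] by blast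
  ultimately show thesis using that by blast
qed

text \<open>The aim is a vertex \<open>a3\<close> of \<open>A\<close> and two vertices of
  \<open>B\<close> that the path does not see; then \<open>K33_spider\<close> applies. The
  hypothesis \<open>min\<close> ranges over both sides because a stretch of the path may join two
  vertices of \<open>B\<close>.\<close>

lemma bip_path:
  assumes b: "bip A B" and max: "\<And>A' B'. bip A' B' \<Longrightarrow> card (A' \<union> B') \<le> card (A \<union> B)"
    and w: "walk (V - (A \<union> B)) x ps y"
    and a: "a2 \<in> A" "a1 \<in> A" "a1 \<noteq> a2" "E x a2" "E y a1"
    and min: "\<And>S x' y' qs a b. (S = A \<or> S = B) \<Longrightarrow> walk (V - (A \<union> B)) x' qs y' \<Longrightarrow> a \<in> S \<Longrightarrow> b \<in> S \<Longrightarrow> a \<noteq> b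
        \<Longrightarrow> E x' a \<Longrightarrow> E y' b \<Longrightarrow> length ps \<le> length qs"
  shows False
proof -
  let ?R = "V - (A \<union> B)"
  have AB: "E a b" if "a \<in> A" "b \<in> B" for a b using b that by (simp add: bip_def)
  have fin: "finite A" "finite B" using bip_fin[OF b] by auto
  have c3: "3 \<le> card A" "3 \<le> card B" using b by (auto simp: bip_def)
  obtain b0 where b0: "b0 \<in> B" using c3(2) by fastforce
  have ip: "ipath ps"
    by (rule shortest_walk_ipath[OF w]) (use min[of A] a in blast)
  have notboth: "\<not> E v q" if "E v p" "p \<in> A" "q \<in> B" for v p q
    using tri[OF that(1) AB[OF that(2,3)]] .
  have sR: "set ps \<subseteq> ?R" "ps \<noteq> []" "hd ps = x" "last ps = y" using w by (auto simp: walk_def)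
  have pre: "p = a2" if vp: "v \<in> set (butlast ps)" "E v p" "p \<in> A" for v p
  proof (rule ccontr)
    assume "p \<noteq> a2"
    obtain xs ys where s: "ps = xs @ v # ys" "ys \<noteq> []"
    proof -
      obtain xs ys where "butlast ps = xs @ v # ys" using split_list[OF vp(1)] by blast
      then have "ps = xs @ v # (ys @ [last ps])" using append_butlast_last_id[OF sR(2)] by simp
      then show thesis using that by blast
    qed
    have "length ps \<le> length (xs @ [v])"
      by (rule min[of A x _ v a2 p]) (use walk_prefix[of ?R x xs v ys y] w s a vp \<open>p \<noteq> a2\<close> in auto)
    then show False using s by simp
  qed
  have suf: "p = a1" if vp: "v \<in> set (tl ps)" "E v p" "p \<in> A" for v p
  proof (rule ccontr)
    assume "p \<noteq> a1"
    obtain xs ys where s: "ps = xs @ v # ys" "xs \<noteq> []"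
    proof -
      obtain xs ys where "tl ps = xs @ v # ys" using split_list[OF vp(1)] by blast
      then have "ps = (hd ps # xs) @ v # ys" using sR(2) by (cases ps) auto
      then show thesis using that by blast
    qed
    have "length ps \<le> length (v # ys)"
      by (rule min[of A v _ y p a1]) (use walk_suffix[of ?R x xs v ys y] w s a vp \<open>p \<noteq> a1\<close> in auto)
    then show False using s by simp
  qed
  \<comment> \<open>A path of one vertex cannot see all of \<open>A\<close>, since that vertex could
    then be added to \<open>B\<close>. A longer path sees nothing of \<open>A\<close> but
    \<open>a1\<close> and \<open>a2\<close>.\<close>
  have ex: "\<exists>a3\<in>A. a3 \<noteq> a1 \<and> a3 \<noteq> a2 \<and> (\<forall>v\<in>set ps. \<not> E v a3)"
  proof (cases "tl ps")
    case Nil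
    then have ps: "ps = [x]" using sR by (cases ps) auto
    have "\<exists>a3\<in>A. \<not> E x a3"
    proof (rule ccontr)
      assume "\<not> ?thesis"
      moreover have "x \<in> V" using w hd_in_set[of ps] unfolding walk_def by auto
      moreover have "3 \<le> card (insert x B)" using c3(2) card_insert_le[of B x] by linarith
      ultimately have "bip A (insert x B)"
        using b Esym unfolding bip_def by simp
      from max[OF this] have "card (insert x (A \<union> B)) \<le> card (A \<union> B)" by simp
      moreover have "x \<notin> A \<union> B" using w ps by (auto simp: walk_def)
      ultimately show False using fin by (simp only: card_insert_disjoint finite_Un simp_thms)
    qed
    moreover have "x = y" using ps sR by simp
    ultimately show ?thesis using ps a by auto
  next
    case (Cons z zs)
    obtain a3 where a3: "a3 \<in> A" "a3 \<noteq> a1" "a3 \<noteq> a2" using pick_other[OF c3(1) fin(1)] .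
    have "\<not> E v a3" if "v \<in> set ps" for v
    proof (cases "v \<in> set (butlast ps)")
      case True then show ?thesis using pre a3 by blast
    next
      case False
      then have "v = last ps" using that append_butlast_last_id[OF sR(2)]
        by (metis Un_iff empty_iff insert_iff list.set(1) list.set(2) set_append)
      then have "v \<in> set (tl ps)" using Cons sR(2) by (metis last_in_set last_tl list.distinct(1))
      then show ?thesis using suf a3 by blast
    qed
    then show ?thesis using a3 by blast
  qed
  then obtain a3 where a3: "a3 \<in> A" "a3 \<noteq> a1" "a3 \<noteq> a2" "\<forall>v\<in>set ps. \<not> E v a3" by blast
  have Bsub: "\<exists>b. \<forall>v\<in>set ps. \<forall>q\<in>B. E v q \<longrightarrow> q = b"
  proof (rule ccontr)
    assume n: "\<not> ?thesis"
    then obtain v q where vq: "v \<in> set ps" "q \<in> B" "E v q" by blast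
    with n obtain v' q' where vq': "v' \<in> set ps" "q' \<in> B" "E v' q'" "q' \<noteq> q" by blast
    have "\<exists>x' y' qs p p'. walk ?R x' qs y' \<and> E x' p \<and> E y' p' \<and> {p, p'} = {q, q'} \<and> length qs < length ps"
    proof -
      obtain xs ys where s: "ps = xs @ v # ys" using split_list[OF vq(1)] by blast
      \<comment> \<open>The ends of the path see \<open>A\<close>, hence by triangle-freeness not
        \<open>B\<close>. So \<open>v\<close> and \<open>v'\<close> are interior, and the stretch
        between them is strictly shorter than \<open>ps\<close>.\<close>
      have "v \<noteq> x" "v' \<noteq> x" "v \<noteq> y" "v' \<noteq> y" using notboth a vq vq' by blast+
      then have xy: "xs \<noteq> []" "ys \<noteq> []" using s sR by auto
      show ?thesis
      proof (cases "v' \<in> set (xs @ [v])")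
        case True
        then obtain p r where "xs @ [v] = p @ v' # r" using split_list[OF True] by blast
        then have "walk ?R v' (v' # r) v"
          using walk_suffix[of ?R x p v' r v] walk_prefix[of ?R x xs v ys y] w s by simp
        moreover have "length (v' # r) < length ps"
          using arg_cong[OF \<open>xs @ [v] = p @ v' # r\<close>, of length] s xy by (cases ys) auto
        ultimately show ?thesis using vq vq' by (metis insert_commute)
      next
        case False
        then have "v' \<in> set ys" using vq'(1) s by auto
        then obtain p r where ys: "ys = p @ v' # r" using split_list by fastforce
        then have "walk ?R v ((v # p) @ [v']) v'"
          using walk_prefix[of ?R v "v # p" v' r y] walk_suffix[of ?R x xs v ys y] w s by simp
        moreover have "length ((v # p) @ [v']) < length ps"
          using s ys xy by (cases xs) auto
        ultimately show ?thesis using vq vq' by blast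
      qed
    qed
    then obtain x' y' qs p p' where q: "walk ?R x' qs y'" "E x' p" "E y' p'" "{p, p'} = {q, q'}"
      "length qs < length ps" by blast
    have "length ps \<le> length qs"
      by (rule min[of B, OF _ q(1), of p p']) (use q vq vq' in \<open>auto simp: doubleton_eq_iff\<close>)
    then show False using q by simp
  qed
  then obtain b where bb: "\<forall>v\<in>set ps. \<forall>q\<in>B. E v q \<longrightarrow> q = b" by blast
  obtain b1 b2 where b12: "b1 \<in> B" "b2 \<in> B" "b1 \<noteq> b2" "b1 \<noteq> b" "b2 \<noteq> b"
    using pick_two[OF c3(2) fin(2)] .
  have disj: "A \<inter> B = {}" using AB Eirr by blast
  have na: "a1 \<notin> set ps" "a2 \<notin> set ps" "\<not> E a2 a1"
    using sR a AB[OF a(1) b0] AB[OF a(2) b0] tri Esym by blast+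
  have "ipath (a2 # ps @ [a1])"
  proof -
    obtain zs where ps: "ps = x # zs" using sR by (cases ps) auto
    have i1: "ipath (a2 # ps)"
    proof -
      have "\<not> E a2 v" if "v \<in> set zs" for v
        using suf[of v a2] that a Esym ps by auto
      then show ?thesis using ip na a Esym[OF a(4)] unfolding ps by (auto simp: apart_def)
    qed
    obtain ys where py: "ps = ys @ [y]" using sR by (cases ps rule: rev_cases) auto
    have "ipath ((a2 # ys) @ y # [a1])"
    proof (subst ipath_append, intro conjI)
      show "ipath ((a2 # ys) @ [y])" using i1 py by simp
      show "ipath [y, a1]" using a na py by auto
      have "\<not> E v a1" if "v \<in> set ys" for v
        using pre[of v a1] that a py by auto
      then show "apart (set (a2 # ys)) (set [a1])" using na a py by (auto simp: apart_def)
    qed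
    then show ?thesis using py by simp
  qed
  moreover have "apart (set ps) {a3, b1, b2}"
    using a3 b12 bb sR(1) unfolding apart_def by blast
  moreover have "\<forall>a\<in>{a1, a2, a3}. \<forall>b\<in>{b1, b2}. E a b" using AB a a3 b12 by blast
  moreover have "distinct [a1, a2, a3, b1, b2]" using a a3 b12 disj by auto
  ultimately show False using K33_spider by blast
qed

text \<open>Let \<open>N\<close> be the attachment of the component \<open>D\<close> of a vertex
  outside a maximal \<open>A\<close>, \<open>B\<close>. Two vertices of \<open>N\<close> on one side
  would be joined by a path through \<open>D\<close>, which \<open>bip_path\<close> forbids for a
  shortest such path. So \<open>N\<close> has at most one vertex per side and is a clique.\<close>

lemma K33_decomposition:
  assumes "bip A0 B0"
  shows "(\<exists>A B. bip A B \<and> V = A \<union> B \<and> (\<forall>u v. E u v \<longrightarrow> (u \<in> A \<longleftrightarrow> v \<in> B))) \<or>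
    (\<exists>C u v. C \<subseteq> V \<and> card C \<le> 2 \<and> (\<forall>x\<in>C. \<forall>y\<in>C. x \<noteq> y \<longrightarrow> E x y) \<and> u \<in> V - C \<and> v \<in> V - C \<and> \<not> conn (V - C) u v)"
proof -
  \<comment> \<open>The greatest-element principle wants a strict bound on the measure, hence
    \<open>Suc (card V)\<close>.\<close>
  have "\<exists>AB. bip (fst AB) (snd AB) \<and>
      (\<forall>y. bip (fst y) (snd y) \<longrightarrow> card (fst y \<union> snd y) \<le> card (fst AB \<union> snd AB))"
    using ex_has_greatest_nat[of "\<lambda>AB. bip (fst AB) (snd AB)" "(A0, B0)" "\<lambda>AB. card (fst AB \<union> snd AB)" "Suc (card V)"]
      assms finV by (auto simp: bip_def intro!: card_mono le_imp_less_Suc)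
  then obtain A B where b: "bip A B" and max: "\<And>A' B'. bip A' B' \<Longrightarrow> card (A' \<union> B') \<le> card (A \<union> B)" by force
  have AB: "E a b" if "a \<in> A" "b \<in> B" for a b using b that by (simp add: bip_def)
  have fin: "finite A" "finite B" using bip_fin[OF b] by auto
  have c3: "3 \<le> card A" "3 \<le> card B" "A \<subseteq> V" "B \<subseteq> V" using b by (auto simp: bip_def)
  obtain a0 b0 where ab0: "a0 \<in> A" "b0 \<in> B" using c3(1,2) by fastforce
  have nA: "\<not> E x y" if "x \<in> A" "y \<in> A" for x y using tri[of x b0 y] AB ab0 that Esym by blast
  have nB: "\<not> E x y" if "x \<in> B" "y \<in> B" for x y using tri[of x a0 y] AB ab0 that Esym by blast
  have disj: "A \<inter> B = {}" using AB Eirr by blast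
  show ?thesis
  proof (cases "V = A \<union> B")
    case True
    have "u \<in> A \<longleftrightarrow> v \<in> B" if "E u v" for u v
      using that nA nB EV[OF that] EV[OF Esym[OF that]] True disj by blast
    then show ?thesis using b True by blast
  next
    case False
    then obtain r where r: "r \<in> V - (A \<union> B)" using c3 by blast
    let ?R = "V - (A \<union> B)"
    define D where "D = {v. conn ?R r v}"
    define N where "N = {k \<in> A \<union> B. \<exists>v\<in>D. E v k}"
    define W where "W qs \<longleftrightarrow> (\<exists>S x y a b. (S = A \<or> S = B) \<and> walk ?R x qs y \<and> a \<in> S \<and> b \<in> S \<and> a \<noteq> b
        \<and> E x a \<and> E y b)" for qs
    have noW: "\<not> W qs" for qs
    proof
      assume "W qs"
      then obtain ps where ps: "W ps" "\<And>qs. W qs \<Longrightarrow> length ps \<le> length qs"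
        using ex_has_least_nat[of W qs length] by blast
      then obtain S x y a b' where w: "S = A \<or> S = B" "walk ?R x ps y" "a \<in> S" "b' \<in> S" "a \<noteq> b'" "E x a" "E y b'"
        unfolding W_def by blast
      have m: "length ps \<le> length qs" if "S' = A \<or> S' = B" "walk ?R x' qs y'" "c \<in> S'" "d \<in> S'" "c \<noteq> d"
        "E x' c" "E y' d" for S' x' y' qs c d
        using ps(2)[of qs] that unfolding W_def by blast
      from w(1) show False
      proof
        assume S: "S = A"
        show False
        proof (rule bip_path[where ?a2.0 = a and ?a1.0 = b', OF b max w(2)])
          show "length ps \<le> length qs" if "S' = A \<or> S' = B" "walk ?R x' qs y'" "c \<in> S'" "d \<in> S'"
            "c \<noteq> d" "E x' c" "E y' d" for S' x' y' qs c d
            by (rule m[OF that])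
        qed (use w S in auto)
      next
        assume S: "S = B"
        have max': "card (A' \<union> B') \<le> card (B \<union> A)" if "bip A' B'" for A' B'
          using max[OF that] by (simp add: Un_commute)
        have m': "length ps \<le> length qs" if "S' = B \<or> S' = A" "walk (V - (B \<union> A)) x' qs y'" "c \<in> S'" "d \<in> S'"
          "c \<noteq> d" "E x' c" "E y' d" for S' x' y' qs c d
          by (rule m[of S' x' qs y' c d]) (use that in \<open>auto simp: Un_commute\<close>)
        have w': "walk (V - (B \<union> A)) x ps y" using w(2) by (simp add: Un_commute)
        show False
        proof (rule bip_path[where ?a2.0 = a and ?a1.0 = b', OF bip_sym[OF b] max' w'])
          show "length ps \<le> length qs" if "S' = B \<or> S' = A" "walk (V - (B \<union> A)) x' qs y'" "c \<in> S'" "d \<in> S'"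
            "c \<noteq> d" "E x' c" "E y' d" for S' x' y' qs c d
            by (rule m'[OF that])
        qed (use w S in auto)
      qed
    qed
    have N1: "a = a'" if aN: "a \<in> N" "a' \<in> N" "S = A \<or> S = B" "a \<in> S" "a' \<in> S" for a a' S
    proof (rule ccontr)
      assume ne: "a \<noteq> a'"
      obtain v v' where v: "v \<in> D" "E v a" "v' \<in> D" "E v' a'" using aN by (auto simp: N_def)
      obtain xs ys where w: "walk ?R r xs v" "walk ?R r ys v'" using v by (auto simp: D_def conn_def)
      obtain zs where "walk ?R v zs v'"
      proof (cases "tl ys")
        case Nil
        then have "r = v'" using w(2) unfolding walk_def by (cases ys) auto
        then show thesis using walk_rev[OF w(1)] that by blast
      next
        case (Cons z zs)
        then have "ys = [r] @ z # zs" using w(2) by (cases ys) (auto simp: walk_def)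
        then have "walk ?R z (z # zs) v'" "E r z" using w(2) walk_suffix[of ?R r "[r]" z zs v']
          by (auto simp: walk_def)
        then show thesis using walk_append[OF walk_rev[OF w(1)]] that by blast
      qed
      then have "W zs" unfolding W_def using v ne aN by blast
      then show False using noW by blast
    qed
    have NA: "\<exists>x. N \<inter> S \<subseteq> {x}" if S: "S = A \<or> S = B" for S
    proof (cases "N \<inter> S = {}")
      case False
      then obtain x where x: "x \<in> N" "x \<in> S" by blast
      have "N \<inter> S \<subseteq> {x}" using N1[OF x(1) _ S x(2)] by auto
      then show ?thesis ..
    qed simp
    obtain p where p: "N \<inter> A \<subseteq> {p}" using NA by blast
    obtain q where q: "N \<inter> B \<subseteq> {q}" using NA by blast
    note pq = p q
    have NAB: "N \<subseteq> A \<union> B" by (auto simp: N_def)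
    then have "N \<subseteq> {p, q}" using pq by blast
    then have "card N \<le> card {p, q}" by (intro card_mono) auto
    then have "card N \<le> 2" by (simp add: card_insert_if split: if_splits)
    moreover have "N \<subseteq> V" using NAB c3 by blast
    moreover have "\<forall>x\<in>N. \<forall>y\<in>N. x \<noteq> y \<longrightarrow> E x y"
    proof (intro ballI impI)
      fix x y assume xy: "x \<in> N" "y \<in> N" "x \<noteq> y"
      then consider "x \<in> A" "y \<in> A" | "x \<in> B" "y \<in> B" | "x \<in> A" "y \<in> B" | "x \<in> B" "y \<in> A"
        using NAB by blast
      then show "E x y"
      proof cases
        case 1 then show ?thesis using N1[OF xy(1,2), of A] xy(3) by simp
      next
        case 2 then show ?thesis using N1[OF xy(1,2), of B] xy(3) by simp
      next
        case 3 then show ?thesis by (rule AB)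
      next
        case 4 show ?thesis by (rule Esym[OF AB[OF 4(2,1)]])
      qed
    qed
    \<comment> \<open>A vertex of \<open>A\<close> other than the only possible member of
      \<open>N\<close> on that side; it lies beyond the cut.\<close>
    moreover obtain k where k: "k \<in> A" "k \<noteq> p" using pick_other[OF c3(1) fin(1), of p p] .
    then have "k \<in> V - N" using pq c3 by blast
    moreover have "r \<in> V - N" using r NAB by blast
    moreover have "\<not> conn (V - N) r k"
    proof
      assume "conn (V - N) r k"
      then obtain xs where xs: "walk (V - N) r xs k" by (auto simp: conn_def)
      have "r \<in> D" using walk_single[OF r] by (auto simp: D_def conn_def)
      moreover have "k \<notin> D" using k walk_ends by (fastforce simp: D_def conn_def)
      ultimately obtain x y where xy: "x \<in> D" "y \<notin> D" "E x y" "y \<in> V - N"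
        using walk_exit[OF xs] by metis
      obtain zs where zs: "walk ?R r zs x" using xy by (auto simp: D_def conn_def)
      show False
      proof (cases "y \<in> A \<union> B")
        case True then show False using xy by (auto simp: N_def)
      next
        case False
        then have "walk ?R r (zs @ [y]) y" using walk_append[OF zs walk_single[of y ?R] xy(3)] xy by blast
        then show False using xy by (auto simp: D_def conn_def)
      qed
    qed
    ultimately show ?thesis by blast
  qed
qed

end

section \<open>Holes with a chord path\<close>

text \<open>Take a shortest stretch with the two colours at its ends. It may have to be read
  backwards, because either colour can come first, and it may be a single entry with both
  colours.\<close>

lemma two_colour_sublist:
  assumes "\<exists>v\<in>set xs. P v" "\<exists>v\<in>set xs. Q v"
  shows "\<exists>p l q. (xs = p @ l @ q \<or> xs = p @ rev l @ q) \<and> l \<noteq> [] \<and> P (hd l) \<and> Q (last l) \<and>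
    (\<forall>v\<in>set (tl l). \<not> P v) \<and> (\<forall>v\<in>set (butlast l). \<not> Q v)"
proof -
  define W where "W l \<longleftrightarrow> (\<exists>p q. xs = p @ l @ q \<or> xs = p @ rev l @ q) \<and> l \<noteq> [] \<and> P (hd l) \<and> Q (last l)" for l
  have WI: "W l" if "xs = p @ l @ q \<or> xs = p @ rev l @ q" "l \<noteq> []" "P (hd l)" "Q (last l)" for p l q
    unfolding W_def using that by blast
  have "\<exists>l. W l"
  proof -
    obtain v w where v: "v \<in> set xs" "P v" "w \<in> set xs" "Q w" using assms by blast
    obtain a b where ab: "xs = a @ v # b" using split_list[OF v(1)] by blast
    have "w = v \<or> w \<in> set a \<or> w \<in> set b" using v(3) ab by auto
    then show ?thesis
    proof (elim disjE)
      assume "w = v"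
      then have "W [v]" using v ab by (intro WI[of a _ b]) auto
      then show ?thesis ..
    next
      assume "w \<in> set b"
      then obtain c d where "b = c @ w # d" using split_list by fastforce
      then have "W (v # c @ [w])" using v ab by (intro WI[of a _ d]) auto
      then show ?thesis ..
    next
      assume "w \<in> set a"
      then obtain c d where "a = c @ w # d" using split_list by fastforce
      then have "W (v # rev d @ [w])" using v ab by (intro WI[of c _ b]) auto
      then show ?thesis ..
    qed
  qed
  then obtain l where l: "W l" and m: "\<And>l'. W l' \<Longrightarrow> length l \<le> length l'"
    using ex_has_least_nat[of W _ length] by blast
  have sub: "W m" if "l = a @ m @ b" "m \<noteq> []" "P (hd m)" "Q (last m)" for a m b
  proof -
    obtain p q where "xs = p @ l @ q \<or> xs = p @ rev l @ q" using l unfolding W_def by blast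
    then have "xs = (p @ a) @ m @ (b @ q) \<or> xs = (p @ rev b) @ rev m @ (rev a @ q)" using that by auto
    then show ?thesis unfolding W_def using that by blast
  qed
  have "\<not> P v" if vl: "v \<in> set (tl l)" for v
  proof
    assume "P v"
    obtain a b where ab: "tl l = a @ v # b" using split_list[OF vl] by blast
    then have e: "l = (hd l # a) @ (v # b) @ []" using l unfolding W_def by (cases l) auto
    then have "W (v # b)" by (rule sub) (use l ab \<open>P v\<close> in \<open>cases l; auto simp: W_def split: if_splits\<close>)+
    from m[OF this] show False using arg_cong[OF e, of length] by simp
  qed
  moreover have "\<not> Q v" if vl: "v \<in> set (butlast l)" for v
  proof
    assume "Q v"
    obtain a b where ab: "butlast l = a @ v # b" using split_list[OF vl] by blast
    have ne: "l \<noteq> []" using l by (simp add: W_def)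
    have e: "l = [] @ (a @ [v]) @ (b @ [last l])" using append_butlast_last_id[OF ne] ab by simp
    have "hd (a @ [v]) = hd l" using arg_cong[OF e, of hd] by (cases a) auto
    then have "W (a @ [v])" by (intro sub[OF e]) (use l \<open>Q v\<close> in \<open>auto simp: W_def\<close>)
    from m[OF this] show False using arg_cong[OF e, of length] by simp
  qed
  ultimately show ?thesis using l unfolding W_def by blast
qed

context sgraph
begin

lemma ipath_sub: "ipath (p @ l @ q) \<Longrightarrow> ipath l"
  using ipath_appendD1 ipath_appendD2 by blast

lemma ipath_gap: "ipath (p @ y # r) \<Longrightarrow> apart (set p) (set r)"
  using ipath_append[of p y r] by blast

lemma ipath_ConsI:
  assumes "ipath l" "l \<noteq> []" "E x (hd l)" "x \<notin> set l" "\<forall>v\<in>set (tl l). \<not> E x v"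
  shows "ipath (x # l)"
  using assms by (cases l) (auto simp: apart_def)

lemma ipath_snocI:
  assumes "ipath l" "l \<noteq> []" "E (last l) x" "x \<notin> set l" "\<forall>v\<in>set (butlast l). \<not> E v x"
  shows "ipath (l @ [x])"
proof -
  obtain l' y where l: "l = l' @ [y]" using assms(2) by (cases l rule: rev_cases) auto
  have "ipath (l' @ y # [x])"
    by (subst ipath_append) (use assms l in \<open>auto simp: apart_def\<close>)
  then show ?thesis by (simp add: l)
qed

lemma hole_arcs:
  assumes "hole (u # A @ w # B)" "A \<noteq> []" "B \<noteq> []"
  shows "ipath (u # A @ [w])" "ipath (w # B @ [u])" "apart (set A) (set B)" "u \<noteq> w" "\<not> E u w"
    "u \<notin> set A" "u \<notin> set B" "w \<notin> set A" "w \<notin> set B"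
proof -
  have h: "ipath (u # A @ [w])" "ipath (w # B @ [u])" "apart (set A) (set B)"
    using hole_split[OF assms(2,3)] assms(1) by blast+
  then show "ipath (u # A @ [w])" "ipath (w # B @ [u])" "apart (set A) (set B)" by blast+
  show "u \<noteq> w" "u \<notin> set A" "w \<notin> set A" "u \<notin> set B" "w \<notin> set B"
    using ipath_distinct[OF h(1)] ipath_distinct[OF h(2)] by auto
  show "\<not> E u w"
    using h(1) assms(2) by (cases A) (auto simp: apart_def)
qed

lemma hole_through:
  assumes "ipath (u # A @ [w])" "ipath (u # ps @ [w])" "A \<noteq> []" "ps \<noteq> []" "apart (set A) (set ps)"
  shows "hole (u # A @ w # rev ps)"
proof (subst hole_split; (intro conjI)?)
  show "ipath (w # rev ps @ [u])" using ipath_rev[of "u # ps @ [w]"] assms by simp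
qed (use assms in simp_all)

lemma cn_one: "cn z xs = 1 \<Longrightarrow> \<exists>a. a \<in> set xs \<and> E z a \<and> (\<forall>v\<in>set xs. E z v \<longrightarrow> v = a)"
proof -
  assume "cn z xs = 1"
  then obtain a where a: "filter (E z) xs = [a]" unfolding cn_def by (metis One_nat_def length_0_conv length_Suc_conv)
  have "v \<in> set xs \<and> E z v \<longleftrightarrow> v = a" for v using arg_cong[OF a, of set] by auto
  then show ?thesis by blast
qed

lemma cn_two:
  assumes "cn z xs = 2" "distinct xs"
  shows "\<exists>a b. a \<noteq> b \<and> a \<in> set xs \<and> b \<in> set xs \<and> E z a \<and> E z b \<and> (\<forall>v\<in>set xs. E z v \<longrightarrow> v = a \<or> v = b)"
proof -
  obtain a b where a: "filter (E z) xs = [a, b]"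
    using assms(1) unfolding cn_def by (auto simp: numeral_2_eq_2 length_Suc_conv)
  have "distinct [a, b]" using a assms(2) by (metis distinct_filter)
  moreover have "v \<in> set xs \<and> E z v \<longleftrightarrow> v = a \<or> v = b" for v using arg_cong[OF a, of set] by auto
  ultimately show ?thesis by auto
qed

lemma cn_le_length: "cn z xs \<le> length xs"
  unfolding cn_def by (rule length_filter_le)

end

context triangle_ISK4_free_graph
begin

lemma no_three:
  assumes h: "hole C" and z: "z \<notin> set C" and c: "cn z C = 3"
  shows False
proof -
  obtain a b c where a: "filter (E z) C = [a, b, c]"
    using c unfolding cn_def by (auto simp: numeral_3_eq_3 length_Suc_conv)
  have d: "distinct [a, b, c]" using a hole_distinct[OF h] by (metis distinct_filter)
  have v: "v \<in> set C \<and> E z v \<longleftrightarrow> v = a \<or> v = b \<or> v = c" for v using arg_cong[OF a, of set] by auto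
  show False
    by (rule spider[OF h z leg_direct leg_direct leg_direct d]) (use v z in auto)
qed

text \<open>Spider on the hole that uses \<open>ps\<close> instead of \<open>B\<close>. It contains
  exactly two neighbours of \<open>x\<close>; the third leg starts at the neighbour of
  \<open>x\<close> in \<open>B\<close> closest to \<open>u\<close> and follows \<open>B\<close> to
  \<open>u\<close>. A second neighbour in \<open>B\<close> keeps this leg away from
  \<open>w\<close>.\<close>

lemma chord_two:
  assumes h: "hole (u # A @ w # B)" and x: "x \<notin> set (u # A @ w # B)"
    and ps: "ipath (u # ps @ [w])" "ps \<noteq> []" "set ps \<inter> set (u # A @ w # B) = {}" "x \<notin> set ps"
      "apart {x} (set ps)" "apart (set ps) (set A \<union> set B)"
    and c: "cn x A > 0" "cn x (u # A @ [w]) = 2" "cn x B \<ge> 2" and u: "\<not> E x u"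
  shows False
proof -
  have ne: "A \<noteq> []" "B \<noteq> []" using c by auto
  note a = hole_arcs[OF h ne]
  have h': "hole (u # A @ w # rev ps)"
    by (rule hole_through) (use a ps ne in \<open>auto simp: apart_Un apart_sym\<close>)
  obtain B1 b B2 where b: "B = B1 @ b # B2" "cn x B2 = 0" "E x b" using cn_last[of x B] c by auto
  have B1: "B1 \<noteq> []" using c(3) b by auto
  obtain p q where pq: "p \<noteq> q" "p \<in> set (u # A @ [w])" "q \<in> set (u # A @ [w])" "E x p" "E x q"
    "\<forall>v\<in>set (u # A @ [w]). E x v \<longrightarrow> v = p \<or> v = q"
    using cn_two[OF c(2) ipath_distinct[OF a(1)]] by blast
  have b2: "ipath (b # B2 @ [u])" using a(2) ipath_sub[of "w # B1" "b # B2 @ [u]" "[]"] b by simp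
  have wB: "apart {w} (set (b # B2))"
  proof -
    obtain y B1' where "B1 = y # B1'" using B1 by (cases B1) auto
    then have "ipath ([w] @ y # (B1' @ b # B2 @ [u]))" using a(2) b by simp
    from ipath_gap[OF this] show ?thesis by (auto simp: apart_def)
  qed
  show False
  proof (rule spider[OF h', of x "[]" p "[]" q "b # B2" u])
    show "x \<notin> set (u # A @ w # rev ps)" using x ps by auto
    show "leg (u # A @ w # rev ps) x [] p" "leg (u # A @ w # rev ps) x [] q"
      using pq x ps by (auto intro!: leg_direct)
    have "ipath (x # b # B2 @ [u])"
      using ipath_ConsI[of "b # B2 @ [u]" x] b2 b x u cn_0[of x B2] by auto
    moreover have "E v z \<Longrightarrow> z = u" if "v \<in> set (b # B2)" "z \<in> set (u # A @ w # rev ps)" for v z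
    proof -
      assume e: "E v z"
      have "v \<in> set B" using that(1) b by auto
      then have "z \<notin> set A" using a(3) Esym[OF e] unfolding apart_def by blast
      moreover have "z \<notin> set ps" using \<open>v \<in> set B\<close> ps(6) Esym[OF e] unfolding apart_def by blast
      moreover have "z \<noteq> w" using wB that(1) Esym[OF e] unfolding apart_def by blast
      ultimately show ?thesis using that(2) by auto
    qed
    ultimately show "leg (u # A @ w # rev ps) x (b # B2) u"
      unfolding leg_def using a b ps(3) ipath_distinct[OF a(2)] by (auto simp: apart_def)
    show "\<forall>z\<in>set (u # A @ w # rev ps). E x z \<longrightarrow> z \<in> {p, q, u}"
      using pq ps(5) by (auto simp: apart_def)
  qed (use pq u in auto)
qed

text \<open>Spider on the same hole with one direct leg and two legs along \<open>B\<close>, from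
  the outermost neighbours of \<open>x\<close> there to \<open>u\<close> and to \<open>w\<close>. A
  third neighbour between them keeps these two legs apart.\<close>

lemma chord_one:
  assumes h: "hole (u # A @ w # B)" and x: "x \<notin> set (u # A @ w # B)"
    and ps: "ipath (u # ps @ [w])" "ps \<noteq> []" "set ps \<inter> set (u # A @ w # B) = {}" "x \<notin> set ps"
      "apart {x} (set ps)" "apart (set ps) (set A \<union> set B)"
    and c: "cn x A > 0" "cn x (u # A @ [w]) = 1" "cn x B \<ge> 3"
  shows False
proof -
  have ne: "A \<noteq> []" "B \<noteq> []" using c by auto
  note a = hole_arcs[OF h ne]
  have h': "hole (u # A @ w # rev ps)"
    by (rule hole_through) (use a ps ne in \<open>auto simp: apart_Un apart_sym\<close>)
  have uw: "\<not> E x u" "\<not> E x w" using c(1,2) by (auto split: if_splits)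
  obtain B1 b Y where b: "B = B1 @ b # Y" "cn x B1 = 0" "E x b" using cn_first[of x B] c by auto
  have "cn x Y \<ge> 2" using c(3) b by simp
  then obtain M b' B2 where b': "Y = M @ b' # B2" "cn x B2 = 0" "E x b'" using cn_last[of x Y] by auto
  have "cn x M > 0" using \<open>cn x Y \<ge> 2\<close> b' by simp
  then obtain m M' where M: "M = m # M'" by (cases M) auto
  have i: "ipath (w # (B1 @ b # m # M' @ b' # B2) @ [u])" using a(2) b b' M by simp
  have b2: "ipath (b' # B2 @ [u])" "ipath (w # B1 @ [b])"
    using ipath_sub[of "w # B1 @ b # m # M'" "b' # B2 @ [u]" "[]"]
      ipath_sub[of "[]" "w # B1 @ [b]" "m # M' @ b' # B2 @ [u]"] i by simp_all
  have g: "apart (set (w # B1 @ [b])) (set (M' @ b' # B2 @ [u]))"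
    using ipath_gap[of "w # B1 @ [b]" m "M' @ b' # B2 @ [u]"] i by simp
  obtain p where p: "p \<in> set (u # A @ [w])" "E x p" "\<forall>v\<in>set (u # A @ [w]). E x v \<longrightarrow> v = p"
    using cn_one[OF c(2)] by blast
  have B: "v \<in> set B" if "v \<in> set (b' # B2) \<union> set (b # rev B1)" for v using that b b' by auto
  have BA: "\<not> E v z" if "v \<in> set B" "z \<in> set A \<union> set ps" for v z
    using that a(3) ps(6) Esym unfolding apart_def by blast
  show False
  proof (rule spider[OF h', of x "[]" p "b' # B2" u "b # rev B1" w])
    show "x \<notin> set (u # A @ w # rev ps)" using x ps by auto
    show "leg (u # A @ w # rev ps) x [] p"
      using p x ps by (auto intro!: leg_direct)
    have "ipath (x # b' # B2 @ [u])"
      using ipath_ConsI[of "b' # B2 @ [u]" x] b2 b b' x uw cn_0[of x B2] by auto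
    moreover have "E v z \<Longrightarrow> z = u" if "v \<in> set (b' # B2)" "z \<in> set (u # A @ w # rev ps)" for v z
      using BA[of v z] B[of v] g that Esym unfolding apart_def by auto
    ultimately show "leg (u # A @ w # rev ps) x (b' # B2) u"
      unfolding leg_def using a b b' ps(3) ipath_distinct[OF a(2)] by (auto simp: apart_def)
    have "ipath (b # rev B1 @ [w])" using b2(2) ipath_rev[of "w # B1 @ [b]"] by simp
    then have "ipath (x # b # rev B1 @ [w])"
      using ipath_ConsI[of "b # rev B1 @ [w]" x] b x uw cn_0[of x B1] by auto
    moreover have "E v z \<Longrightarrow> z = w" if "v \<in> set (b # rev B1)" "z \<in> set (u # A @ w # rev ps)" for v z
      using BA[of v z] B[of v] g that Esym unfolding apart_def by auto
    ultimately show "leg (u # A @ w # rev ps) x (b # rev B1) w"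
      unfolding leg_def using a b b' ps(3) ipath_distinct[OF a(2)] by (auto simp: apart_def)
    show "apart (set (b' # B2)) (set (b # rev B1))"
      by (rule iffD1[OF apart_sym], rule apart_mono[OF g]) auto
    show "\<forall>z\<in>set (u # A @ w # rev ps). E x z \<longrightarrow> z \<in> {p, u, w}"
      using p ps(5) by (auto simp: apart_def)
  qed (use p uw a(4) in auto)
qed

text \<open>Otherwise \<open>x\<close> has one, two or three neighbours on the hole that uses
  \<open>ps\<close>, and each number gives an ISK4. In the case of two, \<open>x\<close> misses
  \<open>u\<close> or \<open>w\<close>, because it has a neighbour in \<open>A\<close>; reversing
  the hole exchanges the two situations.\<close>

lemma chord_path:
  assumes h: "hole (u # A @ w # B)" and x: "x \<notin> set (u # A @ w # B)"
    and ps: "ipath (u # ps @ [w])" "ps \<noteq> []" "set ps \<inter> set (u # A @ w # B) = {}" "x \<notin> set ps"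
      "apart {x} (set ps)" "apart (set ps) (set A \<union> set B)"
    and c: "cn x A > 0" "cn x B > 0" "4 \<le> cn x (u # A @ w # B)"
  shows "4 \<le> cn x (u # A @ [w])"
proof (rule ccontr)
  assume "\<not> ?thesis"
  moreover have ne: "A \<noteq> []" "B \<noteq> []" using c by auto
  note a = hole_arcs[OF h ne]
  have h': "hole (u # A @ w # rev ps)"
    by (rule hole_through) (use a ps ne in \<open>auto simp: apart_Un apart_sym\<close>)
  have "cn x (rev ps) = 0" using ps(5) by (auto simp: cn_0 apart_def)
  then have "cn x (u # A @ [w]) \<noteq> 3"
    using no_three[OF h', of x] x ps by auto
  moreover have "cn x (u # A @ [w]) \<noteq> 1"
    using chord_one[OF h x ps c(1)] c by (auto split: if_splits)
  moreover have "cn x (u # A @ [w]) \<noteq> 2"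
  proof
    assume 2: "cn x (u # A @ [w]) = 2"
    then have B: "cn x B \<ge> 2" using c(3) by (auto split: if_splits)
    have "\<not> E x u \<or> \<not> E x w" using 2 c(1) by (auto split: if_splits)
    then show False
    proof
      assume "\<not> E x u"
      then show False using chord_two[OF h x ps c(1) 2 B] by blast
    next
      assume w: "\<not> E x w"
      have 1: "hole (w # rev A @ u # rev B)"
        using h hole_rev[of "u # A @ w # B"] hole_swap[of "rev B" "w # rev A @ [u]"] by simp
      have 3: "ipath (w # rev ps @ [u])" using ipath_rev[of "u # ps @ [w]"] ps(1) by simp
      show False
        by (rule chord_two[OF 1 _ 3, of x]) (use x ps c 2 B w in auto)
    qed
  qed
  moreover have "cn x (u # A @ [w]) \<noteq> 0" using c(1) by simp
  ultimately show False by linarith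
qed

section \<open>Two centres of one hole\<close>

text \<open>The vertex \<open>y\<close> closes its sector \<open>A\<close> to a hole with exactly
  two neighbours of \<open>x\<close>. The third leg leads from \<open>x\<close> to \<open>y\<close>
  through a shortest stretch of \<open>Q\<close> between neighbours of the two. Leaving out
  \<open>b1\<close> and \<open>b2\<close> ensures that the stretch sees neither \<open>w\<close> nor
  \<open>u\<close>.\<close>

lemma gap_two_leg:
  assumes h: "hole (u # A @ w # B)" and xy: "x \<notin> set (u # A @ w # B)" "y \<notin> set (u # A @ w # B)"
      "x \<noteq> y" "\<not> E x y"
    and y: "E y u" "E y w" "cn y A = 0" and x: "cn x (u # A @ [w]) = 2"
    and O: "B = b1 # Q @ [b2]" "cn x Q > 0" "cn y Q > 0"
  shows False
proof -
  have A: "A \<noteq> []"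
  proof
    assume "A = []"
    then have "E u w" using h hole_wk by fastforce
    then show False using tri y by blast
  qed
  have ne: "B \<noteq> []" using O by simp
  note a = hole_arcs[OF h A ne]
  have ip: "ipath (u # [y] @ [w])" using y a xy by (auto simp: apart_def Esym)
  have h': "hole (u # A @ w # rev [y])"
    by (rule hole_through[OF a(1) ip A]) (use y(3) xy Esym in \<open>auto simp: apart_def cn_0\<close>)
  obtain p q where pq: "p \<noteq> q" "p \<in> set (u # A @ [w])" "q \<in> set (u # A @ [w])" "E x p" "E x q"
    "\<forall>v\<in>set (u # A @ [w]). E x v \<longrightarrow> v = p \<or> v = q"
    using cn_two[OF x ipath_distinct[OF a(1)]] by blast
  obtain r l s where l: "Q = r @ l @ s \<or> Q = r @ rev l @ s" "l \<noteq> []" "E x (hd l)" "E y (last l)"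
    "\<forall>v\<in>set (tl l). \<not> E x v" "\<forall>v\<in>set (butlast l). \<not> E y v"
    using two_colour_sublist[of Q "E x" "E y"] O(2,3) unfolding cn_pos by blast
  have lQ: "set l \<subseteq> set Q" using l(1) by auto
  have iQ: "ipath (w # b1 # Q @ b2 # [u])" using a(2) O(1) by simp
  have "ipath Q" using ipath_sub[of "[w, b1]" Q "[b2, u]"] iQ by simp
  then have il: "ipath l" using l(1) ipath_sub[of r l s] ipath_sub[of r "rev l" s] ipath_rev[of l] by auto
  have wQ: "apart {w} (set Q)" "apart (set Q) {u}"
    using ipath_gap[of "[w]" b1 "Q @ [b2, u]"] ipath_gap[of "w # b1 # Q" b2 "[u]"] iQ
    by (auto simp: apart_def)
  have n: "x \<notin> set l" "y \<notin> set l" using lQ xy O(1) by auto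
  have ixl: "ipath (x # l)" by (rule ipath_ConsI[OF il l(2,3) n(1) l(5)])
  have "ipath ((x # l) @ [y])"
    by (rule ipath_snocI[OF ixl]) (use l n xy Esym in auto)
  then have ip2: "ipath (x # l @ [y])" by simp
  show False
  proof (rule spider[OF h', of x "[]" p "[]" q l y])
    show "leg (u # A @ w # rev [y]) x [] p" "leg (u # A @ w # rev [y]) x [] q"
      using pq xy by (auto intro!: leg_direct)
    have "E v z \<Longrightarrow> z = y" if "v \<in> set l" "z \<in> set (u # A @ w # rev [y])" for v z
    proof -
      assume e: "E v z"
      have v: "v \<in> set Q" using that(1) lQ by blast
      then have "z \<notin> set A" using a(3) O(1) Esym[OF e] unfolding apart_def by auto
      moreover have "z \<noteq> w" "z \<noteq> u" using wQ v e Esym[OF e] unfolding apart_def by blast+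
      ultimately show ?thesis using that(2) by auto
    qed
    moreover have "set l \<inter> set (u # A @ w # rev [y]) = {}"
      using lQ O(1) n(2) hole_distinct[OF h] by auto
    ultimately show "leg (u # A @ w # rev [y]) x l y" unfolding leg_def using ip2 by auto
    show "\<forall>z\<in>set (u # A @ w # rev [y]). E x z \<longrightarrow> z \<in> {p, q, y}" using pq by auto
  qed (use xy pq in auto)
qed

text \<open>Now \<open>y\<close> is the centre. The hole leads from \<open>s\<close>, the last
  neighbour of \<open>x\<close> in \<open>A\<close>, through \<open>w\<close> and \<open>b1\<close>
  and back by \<open>x\<close>; the legs are the edge to \<open>w\<close>, a stretch of
  \<open>B\<close> down to \<open>b1\<close>, and \<open>u\<close>, \<open>b2\<close> to
  \<open>x\<close>.\<close>

lemma gap_two_special: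
  assumes h: "hole (u # A @ w # B)" and xy: "x \<notin> set (u # A @ w # B)" "y \<notin> set (u # A @ w # B)"
      "x \<noteq> y" "\<not> E x y"
    and y: "E y u" "E y w" "cn y A = 0" and x: "cn x (u # A @ [w]) = 2"
    and O: "B = b1 # Q @ [b2]" "cn x Q = 0" "cn y Q \<ge> 2" "E x b1" "E x b2"
  shows False
proof -
  have A: "A \<noteq> []"
  proof
    assume "A = []"
    then have "E u w" using h hole_wk by fastforce
    then show False using tri y by blast
  qed
  have ne: "B \<noteq> []" using O by simp
  note a = hole_arcs[OF h A ne]
  have iB: "ipath (w # b1 # Q @ b2 # [u])" using a(2) O(1) by simp
  have e: "E w b1" "E b2 u"
  proof -
    show "E w b1" using iB by simp
    have "ipath ((w # b1 # Q) @ [b2, u])" using iB by simp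
    then have "ipath [b2, u]" by (rule ipath_appendD2)
    then show "E b2 u" by simp
  qed
  have ux: "\<not> E x u" "\<not> E x w" "\<not> E y b1" "\<not> E y b2"
    using tri e O(4,5) y Esym by blast+
  then have cA: "cn x A = 2" using x by simp
  obtain A1 s A2 where s: "A = A1 @ s # A2" "cn x A2 = 0" "E x s" using cn_last[of x A] cA by auto
  have A1: "A1 \<noteq> []" using cA s by auto
  obtain M b N where b: "Q = M @ b # N" "cn y M = 0" "E y b" using cn_first[of y Q] O(3) by auto
  have "cn y N > 0" using O(3) b by simp
  then obtain n N' where N: "N = n # N'" by (cases N) auto
  have b1b2: "b1 \<noteq> b2" "b1 \<notin> set Q" "b2 \<notin> set Q" using ipath_distinct[OF iB] by auto
  have isA: "ipath (u # A1 @ s # A2 @ [w])" using a(1) s by simp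
  have i1: "ipath (s # A2 @ [w])" using ipath_sub[of "u # A1" "s # A2 @ [w]" "[]"] isA by simp
  have sb1: "\<not> E s b1" "s \<noteq> b1" using tri[OF s(3)[THEN Esym] O(4)] a(3) s(1) O(1) by (auto simp: apart_def)
  have gw: "apart {w} (set (Q @ [b2, u]))" using ipath_gap[of "[w]" b1 "Q @ [b2, u]"] iB by simp
  have gu: "apart (set (w # b1 # Q)) {u}" using ipath_gap[of "w # b1 # Q" b2 "[u]"] iB by simp
  have gM: "apart (set (w # b1 # M @ [b])) (set (N' @ [b2, u]))"
    using ipath_gap[of "w # b1 # M @ [b]" n "N' @ [b2, u]"] iB b(1) N by simp
  have gA: "apart {u} (set (s # A2 @ [w]))"
  proof -
    obtain c A1' where "A1 = c # A1'" using A1 by (cases A1) auto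
    then show ?thesis using ipath_gap[of "[u]" c "A1' @ s # A2 @ [w]"] isA by (auto simp: apart_def)
  qed
  let ?Z = "s # (A2 @ [w]) @ b1 # rev [x]"
  have "ipath ((s # A2) @ w # [b1])"
    by (subst ipath_append) (use i1 e a(3,9) s(1) O(1) in \<open>auto simp: apart_def\<close>)
  then have j1: "ipath (s # (A2 @ [w]) @ [b1])" by simp
  have j2: "ipath (s # [x] @ [b1])" using s(3) O(4) sb1 xy s(1) O(1) Esym by (auto simp: apart_def)
  have h': "hole ?Z"
    by (rule hole_through[OF j1 j2]) (use s ux xy Esym in \<open>auto simp: apart_def cn_0\<close>)
  have yA: "\<not> E y z" if "z \<in> set A" for z using y(3) that by (simp add: cn_0)
  have inA: "s \<in> set A" "set A2 \<subseteq> set A" using s(1) by auto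
  have MQ: "set (b # rev M) \<subseteq> set Q" using b(1) by auto
  have AB: "\<not> E v z" if "v \<in> set B" "z \<in> set A" for v z using a(3) that Esym unfolding apart_def by blast
  have ib: "ipath (b1 # M @ [b])" using ipath_sub[of "[w]" "b1 # M @ [b]" "N @ [b2, u]"] iB b(1) by simp
  then have ib: "ipath (b # rev M @ [b1])" using ipath_rev[of "b1 # M @ [b]"] by simp
  have d: "distinct (u # A @ w # B)" by (rule hole_distinct[OF h])
  show False
  proof (rule spider[OF h', of y "[]" w "b # rev M" b1 "[u, b2]" x])
    show "y \<notin> set ?Z" using xy s(1) O(1) by auto
    show "leg ?Z y [] w" using y xy s(1) O(1) by (intro leg_direct) auto
    have "ipath (y # b # rev M @ [b1])"
      using ipath_ConsI[OF ib, of y] b ux xy O(1) by (auto simp: cn_0)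
    moreover have "E v z \<Longrightarrow> z = b1" if "v \<in> set (b # rev M)" "z \<in> set ?Z" for v z
    proof -
      assume ez: "E v z"
      have v: "v \<in> set Q" "v \<in> set B" using that(1) MQ O(1) by auto
      have "z \<notin> set A" using AB[OF v(2)] ez by blast
      moreover have "z \<noteq> w" using gw v(1) Esym[OF ez] by (auto simp: apart_def)
      moreover have "z \<noteq> x" using O(2) v(1) Esym[OF ez] by (auto simp: cn_0)
      ultimately show ?thesis using that(2) inA by auto
    qed
    ultimately show "leg ?Z y (b # rev M) b1"
      unfolding leg_def using d s(1) O(1) b(1) xy b1b2 by auto
    have "ipath (y # [u, b2] @ [x])"
      using y(1) e(2) Esym O(5) ux xy O(1) by (auto simp: apart_def)
    moreover have "E v z \<Longrightarrow> z = x" if "v \<in> set [u, b2]" "z \<in> set ?Z" for v z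
    proof -
      assume ez: "E v z"
      have "v \<noteq> u \<or> z \<notin> set (s # A2 @ [w])" using gA ez unfolding apart_def by blast
      moreover have "v \<noteq> u \<or> z \<noteq> b1" using gu Esym[OF ez] unfolding apart_def by auto
      moreover have "v \<noteq> b2 \<or> z \<notin> set A" using AB[of b2 z] O(1) ez by auto
      moreover have "v \<noteq> b2 \<or> z \<noteq> w" using gw Esym[OF ez] unfolding apart_def by auto
      moreover have "v \<noteq> b2 \<or> z \<noteq> b1" using tri[OF O(5), of b1] O(4) ez by auto
      ultimately show ?thesis using that inA by auto
    qed
    ultimately show "leg ?Z y [u, b2] x"
      unfolding leg_def using d s(1) O(1) xy by auto
    show "apart (set (b # rev M)) (set [u, b2])" using gM by (auto simp: apart_def)
    show "\<forall>z\<in>set ?Z. E y z \<longrightarrow> z \<in> {w, b1, x}" using yA inA by auto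
  qed (use xy O(1) d in auto)
qed

text \<open>The ends \<open>b1\<close> and \<open>b2\<close> of \<open>B\<close> are adjacent to the
  neighbours \<open>w\<close> and \<open>u\<close> of \<open>y\<close>, so \<open>y\<close> misses
  them and has two neighbours in between. The two preceding lemmas differ in whether
  \<open>x\<close> has a neighbour there.\<close>

lemma gap_two:
  assumes h: "hole (u # A @ w # B)" and xy: "x \<notin> set (u # A @ w # B)" "y \<notin> set (u # A @ w # B)"
      "x \<noteq> y" "\<not> E x y"
    and y: "E y u" "E y w" "cn y A = 0" and x: "cn x (u # A @ [w]) = 2"
    and c: "cn x (u # A @ w # B) \<ge> 4" "cn y (u # A @ w # B) \<ge> 4"
  shows False
proof -
  have cB: "cn x B \<ge> 2" "cn y B \<ge> 2" using c x y by (auto split: if_splits)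
  obtain b1 B' where B': "B = b1 # B'" using cB(1) by (cases B) auto
  have "B' \<noteq> []" using cB(1) B' by (auto split: if_splits)
  then obtain Q b2 where Q: "B = b1 # Q @ [b2]" using B' by (cases B' rule: rev_cases) auto
  have w: "successively E (u # (A @ w # (b1 # Q @ [b2])) @ [u])"
    using hole_wk[OF h] Q by simp
  have "successively E (w # (b1 # Q @ [b2]) @ [u])" by (rule wk_split(2)[OF w])
  then have e: "E w b1" "E b2 u"
    using wk_split(2)[of w "b1 # Q" b2 "[]" u] by auto
  then have "\<not> E y b1" "\<not> E y b2" using tri y Esym by blast+
  then have yQ: "cn y Q \<ge> 2" using cB(2) Q by simp
  show False
  proof (cases "cn x Q = 0")
    case True
    then have "E x b1" "E x b2" using cB(1) Q by (auto split: if_splits)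
    then show False using gap_two_special[OF h xy y x Q True yQ] by blast
  next
    case False
    then show False using gap_two_leg[OF h xy y x Q] yQ by simp
  qed
qed

text \<open>Here \<open>s\<close>, \<open>t\<close>, \<open>t'\<close> are consecutive neighbours of
  \<open>x\<close>, and \<open>y\<close> has one neighbour inside each of the two sectors. The hole
  passes through \<open>r'\<close>, \<open>t'\<close>, \<open>x\<close>, \<open>s\<close>,
  \<open>r\<close>, \<open>y\<close>; the centre is \<open>t\<close>, with legs to \<open>x\<close>,
  \<open>r\<close> and \<open>r'\<close>.\<close>

lemma gap_alternate:
  assumes h: "hole (s # (A1 @ r # A2) @ t # ((B1 @ r' # B2) @ t' # D))"
    and xy: "x \<notin> set (s # (A1 @ r # A2) @ t # ((B1 @ r' # B2) @ t' # D))"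
      "y \<notin> set (s # (A1 @ r # A2) @ t # ((B1 @ r' # B2) @ t' # D))" "x \<noteq> y" "\<not> E x y"
    and x: "E x s" "E x t" "E x t'" "cn x (A1 @ r # A2) = 0" "cn x (B1 @ r' # B2) = 0" "D \<noteq> []"
    and y: "cn y (s # A1 @ A2 @ [t]) = 0" "E y r" "cn y (B1 @ B2 @ [t']) = 0" "E y r'"
  shows False
proof -
  let ?A = "A1 @ r # A2" and ?B = "B1 @ r' # B2"
  have st': "\<not> E s t'" "\<not> E t' s" "\<not> E s t" "\<not> E t t'" using tri x Esym by blast+
  have h2: "hole (s # (?A @ t # ?B) @ t' # D)" using h by simp
  have "ipath (s # (?A @ t # ?B) @ [t'])" by (rule hole_arcs(1)[OF h2]) (use x in auto)
  then have ip: "ipath (s # A1 @ r # A2 @ t # B1 @ r' # B2 @ [t'])" by simp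
  have d: "distinct (s # A1 @ r # A2 @ t # B1 @ r' # B2 @ [t'])" by (rule ipath_distinct[OF ip])
  have g: "apart (set (s # A1 @ r # A2)) (set (B1 @ r' # B2 @ [t']))"
    using ipath_gap[of "s # A1 @ r # A2" t "B1 @ r' # B2 @ [t']"] ip by simp
  have gA: "apart (set (s # A1)) (set (A2 @ t # B1 @ r' # B2 @ [t']))"
    using ipath_gap[of "s # A1" r "A2 @ t # B1 @ r' # B2 @ [t']"] ip by simp
  have gB: "apart (set (s # A1 @ r # A2 @ t # B1)) (set (B2 @ [t']))"
    using ipath_gap[of "s # A1 @ r # A2 @ t # B1" r' "B2 @ [t']"] ip by simp
  have i1: "ipath (s # A1 @ [r])" using ipath_sub[of "[]" "s # A1 @ [r]" "A2 @ t # B1 @ r' # B2 @ [t']"] ip by simp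
  have i2: "ipath (r' # B2 @ [t'])" using ipath_sub[of "s # A1 @ r # A2 @ t # B1" "r' # B2 @ [t']" "[]"] ip by simp
  have i3: "ipath (r # A2 @ [t])" using ipath_sub[of "s # A1" "r # A2 @ [t]" "B1 @ r' # B2 @ [t']"] ip by simp
  have i4: "ipath (t # B1 @ [r'])" using ipath_sub[of "s # A1 @ r # A2" "t # B1 @ [r']" "B2 @ [t']"] ip by simp
  have xn: "\<not> E x v" if "v \<in> set A1 \<union> set A2 \<union> set B1 \<union> set B2 \<union> {r, r'}" for v
    using x(4,5) that unfolding cn_0 by auto
  have yn: "\<not> E y v" if "v \<in> set A1 \<union> set A2 \<union> set B1 \<union> set B2 \<union> {s, t, t'}" for v
    using y(1,3) that unfolding cn_0 by auto
  have "ipath (x # s # A1 @ [r])"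
    using ipath_ConsI[OF i1, of x] x xn xy by auto
  moreover have "ipath ((r' # B2 @ [t']) @ [x])"
    by (rule ipath_snocI[OF i2]) (use x xn xy Esym in auto)
  then have "ipath ((r' # B2 @ [t']) @ x # [])" by simp
  moreover have "apart (set (r' # B2 @ [t'])) (set (s # A1 @ [r]))"
    by (rule iffD1[OF apart_sym], rule apart_mono[OF g]) auto
  ultimately have "ipath ((r' # B2 @ [t']) @ x # s # A1 @ [r])"
    by (subst ipath_append) simp
  then have j1: "ipath (r' # (B2 @ t' # x # s # A1) @ [r])" by simp
  have rr: "r' \<noteq> r" "\<not> E r' r" using g Esym by (auto simp: apart_def)
  have j2: "ipath (r' # [y] @ [r])" using y rr xy Esym by (auto simp: apart_def)
  let ?Z = "r' # (B2 @ t' # x # s # A1) @ r # rev [y]"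
  have h': "hole ?Z"
    by (rule hole_through[OF j1 j2]) (use yn xy Esym in \<open>auto simp: apart_def\<close>)
  show False
  proof (rule spider[OF h', of t "[]" x "rev A2" r B1 r'])
    show "t \<notin> set ?Z" using d xy by auto
    show "leg ?Z t [] x" using x d xy Esym by (intro leg_direct) auto
    have "ipath (t # rev A2 @ [r])" using ipath_rev[of "r # A2 @ [t]"] i3 by simp
    moreover have "E v z \<Longrightarrow> z = r" if "v \<in> set (rev A2)" "z \<in> set ?Z" for v z
    proof -
      assume e: "E v z"
      have "z \<notin> set (B1 @ r' # B2 @ [t'])" using g e that(1) unfolding apart_def by auto
      moreover have "z \<notin> set (s # A1)" using gA Esym[OF e] that(1) unfolding apart_def by auto
      moreover have "z \<noteq> x" "z \<noteq> y" using xn[of v] yn[of v] Esym[OF e] that(1) by auto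
      ultimately show ?thesis using that(2) by auto
    qed
    ultimately show "leg ?Z t (rev A2) r" unfolding leg_def using d xy by auto
    have "E v z \<Longrightarrow> z = r'" if "v \<in> set B1" "z \<in> set ?Z" for v z
    proof -
      assume e: "E v z"
      have "z \<notin> set (s # A1 @ r # A2)" using g Esym[OF e] that(1) unfolding apart_def by auto
      moreover have "z \<notin> set (B2 @ [t'])" using gB e that(1) unfolding apart_def by auto
      moreover have "z \<noteq> x" "z \<noteq> y" using xn[of v] yn[of v] Esym[OF e] that(1) by auto
      ultimately show ?thesis using that(2) by auto
    qed
    then show "leg ?Z t B1 r'" unfolding leg_def using i4 d xy by auto
    show "apart (set (rev A2)) (set B1)" by (rule apart_mono[OF g]) auto
    have "\<not> E t z" if "z \<in> set (s # A1) \<union> set (B2 @ [t']) \<union> {y}" for z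
      using that gA gB yn[of t] Esym[of t z] unfolding apart_def by auto
    then show "\<forall>z\<in>set ?Z. E t z \<longrightarrow> z \<in> {x, r, r'}" by auto
  qed (use d xy rr in auto)
qed

definition no_wheel_below :: "nat \<Rightarrow> bool" where
  "no_wheel_below n \<longleftrightarrow> (\<forall>D z. hole D \<longrightarrow> length D < n \<longrightarrow> z \<notin> set D \<longrightarrow> cn z D \<le> 2)"

text \<open>Closing the sector \<open>A\<close> by \<open>y\<close> gives a hole shorter than the
  rim, because \<open>y\<close> has two further neighbours in \<open>B\<close>. So \<open>x\<close>
  has at most two neighbours on it, and \<open>gap_two\<close> excludes two.\<close>

lemma gap_le_one:
  assumes h: "hole (u # A @ w # B)" and xy: "x \<notin> set (u # A @ w # B)" "y \<notin> set (u # A @ w # B)"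
      "x \<noteq> y" "\<not> E x y"
    and y: "E y u" "E y w" "cn y A = 0"
    and c: "cn x (u # A @ w # B) \<ge> 4" "cn y (u # A @ w # B) \<ge> 4"
    and m: "no_wheel_below (length (u # A @ w # B))"
  shows "cn x (u # A @ [w]) \<le> 1"
proof -
  have A: "A \<noteq> []"
  proof
    assume "A = []"
    then have "E u w" using h hole_wk by fastforce
    then show False using tri y by blast
  qed
  have cB: "cn y B \<ge> 2" using c y by simp
  then have B: "B \<noteq> []" "length B \<ge> 2" using cn_le_length[of y B] by auto
  note a = hole_arcs[OF h A B(1)]
  have ip: "ipath (u # [y] @ [w])" using y a xy by (auto simp: apart_def Esym)
  have h': "hole (u # A @ w # rev [y])"
    by (rule hole_through[OF a(1) ip A]) (use y(3) xy Esym in \<open>auto simp: apart_def cn_0\<close>)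
  have "cn x (u # A @ w # rev [y]) \<le> 2"
    using m[unfolded no_wheel_below_def, rule_format, OF h', of x] B xy by simp
  moreover have "cn x (u # A @ [w]) \<noteq> 2" using gap_two[OF h xy y _ c] by blast
  ultimately show ?thesis using xy by (auto split: if_splits)
qed

text \<open>If \<open>y\<close> had no neighbour strictly inside the sector \<open>A\<close> of
  \<open>x\<close>, some sector of \<open>y\<close> would contain both \<open>s\<close> and
  \<open>t\<close>, against \<open>gap_le_one\<close>. The local fact \<open>no\<close> is this
  contradiction for a rotated copy of the rim.\<close>

lemma gap_eq_one:
  assumes h: "hole (s # A @ t # B)" and xy: "x \<notin> set (s # A @ t # B)" "y \<notin> set (s # A @ t # B)"
      "x \<noteq> y" "\<not> E x y"
    and x: "E x s" "E x t" "cn x A = 0"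
    and c: "cn x (s # A @ t # B) \<ge> 4" "cn y (s # A @ t # B) \<ge> 4"
    and m: "no_wheel_below (length (s # A @ t # B))"
  shows "\<exists>A1 r A2. A = A1 @ r # A2 \<and> E y r \<and> cn y (s # A1 @ A2 @ [t]) = 0"
proof -
  have le: "cn y (s # A @ [t]) \<le> 1"
    using gap_le_one[OF h xy(2,1) xy(3)[symmetric] _ x c(2,1) m] xy(4) Esym by blast
  have no: False if "set C = set (s # A @ t # B)" "length C = length (s # A @ t # B)"
    "C = b # A' @ b' # B'" "hole C" "E y b" "E y b'" "cn y A' = 0" "cn x (b # A' @ [b']) \<ge> 2"
    "cn x C = cn x (s # A @ t # B)" "cn y C = cn y (s # A @ t # B)" for C b A' b' B'
  proof -
    have 1: "x \<notin> set (b # A' @ b' # B')" "y \<notin> set (b # A' @ b' # B')"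
      unfolding that(3)[symmetric] that(1) by (rule xy)+
    have 2: "cn x (b # A' @ b' # B') \<ge> 4" "cn y (b # A' @ b' # B') \<ge> 4"
      unfolding that(3)[symmetric] that(9,10) by (rule c)+
    have 3: "no_wheel_below (length (b # A' @ b' # B'))"
      unfolding that(3)[symmetric] that(2) by (rule m)
    show False
      using gap_le_one[OF that(4)[unfolded that(3)] 1 xy(3,4) that(5,6,7) 2 3] that(8) by linarith
  qed
  consider "E y s" | "E y t" | "cn y (s # A @ [t]) = 0" | "cn y A = 1" "\<not> E y s" "\<not> E y t"
    using le by (cases "cn y A") (auto split: if_splits)
  then show ?thesis
  proof cases
    case 1
    then have n: "\<not> E y t" "cn y A = 0" using le by (auto split: if_splits)
    then have "cn y B > 0" using c(2) 1 by simp
    then obtain B1 b B2 where b: "B = B1 @ b # B2" "cn y B1 = 0" "E y b" using cn_first by blast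
    have False
      by (rule no[of "s # (A @ t # B1) @ b # B2" s "A @ t # B1" b B2]) (use h b n 1 x in simp_all)
    then show ?thesis ..
  next
    case 2
    then have n: "\<not> E y s" "cn y A = 0" using le by (auto split: if_splits)
    then have "cn y B > 0" using c(2) 2 by simp
    then obtain B1 b B2 where b: "B = B1 @ b # B2" "cn y B2 = 0" "E y b" using cn_last by blast
    have False
      by (rule no[of "b # (B2 @ s # A) @ t # B1" b "B2 @ s # A" t B1])
        (use hole_swap[of "s # A @ t # B1" "b # B2"] h b n 2 x in auto)
    then show ?thesis ..
  next
    case 3
    then have n: "\<not> E y s" "\<not> E y t" "cn y A = 0" by (auto split: if_splits)
    then have "cn y B > 1" using c(2) by simp
    moreover obtain B1 b Y where b: "B = B1 @ b # Y" "cn y B1 = 0" "E y b"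
      using cn_first[of y B] calculation by auto
    ultimately have "cn y Y > 0" by simp
    then obtain M b' B2 where b': "Y = M @ b' # B2" "cn y B2 = 0" "E y b'" using cn_last by blast
    have False
      by (rule no[of "b' # (B2 @ s # A @ t # B1) @ b # M" b' "B2 @ s # A @ t # B1" b M])
        (use hole_swap[of "s # A @ t # B1 @ b # M" "b' # B2"] h b b' n x in auto)
    then show ?thesis ..
  next
    case 4
    then obtain A1 r A2 where "A = A1 @ r # A2" "cn y A1 = 0" "E y r" using cn_first[of y A] by auto
    then show ?thesis using 4 by (intro exI[of _ A1] exI[of _ r] exI[of _ A2]) simp
  qed
qed

text \<open>By \<open>gap_eq_one\<close> the neighbours of \<open>x\<close> and \<open>y\<close>
  alternate along two consecutive sectors of \<open>x\<close>. A fourth neighbour of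
  \<open>x\<close> keeps the last end of these sectors away from the first.\<close>

lemma two_centres:
  assumes h: "hole C" and xy: "x \<notin> set C" "y \<notin> set C" "x \<noteq> y" "\<not> E x y"
    and c: "cn x C \<ge> 4" "cn y C \<ge> 4" and m: "no_wheel_below (length C)"
  shows False
proof -
  obtain p s q where s: "C = p @ s # q" "E x s" using cn_first[of x C] c by auto
  then have "cn x (q @ p) \<ge> 3" using c(1) by simp
  then have "cn x (q @ p) > 0" by linarith
  from cn_first[OF this] obtain A t B where t: "q @ p = A @ t # B" "cn x A = 0" "E x t" by blast
  have h1: "hole (s # A @ t # B)" using hole_swap[of p "s # q"] h s t by simp
  have set1: "set (s # A @ t # B) = set C" using s arg_cong[OF t(1), of set] by auto
  have cn1: "cn z (s # A @ t # B) = cn z C" for z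
    using s arg_cong[OF t(1), of "cn z"] by simp
  have len1: "length (s # A @ t # B) = length C" using s arg_cong[OF t(1), of length] by simp
  note xy1 = xy(1,2)[folded set1] xy(3,4) and c1 = c[folded cn1] and m1 = m[folded len1]
  obtain A1 r A2 where r: "A = A1 @ r # A2" "E y r" "cn y (s # A1 @ A2 @ [t]) = 0"
    using gap_eq_one[OF h1 xy1 s(2) t(3,2) c1 m1] by blast
  have "cn x B \<ge> 2" using c1(1) s t by simp
  moreover obtain B' t' D where t': "B = B' @ t' # D" "cn x B' = 0" "E x t'"
    using cn_first[of x B] calculation by auto
  ultimately have D: "D \<noteq> []" by auto
  have h2: "hole (t # B' @ t' # (D @ s # A))" using hole_swap[of "s # A" "t # B"] h1 t' by simp
  obtain B1 r' B2 where r': "B' = B1 @ r' # B2" "E y r'" "cn y (t # B1 @ B2 @ [t']) = 0"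
  proof -
    have set2: "set (t # B' @ t' # (D @ s # A)) = set C" using set1 t' by auto
    have cn2: "cn z (t # B' @ t' # (D @ s # A)) = cn z C" for z
      using cn1[of z] t' by (auto split: if_splits)
    have len2: "length (t # B' @ t' # (D @ s # A)) = length C" using len1 t' by simp
    show thesis
      using gap_eq_one[OF h2 xy(1,2)[folded set2] xy(3,4) t(3) t'(3,2) c[folded cn2] m[folded len2]] that
      by blast
  qed
  show False
    by (rule gap_alternate[of s A1 r A2 t B1 r' B2 t' D x y])
      (use h1 xy1 s(2) t t' D r r' in \<open>auto split: if_splits\<close>)
qed

end

section \<open>Proper wheels and bad pairs\<close>

text \<open>Only one rotation of a rim starts at a given vertex, so the existential quantifiers in
  \<open>bad_pair\<close> can be evaluated.\<close>

lemma rotate_Cons_unique: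
  assumes "distinct (u # xs)" "rotate n (u # xs) = u # ys"
  shows "xs = ys"
proof -
  let ?m = "n mod length (u # xs)"
  have "rotate n (u # xs) ! 0 = (u # xs) ! ?m"
    using nth_rotate[of 0 "u # xs" n] by simp
  then have "(u # xs) ! ?m = (u # xs) ! 0" using assms(2) by simp
  then have "?m = 0" using nth_eq_iff_index_eq[OF assms(1), of ?m 0] by simp
  then have "rotate n (u # xs) = u # xs" using rotate_conv_mod[of n "u # xs"] by simp
  then show ?thesis using assms(2) by simp
qed

lemma rotate_two:
  assumes "u \<in> set xs" "w \<in> set xs" "u \<noteq> w"
  shows "\<exists>n A B. rotate n xs = u # A @ w # B"
proof -
  obtain p q where xs: "xs = p @ u # q" using split_list[OF assms(1)] by blast
  then have "w \<in> set (q @ p)" using assms by auto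
  then obtain A B where "q @ p = A @ w # B" using split_list by fast
  moreover have "rotate (length p) xs = u # (q @ p)" using rotate_append[of p "u # q"] xs by simp
  ultimately show ?thesis by metis
qed

context sgraph
begin

text \<open>
  Consecutive neighbours of \<open>x\<close> on \<open>C\<close> bound sectors; a bad pair is a pair of vertices of \<open>C\<close>
  that do not lie in one common closed sector.
\<close>

definition bad_pair :: "'a \<Rightarrow> 'a list \<Rightarrow> 'a \<Rightarrow> 'a \<Rightarrow> bool" where
  "bad_pair x C u w \<longleftrightarrow> (\<exists>n A B. rotate n C = u # A @ w # B \<and> cn x A > 0 \<and> cn x B > 0)"

lemma bad_pair_rotate: "bad_pair x (rotate m C) u w \<longleftrightarrow> bad_pair x C u w"
proof
  show "bad_pair x (rotate m C) u w \<Longrightarrow> bad_pair x C u w"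
    unfolding bad_pair_def rotate_rotate by blast
  assume "bad_pair x C u w"
  then obtain n A B where n: "rotate n C = u # A @ w # B" "cn x A > 0" "cn x B > 0"
    unfolding bad_pair_def by blast
  let ?k = "n + (length C - m mod length C)"
  have "rotate (length C - m mod length C) (rotate m C) = C"
  proof (cases "C = []")
    case False
    then have "m mod length C \<le> length C" by simp
    have "rotate (length C - m mod length C) (rotate (m mod length C) C) = C"
      unfolding rotate_rotate using \<open>m mod length C \<le> length C\<close> by simp
    then show ?thesis by (simp add: rotate_conv_mod[symmetric])
  qed simp
  then have "rotate ?k (rotate m C) = rotate n C"
    unfolding rotate_rotate[symmetric, of n] by simp
  then show "bad_pair x (rotate m C) u w" using n unfolding bad_pair_def by metis
qed

lemma bad_pair_swap: "bad_pair x (xs @ ys) u w \<longleftrightarrow> bad_pair x (ys @ xs) u w"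
  using bad_pair_rotate[of x "length xs" "xs @ ys"] by (simp add: rotate_append)

lemma bad_pair_iff:
  assumes "distinct (u # A @ w # B)"
  shows "bad_pair x (u # A @ w # B) u w \<longleftrightarrow> cn x A > 0 \<and> cn x B > 0"
proof
  show "cn x A > 0 \<and> cn x B > 0 \<Longrightarrow> bad_pair x (u # A @ w # B) u w"
    unfolding bad_pair_def by (rule exI[of _ 0]) auto
  assume "bad_pair x (u # A @ w # B) u w"
  then obtain n A' B' where n: "rotate n (u # A @ w # B) = u # A' @ w # B'" "cn x A' > 0" "cn x B' > 0"
    unfolding bad_pair_def by blast
  have "A @ w # B = A' @ w # B'" by (rule rotate_Cons_unique[OF assms n(1)])
  moreover have "w \<notin> set A" "w \<notin> set B" using assms by auto
  moreover from calculation have "w \<notin> set A'" "w \<notin> set B'"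
    using assms by (metis distinct.simps(2) distinct_append not_distinct_conv_prefix in_set_conv_decomp list.set_intros(1) disjoint_iff)+
  ultimately have "A = A' \<and> B = B'" using append_Cons_eq_iff[of w A B A' B'] by simp
  then show "cn x A > 0 \<and> cn x B > 0" using n by simp
qed

lemma bad_pair_sym: "bad_pair x C u w \<Longrightarrow> bad_pair x C w u"
proof -
  assume "bad_pair x C u w"
  then obtain n A B where n: "rotate n C = u # A @ w # B" "cn x A > 0" "cn x B > 0"
    unfolding bad_pair_def by blast
  have "rotate (length (u # A)) (rotate n C) = w # B @ u # A"
    unfolding n(1) using rotate_append[of "u # A" "w # B"] by simp
  then show ?thesis using n(2,3) unfolding bad_pair_def rotate_rotate by blast
qed

lemma bad_pair_mem: "bad_pair x C u w \<Longrightarrow> u \<in> set C \<and> w \<in> set C"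
proof -
  assume "bad_pair x C u w"
  then obtain n A B where n: "rotate n C = u # A @ w # B" unfolding bad_pair_def by blast
  then have "set C = set (u # A @ w # B)" using set_rotate by metis
  then show ?thesis by simp
qed

lemma bad_pair_neq: "bad_pair x C u w \<Longrightarrow> distinct C \<Longrightarrow> u \<noteq> w"
proof
  assume "bad_pair x C u w" "distinct C" "u = w"
  then obtain n A B where n: "rotate n C = u # A @ u # B" unfolding bad_pair_def by blast
  then have "distinct (u # A @ u # B)" using \<open>distinct C\<close> distinct_rotate by metis
  then show False by simp
qed

text \<open>The positions of two rim vertices relative to the cut points \<open>u\<close> and
  \<open>w\<close>; rotation reduces each of them to \<open>bad_pair_iff\<close>.\<close>

lemma bad_pair_arcs:
  assumes "distinct (u # A @ w # B)"
  shows "A = A1 @ a # A2 \<Longrightarrow>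
      bad_pair x (u # A @ w # B) u a \<longleftrightarrow> cn x A1 > 0 \<and> cn x (A2 @ w # B) > 0"
    and "B = B1 @ b # B2 \<Longrightarrow> bad_pair x (u # A @ w # B) u b \<longleftrightarrow> cn x (A @ w # B1) > 0 \<and> cn x B2 > 0"
    and "A = A1 @ a # A2 \<Longrightarrow> bad_pair x (u # A @ w # B) a w \<longleftrightarrow> cn x A2 > 0 \<and> cn x (B @ u # A1) > 0"
    and "B = B1 @ b # B2 \<Longrightarrow> bad_pair x (u # A @ w # B) w b \<longleftrightarrow> cn x B1 > 0 \<and> cn x (B2 @ u # A) > 0"
    and "A = A1 @ a # A2 \<Longrightarrow> B = B1 @ b # B2 \<Longrightarrow>
      bad_pair x (u # A @ w # B) a b \<longleftrightarrow> cn x (A2 @ w # B1) > 0 \<and> cn x (B2 @ u # A1) > 0"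
proof -
  show "bad_pair x (u # A @ w # B) u a \<longleftrightarrow> cn x A1 > 0 \<and> cn x (A2 @ w # B) > 0" if "A = A1 @ a # A2"
    using bad_pair_iff[of u A1 a "A2 @ w # B" x] assms that by simp
  show "bad_pair x (u # A @ w # B) u b \<longleftrightarrow> cn x (A @ w # B1) > 0 \<and> cn x B2 > 0" if "B = B1 @ b # B2"
    using bad_pair_iff[of u "A @ w # B1" b B2 x] assms that by simp
  show "bad_pair x (u # A @ w # B) a w \<longleftrightarrow> cn x A2 > 0 \<and> cn x (B @ u # A1) > 0" if h: "A = A1 @ a # A2"
  proof -
    have "distinct (a # A2 @ w # (B @ u # A1))" using assms h by auto
    from bad_pair_iff[OF this, of x] show ?thesis
      using bad_pair_swap[of x "u # A1" "a # A2 @ w # B" a w] h by simp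
  qed
  show "bad_pair x (u # A @ w # B) w b \<longleftrightarrow> cn x B1 > 0 \<and> cn x (B2 @ u # A) > 0" if h: "B = B1 @ b # B2"
  proof -
    have "distinct (w # B1 @ b # (B2 @ u # A))" using assms h by auto
    from bad_pair_iff[OF this, of x] show ?thesis
      using bad_pair_swap[of x "u # A" "w # B" w b] h by simp
  qed
  show "bad_pair x (u # A @ w # B) a b \<longleftrightarrow> cn x (A2 @ w # B1) > 0 \<and> cn x (B2 @ u # A1) > 0"
    if h: "A = A1 @ a # A2" "B = B1 @ b # B2"
  proof -
    have "distinct (a # (A2 @ w # B1) @ b # (B2 @ u # A1))" using assms h by auto
    from bad_pair_iff[OF this, of x] show ?thesis
      using bad_pair_swap[of x "u # A1" "a # A2 @ w # B" a b] h by simp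
  qed
qed

lemma bad_pair_rev: "bad_pair x (rev C) u w \<longleftrightarrow> bad_pair x C u w"
proof -
  have *: "bad_pair x (rev C) u w" if b: "bad_pair x C u w" for C
  proof -
    obtain n A B where n: "rotate n C = u # A @ w # B" "cn x A > 0" "cn x B > 0"
      using b unfolding bad_pair_def by blast
    let ?m = "n mod length C"
    have "drop ?m C @ take ?m C = u # A @ w # B" using n(1) by (simp add: rotate_drop_take)
    then have "rev (drop ?m C @ take ?m C) = rev B @ w # rev A @ [u]" by simp
    then have "rev (take ?m C) @ rev (drop ?m C) = (rev B @ w # rev A) @ [u]" by simp
    moreover have "rev C = rev (drop ?m C) @ rev (take ?m C)"
      using rev_append[of "take ?m C" "drop ?m C"] by simp
    ultimately have "bad_pair x (rev C) u w \<longleftrightarrow> bad_pair x ([u] @ (rev B @ w # rev A)) u w"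
      by (metis bad_pair_swap)
    moreover have "bad_pair x ([u] @ (rev B @ w # rev A)) u w"
      unfolding bad_pair_def using n by (intro exI[of _ 0] exI[of _ "rev B"] exI[of _ "rev A"]) simp
    ultimately show ?thesis by blast
  qed
  show ?thesis using *[of C] *[of "rev C"] by auto
qed

text \<open>Both vertices lie in \<open>N\<close>, so \<open>M\<close> and \<open>M'\<close> are
  contained in the same one of the two arcs between them. That arc has no fewer neighbours of
  \<open>x\<close> when \<open>M\<close> is put back.\<close>

lemma bad_pair_replace:
  assumes d: "distinct (M @ N)" "distinct (M' @ N)" and le: "cn x M' \<le> cn x M"
    and ab: "a \<in> set N" "b \<in> set N" and b: "bad_pair x (M' @ N) a b"
  shows "bad_pair x (M @ N) a b"
proof -
  have main: "bad_pair x (M @ N) a b" if N: "N = N1 @ a # N2 @ b # N3" and b: "bad_pair x (M' @ N) a b" for a b N1 N2 N3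
  proof -
    have "bad_pair x (a # N2 @ b # (N3 @ M' @ N1)) a b"
      using b bad_pair_swap[of x "M' @ N1" "a # N2 @ b # N3" a b] N by simp
    then have "cn x N2 > 0 \<and> cn x (N3 @ M' @ N1) > 0"
      by (subst (asm) bad_pair_iff) (use d N in auto)
    then have "cn x N2 > 0 \<and> cn x (N3 @ M @ N1) > 0" using le by auto
    then have "bad_pair x (a # N2 @ b # (N3 @ M @ N1)) a b"
      by (subst bad_pair_iff) (use d N in auto)
    then show ?thesis using bad_pair_swap[of x "M @ N1" "a # N2 @ b # N3" a b] N by simp
  qed
  have "a \<noteq> b" using bad_pair_neq[OF b d(2)] .
  obtain N1 Y where N: "N = N1 @ a # Y" using split_list[OF ab(1)] by blast
  show ?thesis
  proof (cases "b \<in> set Y")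
    case True
    then obtain N2 N3 where "Y = N2 @ b # N3" using split_list by fast
    then show ?thesis using main[of N1 a N2 b N3] N b by simp
  next
    case False
    then have "b \<in> set N1" using ab N \<open>a \<noteq> b\<close> by auto
    then obtain K1 K2 where "N1 = K1 @ b # K2" using split_list by fast
    then show ?thesis using main[of K1 b K2 a Y] N bad_pair_sym[OF b] bad_pair_sym by simp
  qed
qed

definition outside :: "'a \<Rightarrow> 'a list \<Rightarrow> 'a set" where
  "outside x C = {v \<in> V. v \<noteq> x \<and> \<not> E x v \<and> v \<notin> set C}"

definition proper :: "'a \<Rightarrow> 'a list \<Rightarrow> bool" where
  "proper x C \<longleftrightarrow> hole C \<and> x \<notin> set C \<and> 4 \<le> cn x C \<and>
    (\<forall>y\<in>outside x C. cn y C \<le> 2 \<and> (\<forall>u\<in>set C. \<forall>w\<in>set C. E y u \<longrightarrow> E y w \<longrightarrow> \<not> bad_pair x C u w))"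

lemma proper_rotate: "proper x (rotate n C) \<longleftrightarrow> proper x C"
  unfolding proper_def hole_rotate cn_rotate set_rotate outside_def bad_pair_rotate ..

lemma proper_rev: "proper x (rev C) \<longleftrightarrow> proper x C"
  unfolding proper_def hole_rev cn_simps set_rev outside_def bad_pair_rev ..

end

context triangle_ISK4_free_graph
begin

text \<open>
  A shortest hole that is the rim of a wheel, with a centre having fewest spokes.
\<close>

lemma ex_proper:
  assumes "hole C0" "x0 \<notin> set C0" "3 \<le> cn x0 C0"
  shows "\<exists>C x. proper x C"
proof -
  define W where "W C x \<longleftrightarrow> hole C \<and> x \<notin> set C \<and> 3 \<le> cn x C" for C x
  have "W (fst (C0, x0)) (snd (C0, x0))" using assms unfolding W_def by simp
  then have "\<exists>X. W (fst X) (snd X) \<and> (\<forall>Y. W (fst Y) (snd Y) \<longrightarrow> length (fst X) \<le> length (fst Y))"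
    by (rule ex_has_least_nat)
  then obtain Cx1 where 1: "W (fst Cx1) (snd Cx1)"
      "\<forall>Y. W (fst Y) (snd Y) \<longrightarrow> length (fst Cx1) \<le> length (fst Y)" by blast
  let ?N = "length (fst Cx1)"
  have "W (fst Cx1) (snd Cx1) \<and> length (fst Cx1) = ?N" using 1(1) by simp
  then have "\<exists>X. (W (fst X) (snd X) \<and> length (fst X) = ?N) \<and>
      (\<forall>Y. W (fst Y) (snd Y) \<and> length (fst Y) = ?N \<longrightarrow> cn (snd X) (fst X) \<le> cn (snd Y) (fst Y))"
    by (rule ex_has_least_nat)
  then obtain Cx2 where 2: "W (fst Cx2) (snd Cx2)" "length (fst Cx2) = ?N"
      "\<forall>Y. W (fst Y) (snd Y) \<and> length (fst Y) = ?N \<longrightarrow> cn (snd Cx2) (fst Cx2) \<le> cn (snd Y) (fst Y)"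
    by blast
  define C x where "C = fst Cx2" and "x = snd Cx2"
  have W: "W C x" "length C = ?N" using 2(1,2) by (simp_all add: C_def x_def)
  have len: "length C \<le> length D" if "W D z" for D z
    using 1(2)[rule_format, of "(D, z)"] 2(2) that by (simp add: C_def)
  have cnt: "cn x C \<le> cn z D" if "W D z" "length D = length C" for D z
    using 2(3)[rule_format, of "(D, z)"] 2(2) that by (simp add: C_def x_def)
  have h: "hole C" "x \<notin> set C" using W by (auto simp: W_def)
  have c4: "4 \<le> cn x C" using W no_three[OF h] unfolding W_def by fastforce
  have sh: "no_wheel_below (length C)"
    unfolding no_wheel_below_def using len unfolding W_def by (metis not_less_eq_eq numeral_2_eq_2 numeral_3_eq_3 leD)
  have "cn y C \<le> 2 \<and> (\<forall>u\<in>set C. \<forall>w\<in>set C. E y u \<longrightarrow> E y w \<longrightarrow> \<not> bad_pair x C u w)" if y: "y \<in> outside x C" for y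
  proof -
    have yn: "y \<notin> set C" "x \<noteq> y" "\<not> E x y" "\<not> E y x" using y Esym by (auto simp: outside_def)
    \<comment> \<open>Otherwise \<open>y\<close> would be a second centre of a shortest rim.\<close>
    have "\<not> 4 \<le> cn y C" using two_centres[OF h(1,2) yn(1-3) c4 _ sh] by blast
    moreover have "cn y C \<noteq> 3" using no_three[OF h(1) yn(1)] by blast
    ultimately have c2: "cn y C \<le> 2" by linarith
    moreover have False if uw: "E y u" "E y w" "bad_pair x C u w" for u w
    proof -
      obtain n A B where n: "rotate n C = u # A @ w # B" "cn x A > 0" "cn x B > 0"
        using uw(3) unfolding bad_pair_def by blast
      have h1: "hole (u # A @ w # B)" using h(1) hole_rotate[of n C] n by simp
      have s1: "set (u # A @ w # B) = set C" using n(1) set_rotate by metis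
      have c1: "cn z (u # A @ w # B) = cn z C" for z using n(1) cn_rotate by metis
      have l1: "length (u # A @ w # B) = length C" using n(1) length_rotate by metis
      have ne: "A \<noteq> []" "B \<noteq> []" using n by auto
      note a = hole_arcs[OF h1 ne]
      have "cn y A = 0" "cn y B = 0" using c2 uw c1[of y] by auto
      then have yAB: "apart {y} (set A \<union> set B)" using yn s1 by (auto simp: apart_def cn_0)
      have ip: "ipath (u # [y] @ [w])" using uw a yn s1 by (auto simp: apart_def Esym)
      \<comment> \<open>For the path consisting of \<open>y\<close> alone: rerouting the rim through
        \<open>y\<close> leaves a wheel.\<close>
      have "4 \<le> cn x (u # A @ [w])"
        by (rule chord_path[OF h1 _ ip]) (use h yn s1 yAB n c1 c4 in \<open>auto simp: apart_def\<close>)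
      moreover have "hole (u # A @ w # rev [y])"
        by (rule hole_through[OF a(1) ip ne(1)]) (use yAB in \<open>auto simp: apart_def dest: Esym\<close>)
      ultimately have W': "W (u # A @ w # rev [y]) x"
        using yn h s1 unfolding W_def by (auto split: if_splits)
      \<comment> \<open>The new rim is no longer than \<open>C\<close>, hence also shortest. It has
        lost the spokes in \<open>B\<close>, against the choice of the centre.\<close>
      have "length (u # A @ w # rev [y]) \<le> length C" using l1 ne(2) by (cases B) auto
      then have "length (u # A @ w # rev [y]) = length C" using len[OF W'] by simp
      then have "cn x C \<le> cn x (u # A @ w # rev [y])" using cnt[OF W'] by simp
      also have "\<dots> < cn x (u # A @ w # B)" using n(3) yn by simp
      finally show False using c1 by simp
    qed
    ultimately show ?thesis by blast
  qed
  then have "proper x C" unfolding proper_def using h c4 by blast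
  then show ?thesis by blast
qed

end

section \<open>Shortest bad paths\<close>

context sgraph
begin

lemma walk_sub: "walk S u (P @ M @ Q) v \<Longrightarrow> M \<noteq> [] \<Longrightarrow> walk S (hd M) M (last M)"
  unfolding walk_def by (auto simp: successively_append_iff)

definition bad_path :: "'a \<Rightarrow> 'a list \<Rightarrow> 'a list \<Rightarrow> bool" where
  "bad_path x C ps \<longleftrightarrow> (\<exists>p q u w. walk (outside x C) p ps q \<and> E p u \<and> E q w \<and> bad_pair x C u w)"

lemma bad_path_rotate: "bad_path x (rotate n C) ps \<longleftrightarrow> bad_path x C ps"
  unfolding bad_path_def outside_def set_rotate bad_pair_rotate ..

lemma bad_path_rev: "bad_path x (rev C) ps \<longleftrightarrow> bad_path x C ps"
  unfolding bad_path_def outside_def set_rev bad_pair_rev ..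

lemma bad_path_rev_path: "bad_path x C ps \<Longrightarrow> bad_path x C (rev ps)"
  unfolding bad_path_def using walk_rev bad_pair_sym by blast

text \<open>Path lengths are compared over all proper wheels with centre \<open>x\<close> and
  equally many spokes, not for the rim \<open>C\<close> alone, because \<open>end_unique_aux\<close>
  changes the rim and keeps the number of spokes.\<close>

definition min_bad :: "'a \<Rightarrow> 'a list \<Rightarrow> 'a list \<Rightarrow> bool" where
  "min_bad x C ps \<longleftrightarrow> proper x C \<and> bad_path x C ps \<and> (\<forall>C'. proper x C' \<longrightarrow> cn x C \<le> cn x C') \<and>
    (\<forall>C' ps'. proper x C' \<longrightarrow> cn x C' = cn x C \<longrightarrow> bad_path x C' ps' \<longrightarrow> length ps \<le> length ps')"

lemma min_bad_rotate: "min_bad x (rotate n C) ps \<longleftrightarrow> min_bad x C ps"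
  unfolding min_bad_def proper_rotate bad_path_rotate cn_rotate ..

lemma min_bad_swap: "min_bad x (xs @ ys) ps \<longleftrightarrow> min_bad x (ys @ xs) ps"
  using min_bad_rotate[of x "length xs" "xs @ ys"] by (simp add: rotate_append)

lemma min_bad_rev: "min_bad x (rev C) ps \<longleftrightarrow> min_bad x C ps"
  unfolding min_bad_def proper_rev bad_path_rev cn_simps ..

lemma min_bad_rev_path: "min_bad x C ps \<Longrightarrow> min_bad x C (rev ps)"
  unfolding min_bad_def length_rev using bad_path_rev_path by blast

lemma min_bad_flip: "min_bad x (u # A @ w # B) ps \<longleftrightarrow> min_bad x (u # rev B @ w # rev A) ps"
  using min_bad_rev[of x "u # A @ w # B" ps] min_bad_swap[of x "[u]" "rev B @ w # rev A" ps] by simp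

lemma min_bad_hole: "min_bad x C ps \<Longrightarrow> hole C \<and> x \<notin> set C \<and> 4 \<le> cn x C"
  unfolding min_bad_def proper_def by blast

lemma min_bad_short:
  assumes "min_bad x C ps" "walk (outside x C) p qs q" "length qs < length ps" "E p a" "E q b"
  shows "\<not> bad_pair x C a b"
proof
  assume "bad_pair x C a b"
  then have "bad_path x C qs" using assms unfolding bad_path_def by blast
  then show False using assms unfolding min_bad_def by fastforce
qed

lemma min_bad_single: "min_bad x C ps \<Longrightarrow> y \<in> outside x C \<Longrightarrow> E y a \<Longrightarrow> E y b \<Longrightarrow> \<not> bad_pair x C a b"
  unfolding min_bad_def proper_def using bad_pair_mem by blast

lemma min_bad_cn: "min_bad x C ps \<Longrightarrow> y \<in> outside x C \<Longrightarrow> cn y C \<le> 2"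
  unfolding min_bad_def proper_def by blast

text \<open>In a proper wheel a single outside vertex is never attached to a bad pair, so the ends
  of the path differ. Minimal length makes the path induced.\<close>

lemma min_bad_path:
  assumes m: "min_bad x C ps"
  shows "ps \<noteq> []" "walk (outside x C) (hd ps) ps (last ps)" "set ps \<subseteq> outside x C" "2 \<le> length ps" "ipath ps"
    "\<exists>u w. E (hd ps) u \<and> E (last ps) w \<and> bad_pair x C u w"
proof -
  obtain p q u w where w: "walk (outside x C) p ps q" "E p u" "E q w" "bad_pair x C u w"
    using m unfolding min_bad_def bad_path_def by blast
  show 1: "ps \<noteq> []" "walk (outside x C) (hd ps) ps (last ps)" "set ps \<subseteq> outside x C"
    using w unfolding walk_def by auto
  have pq: "hd ps = p" "last ps = q" using w unfolding walk_def by auto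
  then show "\<exists>u w. E (hd ps) u \<and> E (last ps) w \<and> bad_pair x C u w" using w by blast
  have "hd ps \<noteq> last ps"
    using min_bad_single[OF m, of "hd ps"] w pq walk_ends[OF w(1)] by metis
  then show "2 \<le> length ps" using 1 by (cases ps rule: ipath.cases) auto
  show "ipath ps"
  proof (rule shortest_walk_ipath[OF w(1)], rule ccontr)
    fix ys
    assume "walk (outside x C) p ys q" "\<not> length ps \<le> length ys"
    then show False using min_bad_short[OF m _ _ w(2,3)] w(4) by fastforce
  qed
qed

end

context triangle_ISK4_free_graph
begin

text \<open>
  If the end \<open>p\<close> of the bad path had two neighbours \<open>u\<close>, \<open>u'\<close> on the hole, rerouting the hole
  through \<open>p\<close> would leave a shorter bad path.
\<close>

lemma end_unique_aux:
  assumes m: "min_bad x (u # A @ u' # B) (p # qs)" and p: "E p u" "E p u'" and A0: "cn x A = 0"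
    and w: "E (last (p # qs)) w" "bad_pair x (u # A @ u' # B) u w"
  shows False
proof -
  \<comment> \<open>The rim \<open>?H\<close> uses \<open>p\<close> instead of \<open>A\<close>.
    Neither contains a neighbour of \<open>x\<close>, so the number of spokes is the same.\<close>
  let ?C = "u # A @ u' # B" let ?H = "u # [p] @ u' # B"
  have h: "hole ?C" and x: "x \<notin> set ?C" and n4: "4 \<le> cn x ?C" using min_bad_hole[OF m] by auto
  have d: "distinct ?C" using hole_distinct[OF h] .
  note mp = min_bad_path[OF m]
  have po: "p \<in> outside x ?C" using mp(3) by simp
  have pn: "p \<notin> set ?C" "p \<noteq> x" "\<not> E x p" using po unfolding outside_def by blast+
  have u'w: "u' \<noteq> w" using min_bad_single[OF m po p] w(2) by blast
  have An: "A \<noteq> []"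
  proof
    assume "A = []"
    then have "E u u'" using h hole_wk by fastforce
    then show False using tri p by blast
  qed
  have Bn: "B \<noteq> []"
  proof
    assume "B = []"
    then have "\<not> bad_pair x ?C u w" using bad_pair_arcs(1)[OF d] bad_pair_mem bad_pair_neq[OF _ d] A0 u'w
      by (metis split_list append_is_Nil_conv cn_simps(1) in_set_conv_decomp insert_iff list.set(1,2) set_append Un_iff add_is_0 cn_simps(3) less_numeral_extra(3) empty_iff)
    then show False using w by blast
  qed
  note a = hole_arcs[OF h An Bn]
  have cp: "cn p A = 0" "cn p B = 0" using min_bad_cn[OF m po] p by auto
  have "w \<in> set B"
  proof -
    have "w \<notin> set A"
    proof
      assume "w \<in> set A"
      then obtain A1 A2 where "A = A1 @ w # A2" using split_list by fast
      then show False using bad_pair_arcs(1)[OF d, of A1 w A2 x] A0 w(2) by simp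
    qed
    then show ?thesis using bad_pair_mem[OF w(2)] bad_pair_neq[OF w(2) d] u'w by auto
  qed
  then obtain B1 B2 where B: "B = B1 @ w # B2" using split_list by fast
  have st: "cn x (u' # B1) > 0" "cn x B2 > 0"
    using bad_pair_arcs(2)[OF d B, of x] w(2) A0 by auto
  have ip: "ipath (u' # [p] @ [u])" using p a pn Esym by (auto simp: apart_def)
  have ip2: "ipath (u' # B @ [u])" using a(2) by simp
  have "hole (u' # B @ u # rev [p])"
    by (rule hole_through[OF ip2 ip Bn]) (use cp pn Esym in \<open>auto simp: apart_def cn_0\<close>)
  then have hH: "hole ?H" using hole_swap[of "u' # B" "[u, p]"] by simp
  have dH: "distinct ?H" using hole_distinct[OF hH] .
  have cH: "cn x ?H = cn x ?C" using A0 pn by simp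
  have xH: "x \<notin> set ?H" using x pn by auto
  have Hb: "bad_pair x ?H p b \<longleftrightarrow> cn x (u' # X1) > 0 \<and> cn x (X2 @ [u]) > 0" if "B = X1 @ b # X2" for b X1 X2
    using bad_pair_iff[of p "u' # X1" b "X2 @ [u]" x] bad_pair_swap[of x "[u]" "[p] @ u' # B" p b] dH that by auto
  \<comment> \<open>Going back from \<open>?H\<close> to \<open>?C\<close> puts \<open>A\<close> in
    place of \<open>p\<close>; a pair that avoids \<open>p\<close> and is bad on \<open>?H\<close>
    is then bad on \<open>?C\<close>.\<close>
  have tr: "\<not> bad_pair x ?H b b'" if "b \<in> set (u' # B @ [u])" "b' \<in> set (u' # B @ [u])" "\<not> bad_pair x ?C b b'" for b b'
  proof
    assume "bad_pair x ?H b b'"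
    then have "bad_pair x ([p] @ (u' # B @ [u])) b b'" using bad_pair_swap[of x "[u]" "[p] @ u' # B" b b'] by simp
    then have "bad_pair x (A @ (u' # B @ [u])) b b'"
      by (rule bad_pair_replace[rotated 5]) (use d dH that pn in auto)
    then show False using bad_pair_swap[of x "[u]" "A @ u' # B" b b'] that by simp
  qed
  show False
  \<comment> \<open>A path with two vertices is excluded directly, by a spider with centre
    \<open>p\<close> whose legs are \<open>u\<close>, \<open>u'\<close> and the path through
    \<open>q\<close> to \<open>w\<close>.\<close>
  proof (cases "length (p # qs) = 2")
    case True
    then obtain q where qs: "qs = [q]" by (cases qs) auto
    have pq: "E p q" "q \<in> outside x ?C" "E q w" using mp(3,5) qs w by auto
    have qn: "q \<notin> set ?C" "\<not> E q u" "\<not> E q u'" "q \<noteq> p" using pq tri p Esym Eirr unfolding outside_def by blast+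
    have qA: "cn q A = 0"
    proof (rule ccontr)
      assume "cn q A \<noteq> 0"
      then obtain w' where w': "w' \<in> set A" "E q w'" using cn_pos[of q A] by auto
      obtain A1 A2 where A: "A = A1 @ w' # A2" using split_list[OF w'(1)] by blast
      have "bad_pair x ?C w' w" using bad_pair_arcs(5)[OF d A B] st by auto
      then show False using min_bad_single[OF m pq(2) w'(2) pq(3)] by blast
    qed
    have "cn q B \<le> 2" using min_bad_cn[OF m pq(2)] by (auto split: if_splits)
    \<comment> \<open>Together with \<open>p\<close> these would be exactly three neighbours of
      \<open>q\<close> on the hole \<open>?H\<close>.\<close>
    moreover have "cn q B \<noteq> 2"
    proof
      assume "cn q B = 2"
      then have "cn q ?H = 3" using qn pq Esym by auto
      then show False using no_three[OF hH, of q] qn by auto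
    qed
    moreover have "cn q B > 0" unfolding cn_pos using \<open>w \<in> set B\<close> pq by blast
    ultimately have "cn q B = 1" by linarith
    then have qw: "\<forall>v\<in>set ?C. E q v \<longrightarrow> v = w"
      using cn_one[of q B] \<open>w \<in> set B\<close> pq(3) qn qA unfolding cn_0 by auto
    show False
    proof (rule spider[OF h, of p "[]" u "[]" u' "[q]" w])
      show "leg ?C p [] u" "leg ?C p [] u'" using p pn by (auto intro!: leg_direct)
      show "leg ?C p [q] w" unfolding leg_def using pq qn qw \<open>w \<in> set B\<close> cp pn
        by (auto simp: apart_def cn_0)
      show "distinct [u, u', w]" using a(4) u'w bad_pair_neq[OF w(2) d] by simp
      show "\<forall>z\<in>set ?C. E p z \<longrightarrow> z \<in> {u, u', w}" using cp by (auto simp: cn_0)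
    qed (use pn in auto)
  next
    case False
    then have k: "length (p # qs) > 2" using mp(4) by linarith
    then obtain r rs where qs: "qs = r # rs" "rs \<noteq> []" by (cases qs rule: ipath.cases) auto
    \<comment> \<open>Once \<open>?H\<close> is known to be proper, the path without
      \<open>p\<close>, now attached at \<open>p\<close> itself, is a shorter bad path with equally
      many spokes.\<close>
    have pr: "proper x ?H"
      unfolding proper_def
    proof (intro conjI ballI)
      fix y assume yo: "y \<in> outside x ?H"
      have yn: "y \<noteq> x" "y \<in> V" "\<not> E x y" "y \<notin> set ?H" using yo unfolding outside_def by blast+
      have "cn y ?H \<le> 2 \<and> (\<forall>b\<in>set ?H. \<forall>b'\<in>set ?H. E y b \<longrightarrow> E y b' \<longrightarrow> \<not> bad_pair x ?H b b')"
      proof (cases "y \<in> set A")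
        case True
        have nb: "b = u \<or> b = u'" if "E y b" "b \<in> set ?H" for b
          using that a(3) True cp Esym by (auto simp: apart_def cn_0)
        have "cn y B = 0" using a(3) True by (auto simp: apart_def cn_0)
        moreover have "\<not> E y p" using cp True Esym by (auto simp: cn_0)
        ultimately have "cn y ?H \<le> 2" by auto
        moreover have "\<not> bad_pair x ?H u u'" using bad_pair_iff[OF dH, of x] pn by simp
        moreover have "\<not> bad_pair x ?H u' u" using calculation(2) bad_pair_sym by blast
        moreover have "\<not> bad_pair x ?H b b" for b using bad_pair_neq[OF _ dH] by blast
        ultimately show ?thesis using nb by blast
      next
        case False
        then have yC: "y \<in> outside x ?C" using yn unfolding outside_def by auto
        have c2: "cn y ?C \<le> 2" by (rule min_bad_cn[OF m yC])
        have tr': "\<not> bad_pair x ?H b b'" if "E y b" "E y b'" "b \<in> set (u' # B @ [u])" "b' \<in> set (u' # B @ [u])" for b b'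
          by (rule tr[OF that(3,4)]) (rule min_bad_single[OF m yC that(1,2)])
        show ?thesis
        proof (cases "E y p")
          case False
          have "cn y ?H \<le> 2" using False c2 by auto
          moreover have "\<not> bad_pair x ?H b b'" if "E y b" "E y b'" "b \<in> set ?H" "b' \<in> set ?H" for b b'
            using tr'[of b b'] that False by auto
          ultimately show ?thesis by blast
        next
          case True
          have nu: "\<not> E y u" "\<not> E y u'" using tri[of y p] True p by blast+
          have wk: "walk (outside x ?C) p [p, y] y" using po yC Esym[OF True] unfolding walk_def by simp
          have "cn y ?H \<le> 3" using c2 nu by auto
          moreover have "cn y ?H \<noteq> 3" using no_three[OF hH yn(4)] by blast
          ultimately have c2': "cn y ?H \<le> 2" by linarith
          \<comment> \<open>The walk \<open>p\<close>, \<open>y\<close> is shorter than the minimal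
            path, so \<open>b\<close> forms no bad pair with \<open>u\<close> or \<open>u'\<close>
            on the old rim. If \<open>p\<close> and \<open>b\<close> were bad on the new one, the
            spokes would be among \<open>u\<close>, \<open>u'\<close>, \<open>b\<close>, but there
            are four.\<close>
          have bb: "\<not> bad_pair x ?H p b" if b: "b \<in> set B" "E y b" for b
          proof
            assume bd: "bad_pair x ?H p b"
            obtain X1 X2 where X: "B = X1 @ b # X2" using split_list[OF b(1)] by blast
            have 1: "cn x (u' # X1) > 0" "cn x (X2 @ [u]) > 0" using Hb[OF X] bd by auto
            have "\<not> bad_pair x ?C u b" "\<not> bad_pair x ?C u' b"
              using min_bad_short[OF m wk _ p(1) b(2)] min_bad_short[OF m wk _ p(2) b(2)] k by auto
            then have 2: "cn x X2 = 0" "cn x X1 = 0"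
              using bad_pair_arcs(2)[OF d X, of x] bad_pair_arcs(4)[OF d X, of x] 1 A0 by (auto split: if_splits)
            then show False using n4 A0 X by (auto split: if_splits)
          qed
          have "\<not> bad_pair x ?H b b'" if "E y b" "E y b'" "b \<in> set ?H" "b' \<in> set ?H" for b b'
          proof -
            have "b = p \<or> b \<in> set B" "b' = p \<or> b' \<in> set B" using that nu by auto
            moreover have "\<not> bad_pair x ?H p p" using bad_pair_neq[OF _ dH] by blast
            moreover have "\<not> bad_pair x ?H b p" if "b \<in> set B" "E y b" for b
              using bb[OF that] bad_pair_sym by blast
            ultimately show ?thesis using bb[of b] bb[of b'] tr'[of b b'] that by auto
          qed
          then show ?thesis using c2' by blast
        qed
      qed
      then show "cn y ?H \<le> 2" "\<And>b b'. b \<in> set ?H \<Longrightarrow> b' \<in> set ?H \<Longrightarrow> E y b \<longrightarrow> E y b' \<longrightarrow> \<not> bad_pair x ?H b b'"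
        by blast+
    qed (use hH xH n4 cH in auto)
    have "walk (outside x ?H) r (r # rs) (last (r # rs))"
    proof -
      have "set (r # rs) \<subseteq> outside x ?H"
        using mp(3) ipath_distinct[OF mp(5)] qs unfolding outside_def by auto
      then show ?thesis using mp(2) qs unfolding walk_def by auto
    qed
    moreover have "E r p" using mp(5) qs Esym by simp
    moreover have "bad_pair x ?H p w" using Hb[OF B] st by auto
    ultimately have "bad_path x ?H (r # rs)" unfolding bad_path_def using w(1) qs by (metis last_ConsR list.distinct(1))
    then show False using m pr cH unfolding min_bad_def qs by fastforce
  qed
qed

text \<open>A single vertex is not attached to a bad pair, so one of the arcs between
  \<open>u\<close> and \<open>v\<close> has no spoke. After a reflection it is the first arc, as
  \<open>end_unique_aux\<close> requires.\<close>

lemma end_unique: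
  assumes m: "min_bad x C ps" and p: "E (hd ps) u" and w: "E (last ps) w" "bad_pair x C u w"
    and v: "v \<in> set C" "E (hd ps) v"
  shows "v = u"
proof (rule ccontr)
  assume ne: "v \<noteq> u"
  obtain p qs where ps: "ps = p # qs" using min_bad_path(1)[OF m] by (cases ps) auto
  obtain n A B where n: "rotate n C = u # A @ v # B"
    using rotate_two[of u C v] bad_pair_mem[OF w(2)] v ne by metis
  have m': "min_bad x (u # A @ v # B) (p # qs)" using m min_bad_rotate[of x n C ps] n ps by simp
  have b': "bad_pair x (u # A @ v # B) u w" using w(2) bad_pair_rotate[of x n C u w] n by simp
  have d: "distinct (u # A @ v # B)" using hole_distinct min_bad_hole[OF m'] by blast
  have "p \<in> outside x (u # A @ v # B)" using min_bad_path(3)[OF m'] by simp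
  then have "\<not> bad_pair x (u # A @ v # B) u v" using min_bad_single[OF m'] p v ps by simp
  then have "cn x A = 0 \<or> cn x B = 0" using bad_pair_iff[OF d, of x] by simp
  then show False
  proof
    assume "cn x A = 0"
    then show False using end_unique_aux[OF m' _ _ _ _ b'] p v w ps by simp
  next
    assume "cn x B = 0"
    moreover have "min_bad x (u # rev B @ v # rev A) (p # qs)" using m' min_bad_flip by blast
    moreover have "bad_pair x (u # rev B @ v # rev A) u w"
      using b' bad_pair_rev[of x "u # A @ v # B" u w] bad_pair_swap[of x "[u]" "rev B @ v # rev A" u w] by simp
    ultimately show False using end_unique_aux[of x u "rev B" v "rev A" p qs w] p v w ps by simp
  qed
qed

text \<open>
  The ends of a minimal bad path are attached to the hole at \<open>u\<close> and \<open>w\<close> only.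
\<close>

definition min_bad_at :: "'a \<Rightarrow> 'a \<Rightarrow> 'a list \<Rightarrow> 'a \<Rightarrow> 'a list \<Rightarrow> 'a list \<Rightarrow> bool" where
  "min_bad_at x u A w B ps \<longleftrightarrow> min_bad x (u # A @ w # B) ps \<and> cn x A > 0 \<and> cn x B > 0 \<and>
    E (hd ps) u \<and> E (last ps) w \<and> (\<forall>v\<in>set (u # A @ w # B). E (hd ps) v \<longrightarrow> v = u) \<and>
    (\<forall>v\<in>set (u # A @ w # B). E (last ps) v \<longrightarrow> v = w)"

text \<open>Reflecting the rim exchanges the arcs, so facts about \<open>B\<close> carry over to
  \<open>A\<close>. The next lemma exchanges the ends of the path as well.\<close>

lemma min_bad_at_flip: "min_bad_at x u A w B ps \<Longrightarrow> min_bad_at x u (rev B) w (rev A) ps"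
proof -
  assume s: "min_bad_at x u A w B ps"
  have "set (u # rev B @ w # rev A) = set (u # A @ w # B)" by auto
  then show ?thesis using s min_bad_flip[of x u A w B ps] unfolding min_bad_at_def cn_simps by metis
qed

lemma min_bad_at_rev: "min_bad_at x u A w B ps \<Longrightarrow> min_bad_at x w (rev A) u (rev B) (rev ps)"
proof -
  assume s: "min_bad_at x u A w B ps"
  have m: "min_bad x (w # rev A @ u # rev B) (rev ps)"
    using s min_bad_rev_path min_bad_rev[of x "u # A @ w # B" "rev ps"]
      min_bad_swap[of x "rev B" "w # rev A @ [u]"] unfolding min_bad_at_def by simp
  have "set (w # rev A @ u # rev B) = set (u # A @ w # B)" by auto
  moreover have "ps \<noteq> []" using min_bad_path(1) s unfolding min_bad_at_def by blast
  ultimately show ?thesis using s m unfolding min_bad_at_def cn_simps by (metis hd_rev last_rev)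
qed

lemma min_bad_at_exists:
  assumes m: "min_bad x C ps"
  shows "\<exists>u A w B. min_bad_at x u A w B ps"
proof -
  obtain u w where uw: "E (hd ps) u" "E (last ps) w" "bad_pair x C u w"
    using min_bad_path(6)[OF m] by blast
  obtain n A B where n: "rotate n C = u # A @ w # B" "cn x A > 0" "cn x B > 0"
    using uw(3) unfolding bad_pair_def by blast
  have s: "set C = set (u # A @ w # B)" using n(1) set_rotate by metis
  have "v = u" if "v \<in> set C" "E (hd ps) v" for v
    by (rule end_unique[OF m uw that])
  moreover have "v = w" if "v \<in> set C" "E (last ps) v" for v
    by (rule end_unique[OF min_bad_rev_path[OF m] _ _ bad_pair_sym[OF uw(3)]])
      (use that uw in \<open>auto simp: hd_rev last_rev\<close>)
  ultimately have "min_bad_at x u A w B ps"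
    unfolding min_bad_at_def s[symmetric] using m min_bad_rotate[of x n C ps] n uw by simp
  then show ?thesis by blast
qed

lemma min_bad_at_facts:
  assumes s: "min_bad_at x u A w B ps"
  shows "min_bad x (u # A @ w # B) ps" "hole (u # A @ w # B)" "x \<notin> set (u # A @ w # B)"
    "4 \<le> cn x (u # A @ w # B)" "cn x A > 0" "cn x B > 0" "A \<noteq> []" "B \<noteq> []"
    "E (hd ps) u" "E (last ps) w" "ps \<noteq> []" "ipath ps" "set ps \<subseteq> outside x (u # A @ w # B)"
    "bad_pair x (u # A @ w # B) u w" "distinct (u # A @ w # B)" "hd ps \<noteq> last ps"
proof -
  show m: "min_bad x (u # A @ w # B) ps" and c: "cn x A > 0" "cn x B > 0"
    and e: "E (hd ps) u" "E (last ps) w" using s unfolding min_bad_at_def by blast+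
  show h: "hole (u # A @ w # B)" "x \<notin> set (u # A @ w # B)" "4 \<le> cn x (u # A @ w # B)"
    using min_bad_hole[OF m] by blast+
  show "A \<noteq> []" "B \<noteq> []" using c by auto
  show "ps \<noteq> []" "ipath ps" "set ps \<subseteq> outside x (u # A @ w # B)" using min_bad_path[OF m] by blast+
  show d: "distinct (u # A @ w # B)" using hole_distinct[OF h(1)] .
  show b: "bad_pair x (u # A @ w # B) u w" using bad_pair_iff[OF d] c by blast
  have "hd ps \<in> outside x (u # A @ w # B)" using min_bad_path(1,3)[OF m] by auto
  then show "hd ps \<noteq> last ps" using min_bad_single[OF m _ e(1)] b e(2) by metis
qed

text \<open>An inner vertex of the path attached to \<open>v\<close> cuts off a shorter walk on
  either side; by minimality, \<open>v\<close> forms no bad pair with \<open>u\<close> or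
  \<open>w\<close>.\<close>

lemma min_bad_at_touch:
  assumes s: "min_bad_at x u A w B ps" and r: "r \<in> set ps" and v: "v \<in> set (u # A @ w # B)" "E r v"
  shows "r = hd ps \<and> v = u \<or> r = last ps \<and> v = w \<or>
    r \<noteq> hd ps \<and> r \<noteq> last ps \<and> \<not> bad_pair x (u # A @ w # B) u v \<and> \<not> bad_pair x (u # A @ w # B) v w"
proof -
  let ?C = "u # A @ w # B"
  note f = min_bad_at_facts[OF s]
  note mp = min_bad_path[OF f(1)]
  obtain P1 P2 where P: "ps = P1 @ r # P2" using split_list[OF r] by blast
  have 1: "\<not> bad_pair x ?C u v" if "r \<noteq> last ps"
  proof -
    have ne: "P2 \<noteq> []" using that P by auto
    have "walk (outside x ?C) (hd ps) (P1 @ [r]) r" using walk_prefix mp(2) P by metis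
    then show ?thesis using min_bad_short[OF f(1) _ _ f(9) v(2)] ne P by simp
  qed
  have 2: "\<not> bad_pair x ?C v w" if "r \<noteq> hd ps"
  proof -
    have ne: "P1 \<noteq> []" using that P by auto
    have "walk (outside x ?C) r (r # P2) (last ps)" using walk_suffix mp(2) P by metis
    then show ?thesis using min_bad_short[OF f(1) _ _ v(2) f(10)] ne P by simp
  qed
  have "v = u" if "r = hd ps" using s v that unfolding min_bad_at_def by blast
  moreover have "v = w" if "r = last ps" using s v that unfolding min_bad_at_def by blast
  ultimately show ?thesis using 1 2 by blast
qed

lemma min_bad_at_ends:
  assumes s: "min_bad_at x u A w B ps" and r: "r \<in> set ps"
  shows "E r u \<Longrightarrow> r = hd ps" "E r w \<Longrightarrow> r = last ps"
  using min_bad_at_touch[OF s r, of u] min_bad_at_touch[OF s r, of w] min_bad_at_facts(14,15)[OF s] by auto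

text \<open>By \<open>min_bad_at_touch\<close>, the vertex \<open>t\<close> is bad with neither
  \<open>u\<close> nor \<open>w\<close>. Since \<open>A\<close> has a spoke, no vertex of
  \<open>B\<close> but \<open>t\<close> can be one, and \<open>B\<close> has at least one.\<close>

lemma min_bad_at_arc:
  assumes s: "min_bad_at x u A w B ps" and r: "r \<in> set ps" "E r t" and B: "B = B1 @ t # B2"
  shows "cn x B1 = 0" "cn x B2 = 0" "E x t" "r \<noteq> hd ps" "r \<noteq> last ps"
proof -
  note f = min_bad_at_facts[OF s]
  have t: "t \<in> set (u # A @ w # B)" "t \<noteq> u" "t \<noteq> w" using B f(15) by auto
  have h: "r \<noteq> hd ps" "r \<noteq> last ps" "\<not> bad_pair x (u # A @ w # B) u t" "\<not> bad_pair x (u # A @ w # B) w t"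
    using min_bad_at_touch[OF s r(1) t(1) r(2)] t(2,3) bad_pair_sym by blast+
  then show "cn x B1 = 0" "cn x B2 = 0" "r \<noteq> hd ps" "r \<noteq> last ps"
    using bad_pair_arcs(2)[OF f(15) B, of x] bad_pair_arcs(4)[OF f(15) B, of x] f(5) by (auto split: if_splits)
  then show "E x t" using f(6) B by (auto split: if_splits)
qed

text \<open>If the path saw \<open>t\<close> in \<open>A\<close> and \<open>t'\<close> in
  \<open>B\<close>, these would be the only spokes inside their arcs. Four spokes then need
  \<open>u\<close> and \<open>w\<close> too, which makes \<open>t\<close>, \<open>t'\<close> a bad
  pair. The path vertices that see them are interior, so the stretch between them would be a shorter
  bad path.\<close>

lemma min_bad_at_one_side:
  assumes s: "min_bad_at x u A w B ps"
  shows "apart (set ps) (set A) \<or> apart (set ps) (set B)"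
proof (rule ccontr)
  let ?C = "u # A @ w # B"
  assume n: "\<not> ?thesis"
  note f = min_bad_at_facts[OF s]
  have "set ps \<inter> set ?C = {}" using f(13) unfolding outside_def by blast
  then obtain r t r' t' where t: "r \<in> set ps" "t \<in> set A" "E r t" "r' \<in> set ps" "t' \<in> set B" "E r' t'"
    using n unfolding apart_def by auto
  obtain A1 A2 where A: "A = A1 @ t # A2" using split_list[OF t(2)] by blast
  obtain B1 B2 where B: "B = B1 @ t' # B2" using split_list[OF t(5)] by blast
  note b = min_bad_at_arc[OF s t(4,6) B]
  have "rev A = rev A2 @ t # rev A1" by (simp add: A)
  note a = min_bad_at_arc[OF min_bad_at_flip[OF s] t(1,3) this]
  have "E x u" "E x w" using f(4) a b A B by (auto split: if_splits)
  then have bd: "bad_pair x ?C t t'" using bad_pair_arcs(5)[OF f(15) A B, of x] by auto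
  have bd': "bad_pair x ?C t' t" using bd by (rule bad_pair_sym)
  have sub: "walk (outside x ?C) (hd M) M (last M)" if "ps = P @ M @ Q" "M \<noteq> []" for P M Q
    using walk_sub[of "outside x ?C" "hd ps" P M Q "last ps"] min_bad_path(2)[OF f(1)] that by simp
  obtain P1 P2 where P: "ps = P1 @ r # P2" using split_list[OF t(1)] by blast
  have ne: "P1 \<noteq> []" using a(4) P by (auto simp: hd_append)
  consider "r' = r" | "r' \<in> set P2" | "r' \<in> set P1" using t(4) P by auto
  then show False
  proof cases
    case 1
    then show False using min_bad_single[OF f(1) _ t(3), of t'] t f(13) bd by blast
  next
    case 2
    then obtain Q1 Q2 where Q: "P2 = Q1 @ r' # Q2" using split_list by fast
    have "walk (outside x ?C) r (r # Q1 @ [r']) r'"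
      using sub[of P1 "r # Q1 @ [r']" Q2] P Q by simp
    moreover have "length (r # Q1 @ [r']) < length ps" using P Q ne by (cases P1) auto
    ultimately show False using min_bad_short[OF f(1) _ _ t(3,6)] bd by blast
  next
    case 3
    then obtain Q1 Q2 where Q: "P1 = Q1 @ r' # Q2" using split_list by fast
    have "P2 \<noteq> []" using a(5) P by auto
    then have "length (r' # Q2 @ [r]) < length ps" using P Q by (cases P2) auto
    moreover have "walk (outside x ?C) r' (r' # Q2 @ [r]) r"
      using sub[of Q1 "r' # Q2 @ [r]" P2] P Q by simp
    ultimately show False using min_bad_short[OF f(1) _ _ t(6,3)] bd' by blast
  qed
qed

lemma min_bad_at_ipath:
  assumes s: "min_bad_at x u A w B ps"
  shows "ipath (u # ps @ [w])"
proof -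
  note f = min_bad_at_facts[OF s]
  have n: "set ps \<inter> set (u # A @ w # B) = {}" using f(13) unfolding outside_def by blast
  have "E v w \<Longrightarrow> v \<notin> set (butlast ps)" for v
  proof
    assume v: "E v w" "v \<in> set (butlast ps)"
    then have "v = last ps" using min_bad_at_ends(2)[OF s, of v] by (auto dest: in_set_butlastD)
    moreover have "ps = butlast ps @ [last ps]" using f(11) by simp
    ultimately show False using v(2) ipath_distinct[OF f(12)]
      by (metis distinct_append disjoint_iff list.set_intros(1))
  qed
  then have 1: "ipath (ps @ [w])"
    by (intro ipath_snocI) (use f n in auto)
  have "E u v \<Longrightarrow> v \<notin> set (tl ps)" for v
  proof
    assume v: "E u v" "v \<in> set (tl ps)"
    then have "v \<in> set ps" using f(11) by (cases ps) auto
    then have "v = hd ps" using min_bad_at_ends(1)[OF s, of v] v(1) Esym by blast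
    then show False using v(2) ipath_distinct[OF f(12)] f(11) by (cases ps) auto
  qed
  moreover have "\<not> E u w" "u \<noteq> w" using hole_arcs[OF f(2,7,8)] by blast+
  ultimately show ?thesis
    by (intro ipath_ConsI[OF 1]) (use f n Esym in auto)
qed

text \<open>
  The spider has centre \<open>p\<close>; if the path \<open>P1\<close> is attached to \<open>t\<close>, the leg along it ends in \<open>t\<close>
  instead of \<open>u\<close>.
\<close>

lemma last_spider:
  assumes h: "hole (u # A @ w # B)" and ne: "A \<noteq> []" "B \<noteq> []"
    and P: "ipath (u # P1 @ p # P2 @ [w])" "set (P1 @ p # P2) \<inter> set (u # A @ w # B) = {}"
      "apart (set (P1 @ p # P2)) (set A)"
    and y: "y \<notin> set (u # A @ w # B)" "y \<notin> set (P1 @ p # P2)" "E y p" "apart {y} (set P1 \<union> set P2)"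
      "E y a" "a \<in> set A" "\<forall>v\<in>set (u # A @ w # B). E y v \<longrightarrow> v = a"
    and t: "\<forall>r\<in>set (P1 @ p # P2). \<forall>v\<in>set B. E r v \<longrightarrow> v = t" "\<forall>r\<in>set P2. \<not> E r t"
      "\<not> E (hd (P1 @ [p])) t"
  shows False
proof -
  let ?C = "u # A @ w # B"
  note ha = hole_arcs[OF h ne]
  have d: "distinct (u # P1 @ p # P2 @ [w])" by (rule ipath_distinct[OF P(1)])
  have p: "p \<notin> set ?C" using P(2) by auto
  have py: "E p y" using Esym[OF y(3)] .
  have nA: "\<not> E r v" if "r \<in> set (P1 @ p # P2)" "v \<in> set A" for r v
    using P(3) that unfolding apart_def by blast
  have nw: "\<not> E r w" if "r \<in> set P1 \<or> r = p \<and> P2 \<noteq> []" for r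
  proof -
    obtain z Z where z: "P2 @ [w] = z # Z" by (cases "P2 @ [w]") auto
    have "apart (set (u # P1)) (set (P2 @ [w]))"
      using ipath_gap[of "u # P1" p "P2 @ [w]"] P(1) by simp
    moreover have "apart (set (u # P1 @ [p])) (set Z)"
      using ipath_gap[of "u # P1 @ [p]" z Z] P(1) z by simp
    moreover have "w \<in> set Z" if "P2 \<noteq> []" using that z by (cases P2) auto
    ultimately show ?thesis using that unfolding apart_def by auto
  qed
  have nu: "\<not> E r u" if "r \<in> set P2 \<or> r = p \<and> P1 \<noteq> []" for r
  proof
    assume e: "E r u"
    obtain z Z where z: "P1 @ [p] = z # Z" by (cases "P1 @ [p]") auto
    have "u # P1 @ p # P2 @ [w] = [u] @ z # (Z @ P2 @ [w])" using z by (metis append_Cons append_Nil append_assoc)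
    then have "apart (set [u]) (set (Z @ P2 @ [w]))" using ipath_gap P(1) by metis
    moreover have "p \<in> set Z" if "P1 \<noteq> []" using that z by (cases P1) auto
    ultimately show False using that Esym[OF e] unfolding apart_def by auto
  qed
  have gap: "apart (set P1) (set P2)" using ipath_gap[of "u # P1" p "P2 @ [w]"] P(1)
    by (auto simp: apart_def)
  have Cv: "v = u \<or> v \<in> set A \<or> v = w \<or> v \<in> set B" if "v \<in> set ?C" for v using that by auto
  have l1: "leg ?C p [y] a"
    unfolding leg_def using y py nA[of p a] p by (auto simp: apart_def)
  have l2: "leg ?C p P2 w"
    unfolding leg_def
  proof (intro conjI ballI impI)
    show "ipath (p # P2 @ [w])" using ipath_sub[of "u # P1" "p # P2 @ [w]" "[]"] P(1) by simp
    show "v = w" if "r \<in> set P2" "v \<in> set ?C" "E r v" for r v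
      using Cv[OF that(2)] nA[of r v] nu[of r] t that by auto
  qed (use P in auto)
  have yl: "apart {y} (set P2)" "apart {y} (set P1)" using y(4) by (auto simp: apart_def)
  show False
  proof (cases "\<exists>r\<in>set (P1 @ [p]). \<exists>v\<in>set B. E r v")
    case False
    have l3: "leg ?C p (rev P1) u"
      unfolding leg_def
    proof (intro conjI ballI impI)
      have "ipath (rev (u # P1 @ [p]))"
        using ipath_sub[of "[]" "u # P1 @ [p]" "P2 @ [w]"] P(1) unfolding ipath_rev by simp
      then show "ipath (p # rev P1 @ [u])" by simp
      show "v = u" if "r \<in> set (rev P1)" "v \<in> set ?C" "E r v" for r v
        using Cv[OF that(2)] nA[of r v] nw[of r] False that by auto
    qed (use P in auto)
    show False
    proof (rule spider[OF h p l1 l2 l3])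
      show "distinct [a, w, u]" using ha y(6) by auto
      show "apart (set [y]) (set P2)" "apart (set [y]) (set (rev P1))" using yl by auto
      show "apart (set P2) (set (rev P1))" using gap apart_sym by auto
      show "\<forall>z\<in>set ?C. E p z \<longrightarrow> z \<in> {a, w, u}" using nA[of p] False by auto
    qed
  next
    case True
    obtain r v where rv: "r \<in> set (P1 @ [p])" "v \<in> set B" "E r v" using True by blast
    have "v = t" using t(1) rv by auto
    then have tB: "t \<in> set B" and rt: "\<exists>r\<in>set (P1 @ [p]). E t r" using rv Esym by blast+
    \<comment> \<open>The third leg starts at \<open>p\<close>, goes back to the nearest vertex
      \<open>r\<close> that sees \<open>t\<close>, and ends there. Since the first vertex of the
      path does not see \<open>t\<close>, it is not on this leg, and so the leg does not see
      \<open>u\<close>.\<close>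
    obtain R1 r R2 where R: "P1 @ [p] = R1 @ r # R2" "cn t R2 = 0" "E t r"
      using cn_last[of t "P1 @ [p]"] rt unfolding cn_pos by blast
    have R1: "R1 \<noteq> []" using R t(3) Esym by auto
    have R2: "\<not> E z t" if "z \<in> set R2" for z using R(2) that Esym unfolding cn_0 by blast
    have rt: "E r t" using R(3) Esym by blast
    have ru: "\<not> E z u" if "z \<in> set (r # R2)" for z
    proof
      assume e: "E z u"
      obtain z' Z where z: "R1 = z' # Z" using R1 by (cases R1) auto
      have "u # P1 @ p # P2 @ [w] = u # (P1 @ [p]) @ P2 @ [w]" by simp
      also have "\<dots> = [u] @ z' # (Z @ r # R2 @ P2 @ [w])" unfolding R(1) z by simp
      finally have "apart (set [u]) (set (Z @ r # R2 @ P2 @ [w]))" using ipath_gap P(1) by metis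
      then show False using Esym[OF e] that unfolding apart_def by auto
    qed
    have ta: "a \<noteq> w" "w \<noteq> t" "a \<noteq> t" using y(6) tB ha by (auto simp: apart_def)
    show False
    proof (cases "R2 = []")
      case True
      then have rp: "r = p" "R1 = P1" using R(1) by auto
      show False
      proof (rule spider[OF h p l1 l2 leg_direct])
        show "E p t" using rt rp by simp
        show "distinct [a, w, t]" using ta by simp
        show "apart (set [y]) (set P2)" using yl by simp
        show "\<forall>z\<in>set ?C. E p z \<longrightarrow> z \<in> {a, w, t}" using nA[of p] t(1) ru rp by auto
      qed (use tB p in auto)
    next
      case False
      then obtain S where S: "R2 = S @ [p]" using R(1) by (metis append_butlast_last_id last.simps last_append last_snoc list.distinct(1))
      then have P1: "P1 = R1 @ r # S" using R(1) by simp
      have rw: "E z v \<Longrightarrow> v = t" if "z \<in> set (r # S)" "v \<in> set ?C" for z v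
        using Cv[OF that(2)] nA[of z v] nw[of z] t(1) that P1 ru[of z] S by auto
      have l3: "leg ?C p (rev S @ [r]) t"
        unfolding leg_def
      proof (intro conjI ballI impI)
        have "ipath (rev (r # S @ [p]))"
          using ipath_sub[of "u # R1" "r # S @ [p]" "P2 @ [w]"] P(1) P1 unfolding ipath_rev by simp
        then have i: "ipath (p # rev S @ [r])" by simp
        have "t \<notin> set (P1 @ p # P2)" using P(2) tB by auto
        then have "ipath ((p # rev S @ [r]) @ [t])"
          using i rt R2 S P1 by (intro ipath_snocI[OF i]) (auto simp: butlast_append)
        then show "ipath (p # (rev S @ [r]) @ [t])" by simp
        show "v = t" if "z \<in> set (rev S @ [r])" "v \<in> set ?C" "E z v" for z v
          using rw[of z v] that by auto
      qed (use P P1 tB in auto)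
      show False
      proof (rule spider[OF h p l1 l2 l3])
        show "distinct [a, w, t]" using ta by simp
        show "apart (set [y]) (set P2)" using yl by simp
        show "apart (set [y]) (set (rev S @ [r]))" using yl P1 by (auto simp: apart_def)
        have "apart (set P2) (set P1)" using gap apart_sym by blast
        then show "apart (set P2) (set (rev S @ [r]))" by (rule apart_mono) (auto simp: P1)
        show "\<forall>z\<in>set ?C. E p z \<longrightarrow> z \<in> {a, w, t}" using nA[of p] t(1) ru[of p] S by auto
      qed
    qed
  qed
qed

text \<open>One arc between \<open>a\<close> and \<open>b\<close> runs inside \<open>M\<close>,
  where \<open>x\<close> has no neighbour.\<close>

lemma bad_pair_gap:
  assumes "distinct (N @ M)" "cn x M = 0" "a \<in> set M" "b \<in> set M"
  shows "\<not> bad_pair x (N @ M) a b"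
proof
  assume b: "bad_pair x (N @ M) a b"
  have main: False if M: "M = M1 @ a # M2 @ b # M3" and b: "bad_pair x (N @ M) a b" for a b M1 M2 M3
  proof -
    have "bad_pair x (a # M2 @ b # (M3 @ N @ M1)) a b"
      using bad_pair_swap[of x "N @ M1" "a # M2 @ b # M3" a b] b M by simp
    moreover have "distinct (a # M2 @ b # (M3 @ N @ M1))" using assms(1) M by auto
    ultimately show False using bad_pair_iff[of a M2 b "M3 @ N @ M1" x] assms(2) M by (auto split: if_splits)
  qed
  have "a \<noteq> b" using bad_pair_neq[OF b assms(1)] .
  obtain M1 R where M: "M = M1 @ a # R" using split_list[OF assms(3)] by blast
  show False
  proof (cases "b \<in> set R")
    case True
    then obtain M2 M3 where "R = M2 @ b # M3" using split_list by fast
    then show False using main[of M1 a M2 b M3] b M by simp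
  next
    case False
    then have "b \<in> set M1" using assms(4) M \<open>a \<noteq> b\<close> by auto
    then obtain K L where "M1 = K @ b # L" using split_list by fast
    then show False using main[of K b L a R] bad_pair_sym[OF b] M by simp
  qed
qed

text \<open>Supplies the vertex \<open>t\<close> for \<open>last_spider\<close>. By
  \<open>min_bad_at_arc\<close> the path sees at most one vertex of \<open>B\<close>; if it sees
  none, any vertex that it misses will do, here \<open>a\<close>. A piece \<open>P2\<close> of
  length at most one contains at most the last vertex of the path, which sees only
  \<open>w\<close>.\<close>

lemma min_bad_at_spider:
  assumes s: "min_bad_at x u A w B ps" and ap: "apart (set ps) (set A)" and P: "ps = P1 @ p # P2"
    and y: "y \<notin> set (u # A @ w # B)" "y \<notin> set ps" "E y p" "apart {y} (set P1 \<union> set P2)"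
      "E y a" "a \<in> set A" "\<forall>v\<in>set (u # A @ w # B). E y v \<longrightarrow> v = a"
    and l: "length P2 \<le> 1 \<or> apart (set ps) (set B)"
  shows False
proof -
  note f = min_bad_at_facts[OF s]
  have n: "set (P1 @ p # P2) \<inter> set (u # A @ w # B) = {}" using f(13) P unfolding outside_def by blast
  have ip: "ipath (u # P1 @ p # P2 @ [w])" using min_bad_at_ipath[OF s] P by simp
  have hd: "hd (P1 @ [p]) = hd ps" using P by (cases P1) auto
  have "\<exists>t. (\<forall>r\<in>set ps. \<forall>v\<in>set B. E r v \<longrightarrow> v = t) \<and> (\<forall>r\<in>set P2. \<not> E r t) \<and> \<not> E (hd ps) t"
  proof (cases "apart (set ps) (set B)")
    case True
    then have "(\<forall>r\<in>set ps. \<forall>v\<in>set B. E r v \<longrightarrow> v = a) \<and> (\<forall>r\<in>set ps. \<not> E r a)"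
      using ap y(6) unfolding apart_def by blast
    then show ?thesis using P hd_in_set[OF f(11)] by (intro exI[of _ a]) auto
  next
    case False
    then have l1: "length P2 \<le> 1" using l by blast
    obtain r t where t: "r \<in> set ps" "t \<in> set B" "E r t"
      using False n P unfolding apart_def by auto
    obtain B1 B2 where B: "B = B1 @ t # B2" using split_list[OF t(2)] by blast
    note b = min_bad_at_arc[OF s t(1,3) B]
    have "v = t" if v: "r' \<in> set ps" "v \<in> set B" "E r' v" for r' v
    proof -
      obtain C1 C2 where C: "B = C1 @ v # C2" using split_list[OF v(2)] by blast
      have "E x v" using min_bad_at_arc(3)[OF s v(1,3) C] .
      then show ?thesis using b(1,2) v(2) B unfolding cn_0 by auto
    qed
    moreover have "\<not> E r' t" if "r' \<in> set P2" for r'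
    proof
      assume e: "E r' t"
      have "r' \<in> set ps" "r' = last ps" using that P l1 by (cases P2; auto)+
      then show False using min_bad_at_arc(5)[OF s _ e B] by blast
    qed
    moreover have "\<not> E (hd ps) t" using min_bad_at_arc(4)[OF s _ _ B, of "hd ps"] f(11) by auto
    ultimately show ?thesis by blast
  qed
  then obtain t where t: "\<forall>r\<in>set ps. \<forall>v\<in>set B. E r v \<longrightarrow> v = t" "\<forall>r\<in>set P2. \<not> E r t" "\<not> E (hd ps) t"
    by blast
  show False
    by (rule last_spider[OF f(2,7,8) ip n _ y(1) _ y(3-7) _ t(2)]) (use t ap y(2) P hd in auto)
qed

text \<open>If the path sees \<open>B\<close>, only one spoke ends inside \<open>B\<close>, so at
  least three remain, and three alone are impossible. Otherwise \<open>chord_path\<close>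
  applies.\<close>

lemma min_bad_at_count:
  assumes s: "min_bad_at x u A w B ps" and ap: "apart (set ps) (set A)"
  shows "4 \<le> cn x (u # A @ [w])"
proof -
  note f = min_bad_at_facts[OF s]
  note a = hole_arcs[OF f(2,7,8)]
  have outside: "set ps \<inter> set (u # A @ w # B) = {}" "x \<notin> set ps" "apart {x} (set ps)"
    using f(13) Eirr unfolding outside_def apart_def by blast+
  have ip: "ipath (u # ps @ [w])" by (rule min_bad_at_ipath[OF s])
  show ?thesis
  proof (cases "apart (set ps) (set B)")
    case True
    then show ?thesis
      by (intro chord_path[OF f(2,3) ip f(11) outside _ f(5,6,4)]) (use ap apart_Un in blast)
  next
    case False
    then obtain r t where t: "r \<in> set ps" "t \<in> set B" "E r t"
      using outside unfolding apart_def by auto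
    obtain B1 B2 where B: "B = B1 @ t # B2" using split_list[OF t(2)] by blast
    have "cn x B = 1" using min_bad_at_arc[OF s t(1,3) B] B by simp
    then have "3 \<le> cn x (u # A @ [w])" using f(4) by (auto split: if_splits)
    moreover have "hole (u # A @ w # rev ps)"
      by (rule hole_through[OF a(1) ip f(7,11)]) (use ap apart_sym in blast)
    then have "cn x (u # A @ w # rev ps) \<noteq> 3" using no_three[of "u # A @ w # rev ps" x] f(3) outside(2) by auto
    moreover have "cn x (rev ps) = 0" using outside(3) unfolding apart_def cn_0 by auto
    ultimately show ?thesis by (auto split: if_splits)
  qed
qed

text \<open>
  Replacing the arc \<open>B\<close> by the bad path gives a proper wheel with fewer spokes.
\<close>

lemma min_bad_at_impossible:
  assumes s: "min_bad_at x u A w B ps" and ap: "apart (set ps) (set A)"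
  shows False
proof -
  let ?C = "u # A @ w # B" let ?H = "u # A @ w # rev ps"
  note f = min_bad_at_facts[OF s]
  note m = f(1)
  note a = hole_arcs[OF f(2,7,8)]
  have outside: "set ps \<inter> set ?C = {}" "x \<notin> set ps" "\<forall>r\<in>set ps. \<not> E x r"
    using f(13) unfolding outside_def by blast+
  have ip: "ipath (u # ps @ [w])" by (rule min_bad_at_ipath[OF s])
  have h: "hole ?H" by (rule hole_through[OF a(1) ip f(7,11)]) (use ap apart_sym in blast)
  have d: "distinct ?H" by (rule hole_distinct[OF h])
  have c0: "cn x ps = 0" using outside(3) unfolding cn_0 .
  then have cH: "cn x ?H = cn x (u # A @ [w])" by simp
  have n4: "4 \<le> cn x ?H" using min_bad_at_count[OF s ap] cH by simp
  have xH: "x \<notin> set ?H" using f(3) outside by auto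
  have prH: "proper x ?H"
    unfolding proper_def
  proof (intro conjI ballI)
    fix y assume yo: "y \<in> outside x ?H"
    have yn: "y \<noteq> x" "y \<in> V" "\<not> E x y" "y \<notin> set ?H" using yo unfolding outside_def by blast+
    have nself: "\<not> bad_pair x ?H b b" for b using bad_pair_neq[OF _ d] by blast
    have gap: "\<not> bad_pair x ?H b b'" if "b \<in> set ps" "b' \<in> set ps" for b b'
      using bad_pair_gap[of "u # A @ [w]" "rev ps" x b b'] d c0 that by simp
    have "cn y ?H \<le> 2 \<and> (\<forall>b\<in>set ?H. \<forall>b'\<in>set ?H. E y b \<longrightarrow> E y b' \<longrightarrow> \<not> bad_pair x ?H b b')"
    proof (cases "y \<in> set B")
      case True
      \<comment> \<open>By \<open>min_bad_at_arc\<close>, a vertex of \<open>B\<close> seen by the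
        path is adjacent to \<open>x\<close>, which \<open>y\<close> is not.\<close>
      have "\<not> E y r" if r: "r \<in> set ps" for r
      proof
        assume "E y r"
        obtain B1 B2 where "B = B1 @ y # B2" using split_list[OF True] by blast
        then show False using min_bad_at_arc(3)[OF s r Esym[OF \<open>E y r\<close>]] yn by blast
      qed
      moreover have "\<not> E y v" if "v \<in> set A" for v
        using a(3) True that Esym unfolding apart_def by blast
      ultimately have nb: "E y b \<Longrightarrow> b \<in> set ?H \<Longrightarrow> b = u \<or> b = w" and z: "cn y A = 0" "cn y ps = 0" for b
        unfolding cn_0 by auto
      have "\<not> bad_pair x ?H u w" using bad_pair_iff[OF d, of x] c0 by simp
      moreover from this have "\<not> bad_pair x ?H w u" using bad_pair_sym by blast
      moreover have "cn y ?H \<le> 2" using z by simp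
      ultimately show ?thesis using nb nself by blast
    next
      case False
      then have yC: "y \<in> outside x ?C" using yn unfolding outside_def by auto
      have yC': "y \<notin> set ?C" using False yn by auto
      have yps: "y \<notin> set ps" using yn by auto
      have c2: "cn y ?C \<le> 2" by (rule min_bad_cn[OF m yC])
      have tr: "\<not> bad_pair x ?H b b'" if "E y b" "E y b'" "b \<in> set (u # A @ [w])" "b' \<in> set (u # A @ [w])" for b b'
      proof
        assume "bad_pair x ?H b b'"
        then have "bad_pair x (rev ps @ (u # A @ [w])) b b'"
          using bad_pair_swap[of x "u # A @ [w]" "rev ps" b b'] by simp
        then have "bad_pair x (B @ (u # A @ [w])) b b'"
          by (rule bad_pair_replace[rotated 5]) (use f(15) d that c0 in auto)
        then have "bad_pair x ?C b b'" using bad_pair_swap[of x "u # A @ [w]" B b b'] by simp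
        then show False using min_bad_single[OF m yC that(1,2)] by blast
      qed
      consider "cn y ps = 0" | "cn y ps > 0" "cn y (u # A @ [w]) = 0"
        | "cn y ps > 0" "cn y (u # A @ [w]) > 0" by blast
      then show ?thesis
      proof cases
        case 1
        then have "b \<in> set (u # A @ [w])" if "E y b" "b \<in> set ?H" for b using that unfolding cn_0 by auto
        moreover have "cn y ?H \<le> 2" using 1 c2 by (auto split: if_splits)
        ultimately show ?thesis using tr by blast
      next
        case 2
        then have nb: "b \<in> set ps" if "E y b" "b \<in> set ?H" for b using that unfolding cn_0 by auto
        \<comment> \<open>Going through \<open>y\<close> skips the stretch \<open>M\<close> between
          its first and last neighbour on the path. By minimality \<open>M\<close> is a single
          vertex, hence itself a neighbour of \<open>y\<close>, and two consecutive neighbours close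
          a triangle.\<close>
        have "cn y ps \<le> 2"
        proof (rule ccontr)
          assume c: "\<not> ?thesis"
          obtain P1 b R where P: "ps = P1 @ b # R" "cn y P1 = 0" "E y b" using cn_first[of y ps] 2 by blast
          then have "cn y R \<ge> 2" using c by simp
          then obtain M b' P2 where R: "R = M @ b' # P2" "cn y P2 = 0" "E y b'"
            using cn_last[of y R] by auto
          have M: "cn y M > 0" using \<open>cn y R \<ge> 2\<close> R by simp
          have wk: "walk (outside x ?C) (hd ps) ps (last ps)" by (rule min_bad_path(2)[OF m])
          have "walk (outside x ?C) (hd ps) (P1 @ [b]) b" using walk_prefix wk P(1) by metis
          from walk_append[OF this walk_single[OF yC]] Esym[OF P(3)]
          have 1: "walk (outside x ?C) (hd ps) ((P1 @ [b]) @ [y]) y" by blast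
          have "ps = (P1 @ b # M) @ b' # P2" using P R by simp
          then have "walk (outside x ?C) b' (b' # P2) (last ps)" using walk_suffix wk by metis
          from walk_append[OF 1 this R(3)]
          have "walk (outside x ?C) (hd ps) (((P1 @ [b]) @ [y]) @ b' # P2) (last ps)" .
          then have "\<not> length (((P1 @ [b]) @ [y]) @ b' # P2) < length ps"
            using min_bad_short[OF m _ _ f(9,10)] f(14) by blast
          then have "length M \<le> 1" using P R by simp
          then obtain z where z: "M = [z]" using M by (cases M) auto
          then have "E y z" using M by (auto split: if_splits)
          moreover have "ipath (b # z # b' # P2)"
            using f(12) ipath_sub[of P1 "b # z # b' # P2" "[]"] P(1) R(1) z by simp
          ultimately show False using tri[of y b z] P(3) by simp
        qed
        then have "cn y ?H \<le> 2" using 2 by (simp split: if_splits)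
        then show ?thesis using gap nb by blast
      next
        case 3
        then obtain v where v: "v \<in> set (u # A @ [w])" "E y v" unfolding cn_pos by blast
        \<comment> \<open>Otherwise the spokes of the kept part of the rim are among
          \<open>u\<close>, \<open>v\<close>, \<open>w\<close>, but there are at least four.\<close>
        have vw: "bad_pair x ?C u v \<or> bad_pair x ?C v w"
        proof (rule ccontr)
          assume n: "\<not> ?thesis"
          then have "v \<in> set A" using v f(14) by auto
          then obtain A1 A2 where A: "A = A1 @ v # A2" using split_list by fast
          have "cn x A1 = 0" "cn x A2 = 0"
            using n bad_pair_arcs(1)[OF f(15) A, of x] bad_pair_arcs(3)[OF f(15) A, of x] f(6) by (auto split: if_splits)
          then show False using min_bad_at_count[OF s ap] A by (auto split: if_splits)
        qed
        \<comment> \<open>The path up to \<open>p\<close>, continued by \<open>y\<close>, is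
          attached to the bad pair \<open>u\<close>, \<open>v\<close>. It is not shorter than
          \<open>ps\<close>, so at most one vertex follows \<open>p\<close>; \<open>lenw\<close> is
          the mirror image.\<close>
        have lenu: "length P2 \<le> 1" if bd: "bad_pair x ?C u v" and P: "ps = P1 @ p # P2" "E y p" for P1 p P2
        proof -
          have "walk (outside x ?C) (hd ps) (P1 @ [p]) p" using walk_prefix min_bad_path(2)[OF m] P(1) by metis
          from walk_append[OF this walk_single[OF yC]] Esym[OF P(2)]
          have "walk (outside x ?C) (hd ps) ((P1 @ [p]) @ [y]) y" by blast
          then have "\<not> length ((P1 @ [p]) @ [y]) < length ps"
            using min_bad_short[OF m _ _ f(9) v(2)] bd by blast
          then show ?thesis using P by simp
        qed
        have lenw: "length P1 \<le> 1" if bd: "bad_pair x ?C v w" and P: "ps = P1 @ p # P2" "E y p" for P1 p P2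
        proof -
          have "walk (outside x ?C) p (p # P2) (last ps)" using walk_suffix min_bad_path(2)[OF m] P(1) by metis
          from walk_append[OF walk_single[OF yC] this P(2)]
          have "walk (outside x ?C) y ([y] @ p # P2) (last ps)" .
          then have "\<not> length ([y] @ p # P2) < length ps"
            using min_bad_short[OF m _ _ v(2) f(10)] bd by blast
          then show ?thesis using P by simp
        qed
        obtain P1 p P2 where P: "ps = P1 @ p # P2" "cn y P1 = 0" "E y p" using cn_first[of y ps] 3 by blast
        \<comment> \<open>By the length bounds, two neighbours of \<open>y\<close> on the path would
          be consecutive and close a triangle.\<close>
        have P2: "cn y P2 = 0"
        proof (rule ccontr)
          assume "cn y P2 \<noteq> 0"
          then obtain M p' Q where M: "P2 = M @ p' # Q" "E y p'" using cn_first[of y P2] by auto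
          have "M = []"
            using vw lenu[OF _ P(1,3)] lenw[OF _ _ M(2), of "P1 @ p # M" Q] P(1) M(1) by auto
          then have "ipath (p # p' # Q)" using f(12) ipath_sub[of P1 "p # p' # Q" "[]"] P(1) M(1) by simp
          then show False using tri[of y p p'] P(3) M(2) by simp
        qed
        have cp: "cn y ps = 1" using P P2 by simp
        have "cn y ?H \<noteq> 3" using no_three[OF h yn(4)] by blast
        then have c1: "cn y (u # A @ [w]) = 1" using 3 c2 cp by (auto split: if_splits)
        obtain v' where v': "\<forall>z\<in>set (u # A @ [w]). E y z \<longrightarrow> z = v'" using cn_one[OF c1] by blast
        then have uv: "z = v" if "z \<in> set (u # A @ [w])" "E y z" for z using v that by metis
        have up: "z = p" if "z \<in> set ps" "E y z" for z using that P P2 unfolding cn_0 by auto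
        have pv: "\<not> bad_pair x ?H v p"
        proof
          assume bd: "bad_pair x ?H v p"
          have rp: "rev ps = rev P2 @ p # rev P1" by (simp add: P)
          have cP: "cn x P1 = 0" "cn x P2 = 0" "\<not> E x p" using c0 P(1) by (auto split: if_splits)
          have "v \<noteq> u" using bad_pair_arcs(2)[OF d rp, of x] bd cP by auto
          moreover have "v \<noteq> w" using bad_pair_arcs(4)[OF d rp, of x] bd cP by auto
          ultimately have vA: "v \<in> set A" using v by auto
          then obtain A1 A2 where A: "A = A1 @ v # A2" using split_list by fast
          have st: "cn x (A2 @ [w]) > 0" "cn x (u # A1) > 0"
            using bad_pair_arcs(5)[OF d A rp, of x] bd cP by (auto split: if_splits)
          \<comment> \<open>The single vertex \<open>y\<close> would be attached to \<open>v\<close>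
            and \<open>b\<close>, a bad pair of the old rim.\<close>
          have nB: "\<not> E y b" if b: "b \<in> set B" for b
          proof
            assume e: "E y b"
            obtain B1 B2 where B: "B = B1 @ b # B2" using split_list[OF b] by blast
            have "bad_pair x ?C v b" using bad_pair_arcs(5)[OF f(15) A B, of x] st by auto
            then show False using min_bad_single[OF m yC v(2) e] by blast
          qed
          have y1: "\<forall>z\<in>set ?C. E y z \<longrightarrow> z = v" using uv nB by auto
          have y2: "apart {y} (set P1 \<union> set P2)"
            using P P2 yps unfolding cn_0 apart_def by auto
          show False
          \<comment> \<open>The spider has centre \<open>p\<close>. The path is read from the end
            for which \<open>lenu\<close> or \<open>lenw\<close> bounds the piece after
            \<open>p\<close>.\<close>
          proof (cases "bad_pair x ?C u v")
            case True
            show False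
              by (rule min_bad_at_spider[OF s ap P(1) yC' yps P(3) y2 v(2) vA y1]) (use lenu[OF True P(1,3)] in blast)
          next
            case False
            then have bd': "bad_pair x ?C v w" using vw by blast
            have sr: "min_bad_at x w (rev A) u (rev B) (rev ps)" by (rule min_bad_at_rev[OF s])
            show False
            proof (rule min_bad_at_spider[OF sr _ rp])
              show "length (rev P1) \<le> 1 \<or> apart (set (rev ps)) (set (rev B))"
                using lenw[OF bd' P(1,3)] by simp
              show "apart {y} (set (rev P2) \<union> set (rev P1))" using y2 by (simp add: Un_commute)
              show "\<forall>z\<in>set (w # rev A @ u # rev B). E y z \<longrightarrow> z = v" using y1 by auto
              show "y \<notin> set (w # rev A @ u # rev B)" using yC' by auto
            qed (use ap yps P(3) v(2) vA in auto)
          qed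
        qed
        then have pv': "\<not> bad_pair x ?H p v" using bad_pair_sym by blast
        have "b = v \<or> b = p" if "E y b" "b \<in> set ?H" for b using uv[of b] up[of b] that by auto
        moreover have "cn y ?H \<le> 2" using c1 cp by (auto split: if_splits)
        ultimately show ?thesis using pv pv' nself by blast
      qed
    qed
    then show "cn y ?H \<le> 2" "\<And>b b'. b \<in> set ?H \<Longrightarrow> b' \<in> set ?H \<Longrightarrow> E y b \<longrightarrow> E y b' \<longrightarrow> \<not> bad_pair x ?H b b'"
      by blast+
  qed (use h xH n4 in auto)
  then have "cn x ?C \<le> cn x ?H" using m unfolding min_bad_def by blast
  then show False using cH f(6) by (auto split: if_splits)
qed

lemma ex_no_bad_path:
  assumes "proper x C0"
  shows "\<exists>C. proper x C \<and> (\<forall>ps. \<not> bad_path x C ps)"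
proof (rule ccontr)
  assume n: "\<not> ?thesis"
  have "\<exists>C. proper x C \<and> (\<forall>C'. proper x C' \<longrightarrow> cn x C \<le> cn x C')"
    by (rule ex_has_least_nat[of "proper x"]) (rule assms)
  then obtain C1 where C1: "proper x C1" "\<forall>C'. proper x C' \<longrightarrow> cn x C1 \<le> cn x C'" by blast
  define Q where "Q X \<longleftrightarrow> proper x (fst X) \<and> cn x (fst X) = cn x C1 \<and> bad_path x (fst X) (snd X)" for X
  obtain ps1 where "bad_path x C1 ps1" using n C1 by blast
  then have "Q (C1, ps1)" unfolding Q_def using C1 by simp
  then have "\<exists>X. Q X \<and> (\<forall>Y. Q Y \<longrightarrow> length (snd X) \<le> length (snd Y))"
    by (rule ex_has_least_nat)
  then obtain C ps where C: "Q (C, ps)" "\<forall>Y. Q Y \<longrightarrow> length ps \<le> length (snd Y)" by auto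
  have "length ps \<le> length ps'" if "proper x C'" "cn x C' = cn x C" "bad_path x C' ps'" for C' ps'
    using C(2)[rule_format, of "(C', ps')"] that C(1) unfolding Q_def by simp
  then have "min_bad x C ps" unfolding min_bad_def using C(1) C1(2) unfolding Q_def by simp
  then obtain u A w B where s: "min_bad_at x u A w B ps" using min_bad_at_exists by blast
  then show False using min_bad_at_one_side[OF s] min_bad_at_impossible[OF s] min_bad_at_impossible[OF min_bad_at_flip[OF s]]
    by auto
qed

end

section \<open>Wheel decomposition\<close>

lemma filter_eq_append_split:
  "filter P xs = X @ Y \<Longrightarrow> \<exists>xs1 xs2. xs = xs1 @ xs2 \<and> filter P xs1 = X \<and> filter P xs2 = Y"
proof (induction X arbitrary: xs)
  case Nil
  then have "xs = [] @ xs \<and> filter P [] = [] \<and> filter P xs = Y" by simp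
  then show ?case by blast
next
  case (Cons x X)
  then obtain us vs where us: "xs = us @ x # vs" "\<forall>u\<in>set us. \<not> P u" "P x" "filter P vs = X @ Y"
    using filter_eq_ConsD[of P xs x "X @ Y"] by auto
  obtain xs1 xs2 where "vs = xs1 @ xs2" "filter P xs1 = X" "filter P xs2 = Y"
    using Cons.IH[OF us(4)] by blast
  then have "xs = (us @ x # xs1) @ xs2" "filter P (us @ x # xs1) = x # X" "filter P xs2 = Y"
    using us by simp_all
  then show ?case by blast
qed

lemma filter_ConsD:
  "filter P xs = y # ys \<Longrightarrow> \<exists>us vs. xs = us @ y # vs \<and> (\<forall>u\<in>set us. \<not> P u) \<and> filter P vs = ys"
  using filter_eq_ConsD[of P xs y ys] by metis

text \<open>Turns the index arithmetic of the neighbour list into a rotation of the rim that starts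
  at the sector.\<close>

lemma filter_cyclic_consecutive:
  assumes "i < length (filter P xs)" "2 \<le> length (filter P xs)"
  shows "\<exists>k A B. rotate k xs = filter P xs ! i # A @ filter P xs ! (Suc i mod length (filter P xs)) # B
    \<and> (\<forall>z\<in>set A. \<not> P z)"
proof -
  define fs where "fs = filter P xs"
  define u where "u = fs ! i"
  define v where "v = fs ! (Suc i mod length fs)"
  have i: "i < length fs" and two: "2 \<le> length fs" using assms by (simp_all add: fs_def)
  have "filter P xs = take i fs @ (u # drop (Suc i) fs)"
    using id_take_nth_drop[OF i] by (simp add: u_def fs_def[symmetric])
  then obtain D1 D where D: "xs = D1 @ D" "filter P D1 = take i fs" "filter P D = u # drop (Suc i) fs"
    using filter_eq_append_split by blast
  obtain N D2 where N: "D = N @ u # D2" "\<forall>z\<in>set N. \<not> P z" "filter P D2 = drop (Suc i) fs"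
    using filter_ConsD[OF D(3)] by (elim exE conjE) (rule that; assumption)
  have rot: "rotate (length (D1 @ N)) xs = u # D2 @ D1 @ N"
    using rotate_append[of "D1 @ N" "u # D2"] D(1) N(1) by simp
  have "\<exists>k A B. rotate k xs = u # A @ v # B \<and> (\<forall>z\<in>set A. \<not> P z)"
  proof (cases "Suc i < length fs")
    case True
    then have "filter P D2 = v # drop (Suc (Suc i)) fs" using N(3) Cons_nth_drop_Suc[OF True] True by (simp add: v_def)
    from filter_ConsD[OF this] obtain A R where "D2 = A @ v # R" "\<forall>z\<in>set A. \<not> P z"
      by (elim exE conjE) (rule that; assumption)
    then have "rotate (length (D1 @ N)) xs = u # A @ v # (R @ D1 @ N) \<and> (\<forall>z\<in>set A. \<not> P z)"
      using rot by simp
    then show ?thesis by blast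
  next
    case False
    then have e: "Suc i = length fs" using i by simp
    then have "filter P D2 = []" using N(3) by simp
    then have D2: "\<forall>z\<in>set D2. \<not> P z" by (simp add: filter_empty_conv)
    \<comment> \<open>Wrap-around: the successor of the last marked entry is the first one, which
      lies in the front part \<open>D1\<close>. With at least two entries it is not \<open>u\<close>
      itself.\<close>
    have "v = fs ! 0" using e by (simp add: v_def)
    moreover obtain g gs where g: "fs = g # gs" using two by (cases fs) auto
    moreover obtain i' where "i = Suc i'" using e two by (cases i) auto
    ultimately have "filter P D1 = v # take i' gs" using D(2) by simp
    from filter_ConsD[OF this] obtain A R where A: "D1 = A @ v # R" "\<forall>z\<in>set A. \<not> P z"
      by (elim exE conjE) (rule that; assumption)
    have "rotate (length (D1 @ N)) xs = u # (D2 @ A) @ v # (R @ N) \<and> (\<forall>z\<in>set (D2 @ A). \<not> P z)"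
      using rot A D2 by auto
    then show ?thesis by blast
  qed
  then show ?thesis by (simp only: u_def v_def fs_def)
qed

lemma rotate1_zip: "length xs = length ys \<Longrightarrow> rotate1 (zip xs ys) = zip (rotate1 xs) (rotate1 ys)"
  by (cases xs; cases ys) auto

text \<open>Zipping a cyclic vertex list with its rotation gives the arcs of the cycle, so rotating
  the arcs is rotating the vertices.\<close>

lemma rotate_zip_rotate1: "rotate k (zip xs (rotate1 xs)) = zip (rotate k xs) (rotate1 (rotate k xs))"
proof (induction k)
  case (Suc k)
  then show ?case by (simp add: rotate1_zip)
qed simp

lemma pcas_zip: "pcas u (zip (u # A) (A @ [v])) v"
  by (induction A arbitrary: u) auto

lemma pawalk_verts_zip: "pawalk_verts u (zip (u # A) (A @ [v])) = u # A @ [v]"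
  by (induction A arbitrary: u) auto

lemma zip_arcs: "successively (\<lambda>x y. (x, y) \<in> R) (u # A @ [v]) \<Longrightarrow> set (zip (u # A) (A @ [v])) \<subseteq> R"
  by (induction A arbitrary: u) auto

lemma pe_zip: "(a, b) \<in> pe (u # A @ [v]) \<Longrightarrow>
  (a, b) \<in> set (zip (u # A) (A @ [v])) \<or> (b, a) \<in> set (zip (u # A) (A @ [v]))"
  by (induction A arbitrary: u) auto

context triangle_ISK4_free_graph
begin

text \<open>A walk from \<open>A\<close> to \<open>B\<close> that avoids \<open>Q\<close> contains a
  bad path: the ends of the sector are spokes, so a vertex of \<open>A\<close> and a vertex of
  \<open>B\<close> always form a bad pair.\<close>

lemma sector_cut:
  assumes h: "hole (u # A @ v # B)" and x: "x \<notin> set (u # A @ v # B)" "E x u" "E x v" "cn x A = 0"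
    and n: "\<And>ps. \<not> bad_path x (u # A @ v # B) ps"
    and Q: "Q = {z. E x z \<or> z = x} - set (u # A @ v # B) \<union> {u, v}"
    and ab: "a \<in> set A" "b \<in> set B"
  shows "\<not> conn (V - Q) a b"
proof
  let ?C = "u # A @ v # B"
  assume "conn (V - Q) a b"
  then obtain xs where xs: "walk (V - Q) a xs b" unfolding conn_def by blast
  have "A \<noteq> []" "B \<noteq> []" using ab by auto
  note ha = hole_arcs[OF h this]
  have "a \<in> set xs" "b \<in> set xs" using xs unfolding walk_def by (auto intro: hd_in_set last_in_set)
  \<comment> \<open>The inner vertices of a shortest stretch from \<open>A\<close> to
    \<open>B\<close> avoid both arcs, and \<open>u\<close>, \<open>v\<close> belong to
    \<open>Q\<close>; so they are off the rim.\<close>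
  then obtain p l q where l: "xs = p @ l @ q \<or> xs = p @ rev l @ q" "l \<noteq> []" "hd l \<in> set A" "last l \<in> set B"
    "\<forall>z\<in>set (tl l). z \<notin> set A" "\<forall>z\<in>set (butlast l). z \<notin> set B"
    using two_colour_sublist[of xs "\<lambda>z. z \<in> set A" "\<lambda>z. z \<in> set B"] ab by blast
  have AB: "hd l \<noteq> last l" "\<not> E (hd l) (last l)" using l(3,4) ha(3) unfolding apart_iff by auto
  then obtain M where M: "l = hd l # M @ [last l]"
    using l(2) by (cases l; cases "tl l" rule: rev_cases) auto
  define a' b' where "a' = hd l" and "b' = last l"
  have lM: "l = a' # M @ [b']" using M unfolding a'_def b'_def .
  have a'b': "a' \<in> set A" "b' \<in> set B" using l(3,4) unfolding a'_def b'_def .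
  have "successively E l" "set l \<subseteq> V - Q"
    using xs l(1) wk_rev[of l] unfolding walk_def by (auto simp: successively_append_iff)
  then have w: "successively E (a' # M @ [b'])" "set M \<subseteq> V - Q" using lM by auto
  have ne: "M \<noteq> []" using w AB(2) unfolding a'_def b'_def by auto
  have "z \<notin> set A" "z \<notin> set B" if "z \<in> set M" for z using l(5,6) that lM by (auto simp: butlast_append)
  then have Mo: "set M \<subseteq> outside x ?C" using w(2) Q unfolding outside_def by auto
  have e: "E (hd M) a'" "E (last M) b'" "successively E M"
    using w(1) ne Esym by (auto simp: successively_Cons successively_append_iff)
  obtain A1 A2 where A: "A = A1 @ a' # A2" using split_list[OF a'b'(1)] by blast
  obtain B1 B2 where B: "B = B1 @ b' # B2" using split_list[OF a'b'(2)] by blast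
  have "bad_pair x ?C a' b'" using bad_pair_arcs(5)[OF hole_distinct[OF h] A B, of x] x by simp
  moreover have "walk (outside x ?C) (hd M) M (last M)" unfolding walk_def using ne Mo e by simp
  ultimately have "bad_path x ?C M" unfolding bad_path_def using e by blast
  then show False using n by blast
qed

lemma conn_rtrancl_on:
  assumes "(u, v) \<in> rtrancl_on F R" "\<And>a b. (a, b) \<in> R \<Longrightarrow> E a b"
  shows "conn F u v"
  using assms(1)
proof (induction rule: rtrancl_on_induct)
  case base
  then show ?case unfolding conn_def using walk_single by blast
next
  case (step y z)
  then obtain ys where "walk F u ys y" unfolding conn_def by blast
  from walk_append[OF this walk_single[OF \<open>z \<in> F\<close>] assms(2)[OF step(2)]]
  show ?case unfolding conn_def by blast
qed

end

section \<open>Transfer to digraphs\<close>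

locale triangle_ISK4_free_pair_graph =
  fixes G :: "'a pair_pre_digraph"
  assumes pg: "pair_graph G" and tf: "triangle_free G" and kf: "ISK4_free G"
begin

abbreviation adj :: "'a \<Rightarrow> 'a \<Rightarrow> bool" where "adj u v \<equiv> (u, v) \<in> parcs G"

lemma sgraph_adj: "sgraph (pverts G) adj"
proof -
  interpret pair_graph G by (rule pg)
  show ?thesis
  proof
    show "finite (pverts G)" by (rule pair_finite_verts)
    show "adj u v \<Longrightarrow> u \<in> pverts G" for u v using arc_fst_in_verts by fastforce
    show "adj u v \<Longrightarrow> adj v u" for u v by (rule arcs_symmetric)
    show "\<not> adj u u" for u using pair_no_loops by fastforce
  qed
qed

sublocale triangle_ISK4_free_graph "pverts G" adj
proof -
  interpret S: sgraph "pverts G" adj by (rule sgraph_adj)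
  interpret pair_graph G by (rule pg)
  show "triangle_ISK4_free_graph (pverts G) adj"
  proof
    show "\<not> adj a c" if e: "adj a b" "adj b c" for a b c
    proof
      assume ac: "adj a c"
      define H where "H = \<lparr>pverts = {a, b, c}, parcs = {(u, v) \<in> parcs G. u \<in> {a, b, c} \<and> v \<in> {a, b, c}}\<rparr>"
      have d: "a \<noteq> b" "b \<noteq> c" "a \<noteq> c" using e ac S.Eirr by blast+
      have "complete_digraph 3 (with_proj H)"
        unfolding complete_digraph_pair_def H_def using d e ac S.Esym S.Eirr by auto
      moreover have "wf_digraph (with_proj H)" by unfold_locales (auto simp: H_def)
      then have "induced_subgraph (with_proj H) (with_proj G)"
        using wf_digraph e S.EV S.Esym by (auto simp: induced_subgraph_def subgraph_def H_def compatible_def)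
      ultimately show False using tf unfolding triangle_free_def by blast
    qed
    fix a b c d :: 'a and ab ac ad bc bd cd :: "'a list"
    let ?W = "set (a # b # c # d # ab @ ac @ ad @ bc @ bd @ cd)"
    let ?P = "pe (a # ab @ [b]) \<union> pe (a # ac @ [c]) \<union> pe (a # ad @ [d])
      \<union> pe (b # bc @ [c]) \<union> pe (b # bd @ [d]) \<union> pe (c # cd @ [d])"
    assume m: "K4m adj a b c d ab ac ad bc bd cd"
    show "\<exists>u v. adj u v \<and> u \<in> ?W \<and> v \<in> ?W \<and> (u, v) \<notin> ?P"
    proof (rule ccontr)
      \<comment> \<open>Without a chord the vertices of the subdivision would induce an
        ISK4.\<close>
      assume n: "\<not> ?thesis"
      have V: "set (p # l @ [q]) \<subseteq> pverts G" if "successively adj (p # l @ [q])" for p l q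
        using that
      proof (induction l arbitrary: p)
        case Nil
        then show ?case using S.EV S.Esym by auto
      next
        case (Cons z l)
        then have "adj p z" "set (z # l @ [q]) \<subseteq> pverts G" by auto
        then show ?case using S.EV by auto
      qed
      note k = K4mD[OF m]
      have "?W \<subseteq> pverts G" using k(2-7)[THEN V] by auto
      moreover have "?P \<subseteq> {(u, v) \<in> parcs G. u \<in> ?W \<and> v \<in> ?W}"
      proof
        fix e assume e: "e \<in> ?P"
        obtain s t where st: "e = (s, t)" by (cases e)
        have 1: "adj s t" if "successively adj xs" "(s, t) \<in> pe xs" for xs using that S.wk_pe by blast
        have 2: "s \<in> X \<and> t \<in> X" if "(s, t) \<in> pe (p # l @ [q])" "set (p # l @ [q]) \<subseteq> X" for p l q X
          using pe_subset[OF that(1)] that(2) by blast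
        have "adj s t" using e st 1[OF k(2)] 1[OF k(3)] 1[OF k(4)] 1[OF k(5)] 1[OF k(6)] 1[OF k(7)] by blast
        moreover have "s \<in> ?W \<and> t \<in> ?W"
          using e unfolding st by (elim UnE) (erule 2, force)+
        ultimately show "e \<in> {(u, v) \<in> parcs G. u \<in> ?W \<and> v \<in> ?W}" using st by blast
      qed
      ultimately have "\<not> ISK4_free G"
        using n by (intro not_ISK4_free[OF pg m refl]) blast+
      then show False using kf by blast
    qed
  qed
qed

lemma reachable_conn:
  assumes "a \<rightarrow>\<^sup>*\<^bsub>delete_verts G Q\<^esub> b"
  shows "conn (pverts G - Q) a b"
proof (rule conn_rtrancl_on)
  show "(a, b) \<in> rtrancl_on (pverts G - Q) (arcs_ends (delete_verts G Q))"
    using assms unfolding reachable_def by (simp add: delete_verts_def)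
  show "adj u v" if "(u, v) \<in> arcs_ends (delete_verts G Q)" for u v
    using that by (auto simp: delete_verts_def arcs_ends_conv)
qed

text \<open>Connectedness is strong connectedness of the symmetric closure, which adds no adjacency
  because the graph is symmetric.\<close>

lemma connected_conn:
  assumes "connected (delete_verts G Q)" "a \<in> pverts G - Q" "b \<in> pverts G - Q"
  shows "conn (pverts G - Q) a b"
proof (rule conn_rtrancl_on)
  have "a \<rightarrow>\<^sup>*\<^bsub>mk_symmetric (delete_verts G Q)\<^esub> b"
    using assms unfolding connected_def strongly_connected_def by (auto simp: delete_verts_def)
  then show "(a, b) \<in> rtrancl_on (pverts G - Q) (parcs (mk_symmetric (delete_verts G Q)))"
    unfolding reachable_def by (simp add: delete_verts_def)
  show "adj u v" if "(u, v) \<in> parcs (mk_symmetric (delete_verts G Q))" for u v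
    using that Esym by (auto simp: parcs_mk_symmetric delete_verts_def)
qed

lemma cutsetI:
  assumes "Q \<subseteq> pverts G" "a \<in> pverts G - Q" "b \<in> pverts G - Q" "\<not> conn (pverts G - Q) a b"
  shows "cutset G Q"
  using assms connected_conn unfolding cutset_def by blast

lemma wheel_decompositionI:
  assumes h: "hole C" and x: "x \<notin> set C" "3 \<le> cn x C" and n: "\<And>ps. \<not> bad_path x C ps"
  shows "wheel_decomposition G"
proof -
  define p where "p = zip C (rotate1 C)"
  obtain u0 D where C: "C = u0 # D" using h by (cases C) auto
  have p': "p = zip (u0 # D) (D @ [u0])" by (simp add: p_def C)
  have mp: "map fst p = C" by (simp add: p_def)
  have hn: "hole_nbrs G p x = filter (adj x) C" unfolding hole_nbrs_def mp nbhd_def by simp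
  have wk: "successively adj (u0 # D @ [u0])" using hole_wk h C by simp
  have "Ex (adj x)" using x(2) cn_pos[of x C] by auto
  then have xV: "x \<in> pverts G" using EV by blast
  have CV: "set C \<subseteq> pverts G"
  proof
    fix z assume "z \<in> set C"
    then obtain s r where "u0 # D = s @ z # r" using C split_list by metis
    then have "successively adj (s @ z # r @ [u0])" using wk by (metis append.assoc append_Cons)
    then obtain z' where "adj z z'" by (cases r) (auto simp: successively_append_iff)
    then show "z \<in> pverts G" by (rule EV)
  qed
  have "Defs.hole G p"
    unfolding Defs.hole_def mp
  proof (intro conjI ballI impI)
    have "pre_digraph.awalk (with_proj G) u0 p u0"
      unfolding pre_digraph.awalk_def cas_with_proj_eq p' using pcas_zip zip_arcs[OF wk] CV C by simp
    moreover have "distinct (tl (pre_digraph.awalk_verts (with_proj G) u0 p))"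
      unfolding awalk_verts_with_proj_eq p' pawalk_verts_zip using hole_distinct[OF h] C by simp
    moreover have "p \<noteq> []" by (simp add: p' zip_eq_Nil_iff)
    ultimately show "pre_digraph.cycle (with_proj G) p" unfolding pre_digraph.cycle_def by blast
    show "4 \<le> length p" using hole_length[OF h] by (simp add: p_def)
    show "(u, v) \<in> set p \<or> (v, u) \<in> set p" if "u \<in> set C" "v \<in> set C" "adj u v" for u v
      unfolding p' by (rule pe_zip, rule hole_adj) (use h that C in auto)
  qed
  then have wheel: "wheel G p x" unfolding wheel_def mp hn using xV x by (simp add: cn_def)
  \<comment> \<open>Each sector is treated on a rotation of the rim that starts at its first end,
    where \<open>sector_cut\<close> applies.\<close>
  have sec: "\<exists>q. sector G p x u q v \<and>
      (let S = set (pre_digraph.awalk_verts (with_proj G) u q) in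
        cutset G ((closed_nbhd G x - set C) \<union> {u, v}) \<and>
        separates G ((closed_nbhd G x - set C) \<union> {u, v}) S (set C - S))"
    if rot: "rotate k C = u # A @ v # B" "\<forall>z\<in>set A. \<not> adj x z" "adj x u" "adj x v" for k u v A B
  proof -
    let ?C = "u # A @ v # B"
    define Q where "Q = (closed_nbhd G x - set C) \<union> {u, v}"
    let ?q = "zip (u # A) (A @ [v])"
    have sC: "set C = set ?C" using rot(1) set_rotate by metis
    have hC: "hole ?C" using h hole_rotate[of k C] rot(1) by simp
    have nC: "\<not> bad_path x ?C ps" for ps using n[of ps] bad_path_rotate[of x k C ps] rot(1) by simp
    have cC: "cn x ?C = cn x C" using rot(1) cn_rotate by metis
    have d: "distinct ?C" by (rule hole_distinct[OF hC])
    have cA: "cn x A = 0" using rot(2) unfolding cn_0 .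
    have An: "A \<noteq> []"
    proof
      assume "A = []"
      then have "adj u v" using hole_wk[of u "v # B"] hC by simp
      then show False using tri rot(3,4) by blast
    qed
    have "cn x B > 0" using cC x(2) cA by (auto split: if_splits)
    then have Bn: "B \<noteq> []" by auto
    have wq: "successively adj (u # A @ [v])"
      using hole_arcs(1)[OF hC An Bn] ipath_wk by blast
    have S: "pre_digraph.awalk_verts (with_proj G) u ?q = u # A @ [v]"
      unfolding awalk_verts_with_proj_eq by (rule pawalk_verts_zip)
    have "sector G p x u ?q v"
      unfolding sector_def
    proof (intro conjI)
      show "pre_digraph.apath (with_proj G) u ?q v"
        unfolding pre_digraph.apath_def pre_digraph.awalk_def cas_with_proj_eq S
        using pcas_zip zip_arcs[OF wq] CV sC d by auto
      have "rotate k p = zip ?C (A @ v # B @ [u])"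
        unfolding p_def rotate_zip_rotate1 rot(1) by simp
      also have "\<dots> = ?q @ zip (v # B) (B @ [u])"
        using zip_append[of "u # A" "A @ [v]" "v # B" "B @ [u]"] by simp
      finally show "\<exists>k r. rotate k p = ?q @ r" by blast
      have "pre_digraph.inner_verts (with_proj G) ?q = A"
        unfolding inner_verts_with_proj_def by (simp add: map_fst_zip)
      then show "set (pre_digraph.inner_verts (with_proj G) ?q) \<inter> nbhd G x = {}"
        using rot(2) unfolding nbhd_def by auto
    qed
    moreover have QA: "Q = {z. adj x z \<or> z = x} - set ?C \<union> {u, v}"
      unfolding Q_def closed_nbhd_def nbhd_def sC by auto
    have AQ: "z \<notin> Q" if "z \<in> set A \<union> set B" for z using that QA d by auto
    have QV: "Q \<subseteq> pverts G" using QA EV Esym xV rot(3,4) by auto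
    have nc: "\<not> conn (pverts G - Q) a b" if "a \<in> set A" "b \<in> set B" for a b
      by (rule sector_cut[OF hC _ rot(3,4) cA nC QA that]) (use x sC in simp)
    obtain a b where ab: "a \<in> set A" "b \<in> set B" using An Bn by (meson list.set_sel(1))
    have "cutset G Q"
      by (rule cutsetI[OF QV _ _ nc[OF ab]]) (use ab AQ CV sC in auto)
    moreover have "separates G Q (set (u # A @ [v])) (set C - set (u # A @ [v]))"
      unfolding separates_def
    proof (intro conjI ballI notI)
      have "a \<in> set (u # A @ [v]) - Q" using ab AQ by auto
      then show "set (u # A @ [v]) - Q = {} \<Longrightarrow> False" by blast
      have "b \<in> set C - set (u # A @ [v]) - Q" using ab AQ d sC by auto
      then show "set C - set (u # A @ [v]) - Q = {} \<Longrightarrow> False" by blast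
      fix a' b' assume a': "a' \<in> set (u # A @ [v]) - Q" and b': "b' \<in> set C - set (u # A @ [v]) - Q"
        and r: "a' \<rightarrow>\<^sup>*\<^bsub>delete_verts G Q\<^esub> b'"
      have "a' \<in> set A" "b' \<in> set B" using a' b' QA sC by auto
      then show False using nc reachable_conn[OF r] by blast
    qed
    ultimately show ?thesis unfolding Q_def S[symmetric] Let_def by blast
  qed
  have "let xs = hole_nbrs G p x; n = length xs; VH = set (map fst p) in
      \<forall>i<n. let u = xs ! i; v = xs ! (Suc i mod n); Q = (closed_nbhd G x - VH) \<union> {u, v} in
        \<exists>q. sector G p x u q v \<and>
          (let S = set (pre_digraph.awalk_verts (with_proj G) u q) in
            cutset G Q \<and> separates G Q S (VH - S))"
    unfolding Let_def mp hn
  proof (intro allI impI)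
    let ?xs = "filter (adj x) C"
    fix i assume i: "i < length ?xs"
    have l: "2 \<le> length ?xs" using x(2) unfolding cn_def by simp
    obtain k A B where k: "rotate k C = ?xs ! i # A @ ?xs ! (Suc i mod length ?xs) # B"
      "\<forall>z\<in>set A. \<not> adj x z" using filter_cyclic_consecutive[OF i l] by blast
    have "Suc i mod length ?xs < length ?xs" by (rule mod_less_divisor) (use i in linarith)
    then have "?xs ! i \<in> set ?xs" "?xs ! (Suc i mod length ?xs) \<in> set ?xs" using i nth_mem by blast+
    then have "adj x (?xs ! i)" "adj x (?xs ! (Suc i mod length ?xs))" by auto
    from sec[OF k this] show "\<exists>q. sector G p x (?xs ! i) q (?xs ! (Suc i mod length ?xs)) \<and>
        cutset G (closed_nbhd G x - set C \<union> {?xs ! i, ?xs ! (Suc i mod length ?xs)}) \<and>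
        separates G (closed_nbhd G x - set C \<union> {?xs ! i, ?xs ! (Suc i mod length ?xs)})
          (set (pre_digraph.awalk_verts (with_proj G) (?xs ! i) q))
          (set C - set (pre_digraph.awalk_verts (with_proj G) (?xs ! i) q))"
      unfolding Let_def .
  qed
  then show ?thesis unfolding wheel_decomposition_def using wheel by blast
qed

lemma decomposition:
  "series_parallel G \<or> complete_bipartite G \<or>
    (\<exists>C. clique G C \<and> cutset G C \<and> card C \<le> 2) \<or> wheel_decomposition G"
proof (cases "series_parallel G")
  case False
  then obtain T L where "K4f adj T L" using not_series_parallel_K4f by blast
  from K4f_wheel_or_K33[OF this] show ?thesis
  proof (elim disjE exE conjE)
    fix C x
    assume "hole C" "x \<notin> set C" "3 \<le> cn x C"
    then obtain C' y where "proper y C'" using ex_proper by blast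
    then obtain D where D: "proper y D" "\<forall>ps. \<not> bad_path y D ps" using ex_no_bad_path by blast
    have "wheel_decomposition G"
      by (rule wheel_decompositionI[of D y]) (use D in \<open>auto simp: proper_def\<close>)
    then show ?thesis by blast
  next
    fix a b c d u v
    assume K33: "distinct [a, b, c, d, u, v]" "\<forall>p\<in>{a, b, v}. \<forall>q\<in>{c, d, u}. adj p q"
    have "bip {a, b, v} {c, d, u}"
      unfolding bip_def using K33 EV Esym by auto
    from K33_decomposition[OF this] show ?thesis
    proof (elim disjE exE conjE)
      fix A B
      assume AB: "bip A B" "pverts G = A \<union> B" "\<forall>u v. adj u v \<longrightarrow> (u \<in> A \<longleftrightarrow> v \<in> B)"
      have f: "finite A" "finite B" using bip_fin[OF AB(1)] by auto
      have e: "adj s t" "adj t s" if "s \<in> A" "t \<in> B" for s t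
        using AB(1) that Esym unfolding bip_def by blast+
      have "A \<inter> B = {}" using e Eirr by blast
      moreover have "parcs G = A \<times> B \<union> B \<times> A"
      proof (intro set_eqI iffI)
        fix e' assume e': "e' \<in> parcs G"
        obtain s t where st: "e' = (s, t)" by (cases e')
        then have "s \<in> A \<union> B" "t \<in> A \<union> B" "s \<in> A \<longleftrightarrow> t \<in> B" "t \<in> A \<longleftrightarrow> s \<in> B"
          using e' EV Esym AB(2,3) by blast+
        then show "e' \<in> A \<times> B \<union> B \<times> A" using st by blast
      qed (use e in auto)
      ultimately have "complete_bipartite_digraph (card A) (card B) (with_proj G)"
        unfolding complete_bipartite_digraph_pair_def using AB(2) f by auto
      moreover have "0 < card A" "0 < card B" using AB(1) unfolding bip_def by auto
      ultimately show ?thesis unfolding complete_bipartite_def by blast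
    next
      fix C u v
      assume C: "C \<subseteq> pverts G" "card C \<le> 2" "\<forall>x\<in>C. \<forall>y\<in>C. x \<noteq> y \<longrightarrow> adj x y"
        "u \<in> pverts G - C" "v \<in> pverts G - C" "\<not> conn (pverts G - C) u v"
      then show ?thesis using cutsetI[OF C(1,4,5,6)] unfolding clique_def by blast
    qed
  qed
qed blast

end

theorem theorem3p8:
  fixes G :: "'a pair_pre_digraph"
  assumes "pair_graph G"
    and "triangle_free G"
    and "ISK4_free G"
  shows "series_parallel G
    \<or> complete_bipartite G
    \<or> (\<exists>C. clique G C \<and> cutset G C \<and> card C \<le> 2)
    \<or> wheel_decomposition G"
  using assms by (intro triangle_ISK4_free_pair_graph.decomposition triangle_ISK4_free_pair_graph.intro)

end
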